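(* Let $T>0$ and assume $(\mathbf{a1})$, $(\mathbf{a2})$, $(\mathbf{a3})$, $(\mathbf{h1})$, $(\mathbf{h2})$ (stated in the context). With $h(x,\mu,z)=\min_{a\in\mathbb R^{d_\alpha}}(f(x,\mu,a)\cdot z+g(x,\mu,a))$, the Bellman equation $$\partial_tv(t,m)+\int_{\mathbb R^{d_x}}h(x,m,\partial_mv(t,m)(x))\,dm(x)=0,\qquad v(T,m)=\int_{\mathbb R^{d_x}}k(x,m)\,dm(x)$$ on $[0,T]\times\mathcal P_2(\mathbb R^{d_x})$ has at most one solution $v(t,m)$ with the following regularity: $v$ is differentiable in $t\in[0,T]$ and $L$-differentiable in $m\in\mathcal P_2(\mathbb R^{d_x})$ with $\partial_tv(t,m)$ and $\partial_mv(t,m)(x)$ continuous in their corresponding arguments; $\partial_tv(t,m)$ is differentiable in $t\in[0,T]$ and $L$-differentiable in $m$; and $\partial_mv(t,m)(x)$ is differentiable in $t\in[0,T]$, $x\in\mathbb R^{d_x}$ and $L$-differentiable in $m$.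
   Context: **Notation.** $\mathcal P_2(\mathbb R^d)$: Borel probability measures on $\mathbb R^d$ with finite second moment; $W_p$: $p$-Wasserstein metric; $\|\mu\|_p=(\int|x|^pd\mu)^{1/p}$; $\delta_0$: Dirac mass at $0$; $\|\cdot\|$: operator norm of (multi)linear maps; $a\vee b=\max\{a,b\}$. $\partial_m$ and $\partial_\mu$ both denote the $L$-derivative. **Derivatives in measure.** $h:\mathcal P_2(\mathbb R^d)\to\mathbb R$ has linear functional derivative $\frac{\delta h}{\delta\mu}(\mu)(x)$ if this function is jointly continuous, $|\frac{\delta h}{\delta\mu}(\mu)(x)|\le c(\mu)(1+|x|^2)$ with $c$ bounded on bounded sets, and $h(\nu_1)-h(\nu_2)=\int_0^1\int\frac{\delta h}{\delta\mu}(\theta\nu_1+(1-\theta)\nu_2)(x)\,d(\nu_1-\nu_2)(x)d\theta$; normalization $\int\frac{\delta h}{\delta\mu}(\mu)d\mu=0$. A second-order linear functional derivative $\frac{\delta^2h}{\delta\mu^2}(\mu)(x,\tilde x)$ is jointly continuous, bounded by $c(\mu)(1+|x|^2+|\tilde x|^2)$, has zero $\mu$-integral in each variable, and satisfies $h(\nu_1)-h(\nu_2)=\int\frac{\delta h}{\delta\mu}(\nu_2)d(\nu_1-\nu_2)+\int_0^1\int_0^1\iint\theta\frac{\delta^2h}{\delta\mu^2}(\nu_2+\lambda\theta(\nu_1-\nu_2))(x,\tilde x)d(\nu_1-\nu_2)(x)d(\nu_1-\nu_2)(\tilde x)d\lambda d\theta$. $h$ is second-order regularly differentiable if both exist and $\partial_x\partial_x\frac{\delta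 h}{\delta\mu}$, $\partial_x\partial_{\tilde x}\frac{\delta^2h}{\delta\mu^2}$ are jointly continuous and bounded by $c(\mu)$. $h$ is $L$-differentiable at $\mu$ if the lift $X\mapsto h(\mathrm{Law}(X))$ on square-integrable random vectors is Fréchet differentiable at some $X$ with law $\mu$; the derivative is represented by $\partial_\mu h(\mu)(X)$, and $\partial_\mu h(\mu)(x)=\partial_x\frac{\delta h}{\delta\mu}(\mu)(x)$ for regularly differentiable $h$. Also $\partial_\mu\partial_\mu h(\mu)(\tilde x,\hat x)=\partial_{\tilde x}\partial_{\hat x}\frac{\delta^2h}{\delta\mu^2}(\mu)(\tilde x,\hat x)$. For vector-valued maps everything is componentwise. **(a1)** $f:\mathbb R^{d_x}\times\mathcal P_2(\mathbb R^{d_x})\times\mathbb R^{d_\alpha}\to\mathbb R^{d_x}$ is twice differentiable in $x,\alpha$, second-order regularly differentiable in $\mu$, with jointly continuous derivatives, and for constants $\lambda_f,\Lambda_f,\bar l_f,\mathrm{Lip}_f>0$ and all arguments: (i) $\sum_{i,j}(\xi_i\partial_\alpha f_i)\cdot(\xi_j\partial_\alpha f_j)\ge\lambda_f|\xi|^2$ for $\xi\in\mathbb R^{d_x}$; (ii) $\|\partial_\alpha f\|\vee\|\partial_\mu f(x,\mu,\alpha)(\tilde x)\|\vee\|\partial_xf\|\le\Lambda_f$; (iii) each of $\partial_\mu\partial_\mu f(x,\mu,\alpha)(\tilde x,\hat x)$, $\partial_\alpha\partial_\alpha f$, $\partial_\mu\partial_\alpha f(\cdot)(\tilde x)$, $\partial_\alpha\partial_xf$,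 $\partial_x\partial_xf$, $\partial_{\tilde x}\partial_\mu f(\cdot)(\tilde x)$, $\partial_x\partial_\mu f(\cdot)(\tilde x)$ has norm at most $\bar l_f/(1+|x|+\|\mu\|_1)$; (iv) each of these is jointly Lipschitz with constant $\mathrm{Lip}_f/(1+\max\{|x|,|x'|\}+\max\{\|\mu\|_1,\|\mu'\|_1\})$ with respect to $|x-x'|+W_2(\mu,\mu')+|\alpha-\alpha'|$ (plus $|\tilde x-\tilde x'|$, $|\hat x-\hat x'|$ when these variables occur). **(a2)** $g:\mathbb R^{d_x}\times\mathcal P_2(\mathbb R^{d_x})\times\mathbb R^{d_\alpha}\to\mathbb R$ is twice differentiable in $x,\alpha$, second-order regularly differentiable in $\mu$, with jointly Lipschitz second-order derivatives, and for constants $\lambda_g,\Lambda_g,\bar l_g>0$, $l_g\ge0$: (i) $\xi^\top\partial_\alpha\partial_\alpha g\,\xi\ge\lambda_g|\xi|^2$; (ii) with $G(x,\mu,\alpha):=g(x,\mu,\alpha)+\int\frac{\delta}{\delta\mu}g(\tilde x,\mu,\alpha)(x)d\mu(\tilde x)$: $\xi^\top\partial_x\partial_xG\,\xi\ge\lambda_g|\xi|^2$ and $\int(G(x,\mu',\alpha)-G(x,\mu,\alpha))d(\mu'-\mu)(x)\ge-l_g|\int y\,d(\mu-\mu')(y)|^2$ for all $\mu,\mu',\alpha$, with $l_g\le\frac12\lambda_g$; (iii) the norms of $\partial_\mu\partial_\mu g(\cdot)(\tilde x,\hat x)$, $\partial_\alpha\partial_\alpha g$, $\partial_x\partial_\mu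 g(\cdot)(\tilde x)$, $\partial_x\partial_xg$, $\partial_{\tilde x}\partial_\mu g(\cdot)(\tilde x)$ are $\le\Lambda_g$, and those of $\partial_x\partial_\alpha g$, $\partial_\alpha\partial_\mu g(\cdot)(\tilde x)$ are $\le\bar l_g$. **(a3)** $k:\mathbb R^{d_x}\times\mathcal P_2(\mathbb R^{d_x})\to\mathbb R$ is twice differentiable in $x$, second-order regularly differentiable in $\mu$, with jointly Lipschitz second-order derivatives, and for constants $\lambda_k,\Lambda_k>0$, $l_k\ge0$: (i) with $K(x,\mu):=k(x,\mu)+\int\frac{\delta}{\delta\mu}k(\tilde x,\mu)(x)d\mu(\tilde x)$: $\xi^\top\partial_x\partial_xK\,\xi\ge\lambda_k|\xi|^2$ and $\int(K(x,\mu')-K(x,\mu))d(\mu'-\mu)(x)\ge-l_k|\int y\,d(\mu-\mu')(y)|^2$, with $l_k\le\frac12\lambda_k$; (ii) the norms of $\partial_\mu\partial_\mu k(\cdot)(\tilde x,\hat x)$, $\partial_x\partial_\mu k(\cdot)(\tilde x)$, $\partial_x\partial_xk$, $\partial_{\tilde x}\partial_\mu k(\cdot)(\tilde x)$ are $\le\Lambda_k$. **Constants.** $\bar L_k=3\Lambda_k$; $\lambda_z=\frac{\lambda_f^2}{\Lambda_g+\lambda_g/20}$, $\lambda_x=\frac{17}{20}\lambda_g$, $\bar\lambda_k=\frac14\lambda_k$, $\bar\lambda_z=\frac12\lambda_z$, $\bar\lambda_x=\frac1{40}\lambda_g$; $\kappa_1=\min\{\frac{\lambda_k}4,\frac{\lambda_z}2,\frac{\lambda_g}{40}\}$,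 $\kappa_2=\min\{\frac{\lambda_k}4,\frac{\lambda_z}4,\frac{\lambda_g}5\}$; $L_1^*=\max\{\frac{4\Lambda_k^2}{\lambda_k},\frac1{\lambda_z}(2\Lambda_g+\frac3{20}\lambda_g),\frac1{\lambda_x}(\frac52\Lambda_f+2\Lambda_g+\frac3{20}\lambda_g)\}$; $L_4^*=\max\{\frac{\Lambda_k^2}{\kappa_1\lambda_k},\frac1{4\kappa_1\lambda_x}(\frac{25}{16}\Lambda_f^2+(2\Lambda_g+\frac15\lambda_g)^2)\}$; $L_5^*=\max\{\frac{9\Lambda_k^2}{4\kappa_2\bar\lambda_k},\frac{25\Lambda_f^2}{64\kappa_2\bar\lambda_z},\frac1{4\kappa_2\bar\lambda_x}(\frac{25}{16}\Lambda_f^2+9(\frac1{10}\lambda_g+\Lambda_g)^2)\}$; $L_6^*=\max\{\frac{27\Lambda_k^2}{\bar\lambda_k},\frac{\Lambda_g+\lambda_g/10}{\bar\lambda_x},\frac{\Lambda_g+\lambda_g/10}{\bar\lambda_z},\frac{12\Lambda_k^2}{\lambda_k},\frac{2\Lambda_g+\lambda_g/5}{\lambda_x},\frac{6\Lambda_k^2}{\bar\lambda_k},\frac{2\Lambda_g+3\lambda_g/20}{\bar\lambda_x},\frac{\frac{15}4\Lambda_f+7\Lambda_g+\frac{13}{20}\lambda_g}{\bar\lambda_z}\}$; $L_0^*=d_x\max\{L_1^*,\sqrt{(L_4^*(2+L_5^* )+1)L_1^*L_6^*}\}$. **(h1)** $f(0,\delta_0,0)=0$, $\partial_xg(0,\delta_0,0)=0$,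 $\partial_\alpha g(0,\delta_0,0)=0$, $\partial_\mu g(0,\delta_0,0)(0)=0$, $\partial_xk(0,\delta_0)=0$, $\partial_\mu k(0,\delta_0)(0)=0$. **(h2)** $8\bar l_g\le\lambda_g$ and $\bar l_f\le\frac{\lambda_g}{40\max\{\bar L_k,L_0^*\}}$. *)

theory Defs
  imports "HOL-Probability.Probability"
begin

section \<open>The Wasserstein space\<close>

definition P2 :: "'x::euclidean_space measure set" where
  "P2 = {\<mu>. sets \<mu> = sets borel \<and> prob_space \<mu> \<and> integrable \<mu> (\<lambda>x. (norm x)\<^sup>2)}"

definition mnorm :: "real \<Rightarrow> 'x::euclidean_space measure \<Rightarrow> real" where
  "mnorm p \<mu> = (\<integral>x. norm x powr p \<partial>\<mu>) powr (1 / p)"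

definition couplings :: "'x::euclidean_space measure \<Rightarrow> 'x measure \<Rightarrow> ('x \<times> 'x) measure set" where
  "couplings \<mu> \<nu> = {\<pi>. sets \<pi> = sets borel \<and> distr \<pi> borel fst = \<mu> \<and> distr \<pi> borel snd = \<nu>}"

text \<open>Only used for measures with finite \<open>p\<close>-th moment, where all the integrals below are finite.\<close>

definition wasserstein :: "real \<Rightarrow> 'x::euclidean_space measure \<Rightarrow> 'x measure \<Rightarrow> real" where
  "wasserstein p \<mu> \<nu> =
     (INF \<pi>\<in>couplings \<mu> \<nu>. \<integral>z. norm (fst z - snd z) powr p \<partial>\<pi>) powr (1 / p)"

abbreviation dirac0 :: "'x::euclidean_space measure" where
  "dirac0 \<equiv> return borel 0"

text \<open>\<open>mix \<theta> \<mu> \<nu>\<close> is \<open>\<theta> \<mu> + (1 - \<theta>) \<nu>\<close>, and \<open>int_diff \<mu> \<nu> \<phi>\<close> is the integral of \<open>\<phi>\<close>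
  against the signed measure \<open>\<mu> - \<nu>\<close>.\<close>

definition mix :: "real \<Rightarrow> 'x::euclidean_space measure \<Rightarrow> 'x measure \<Rightarrow> 'x measure" where
  "mix \<theta> \<mu> \<nu> = measure_of UNIV (sets borel)
     (\<lambda>A. ennreal \<theta> * emeasure \<mu> A + ennreal (1 - \<theta>) * emeasure \<nu> A)"

definition int_diff :: "'x measure \<Rightarrow> 'x measure \<Rightarrow>
    ('x \<Rightarrow> 'b::{banach, second_countable_topology}) \<Rightarrow> 'b" where
  "int_diff \<mu> \<nu> \<phi> = (\<integral>x. \<phi> x \<partial>\<mu>) - (\<integral>x. \<phi> x \<partial>\<nu>)"

text \<open>Joint continuity in a (tuple of) Euclidean variable(s) ranging over \<open>S\<close> and a measure,
  the latter with respect to \<open>W\<^sub>2\<close>.\<close>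

definition jcont :: "'p::metric_space set \<Rightarrow>
    ('p \<Rightarrow> 'x::euclidean_space measure \<Rightarrow> 'b::metric_space) \<Rightarrow> bool" where
  "jcont S F \<longleftrightarrow> (\<forall>p\<in>S. \<forall>\<mu>\<in>P2. \<forall>\<epsilon>>0. \<exists>\<delta>>0. \<forall>p'\<in>S. \<forall>\<mu>'\<in>P2.
     dist p' p < \<delta> \<longrightarrow> wasserstein 2 \<mu>' \<mu> < \<delta> \<longrightarrow> dist (F p' \<mu>') (F p \<mu>) < \<epsilon>)"

definition bounded_on_bounded :: "('x::euclidean_space measure \<Rightarrow> real) \<Rightarrow> bool" where
  "bounded_on_bounded c \<longleftrightarrow> (\<forall>R. \<exists>C. \<forall>\<mu>\<in>P2. mnorm 2 \<mu> \<le> R \<longrightarrow> c \<mu> \<le> C)"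

section \<open>Derivatives\<close>

text \<open>The derivative of \<open>F\<close> at \<open>x\<close> as a bounded linear map; its norm is the operator norm. Iterating
  gives curried multilinear maps, again with the operator norm.\<close>

definition fd :: "('a::real_normed_vector \<Rightarrow> 'b::real_normed_vector) \<Rightarrow> 'a \<Rightarrow> 'a \<Rightarrow>\<^sub>L 'b" where
  "fd F x = Blinfun (frechet_derivative F (at x))"

definition grad :: "('a::euclidean_space \<Rightarrow> real) \<Rightarrow> 'a \<Rightarrow> 'a" where
  "grad F x = (\<Sum>e\<in>Basis. fd F x e *\<^sub>R e)"

subsection \<open>Linear functional derivatives\<close>

definition has_lfd_real :: "('x::euclidean_space measure \<Rightarrow> real) \<Rightarrow>
    ('x measure \<Rightarrow> 'x \<Rightarrow> real) \<Rightarrow> bool" where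
  "has_lfd_real h D \<longleftrightarrow>
     jcont UNIV (\<lambda>x \<mu>. D \<mu> x) \<and>
     (\<exists>c. bounded_on_bounded c \<and> (\<forall>\<mu>\<in>P2. \<forall>x. \<bar>D \<mu> x\<bar> \<le> c \<mu> * (1 + (norm x)\<^sup>2))) \<and>
     (\<forall>\<nu>1\<in>P2. \<forall>\<nu>2\<in>P2.
        h \<nu>1 - h \<nu>2 = integral {0..1} (\<lambda>\<theta>. int_diff \<nu>1 \<nu>2 (D (mix \<theta> \<nu>1 \<nu>2)))) \<and>
     (\<forall>\<mu>\<in>P2. (\<integral>x. D \<mu> x \<partial>\<mu>) = 0)"

text \<open>\<open>D\<close> is the first-order derivative. Note that
  \<open>mix (\<lambda> \<theta>) \<nu>1 \<nu>2 = \<nu>2 + \<lambda> \<theta> (\<nu>1 - \<nu>2)\<close>; in the code \<open>s\<close> stands for \<open>\<lambda>\<close>.\<close>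

definition has_lfd2_real :: "('x::euclidean_space measure \<Rightarrow> real) \<Rightarrow>
    ('x measure \<Rightarrow> 'x \<Rightarrow> real) \<Rightarrow> ('x measure \<Rightarrow> 'x \<Rightarrow> 'x \<Rightarrow> real) \<Rightarrow> bool" where
  "has_lfd2_real h D H \<longleftrightarrow>
     jcont UNIV (\<lambda>(x, y) \<mu>. H \<mu> x y) \<and>
     (\<exists>c. bounded_on_bounded c \<and>
        (\<forall>\<mu>\<in>P2. \<forall>x y. \<bar>H \<mu> x y\<bar> \<le> c \<mu> * (1 + (norm x)\<^sup>2 + (norm y)\<^sup>2))) \<and>
     (\<forall>\<mu>\<in>P2. (\<forall>y. (\<integral>x. H \<mu> x y \<partial>\<mu>) = 0) \<and> (\<forall>x. (\<integral>y. H \<mu> x y \<partial>\<mu>) = 0)) \<and>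
     (\<forall>\<nu>1\<in>P2. \<forall>\<nu>2\<in>P2.
        h \<nu>1 - h \<nu>2 = int_diff \<nu>1 \<nu>2 (D \<nu>2) +
          integral {0..1} (\<lambda>\<theta>. integral {0..1} (\<lambda>s.
            \<theta> * int_diff \<nu>1 \<nu>2 (\<lambda>y. int_diff \<nu>1 \<nu>2 (\<lambda>x. H (mix (s * \<theta>) \<nu>1 \<nu>2) x y)))))"

text \<open>Vector-valued maps are treated componentwise. Values lie in a finite-dimensional space, possibly
  of linear maps, and the components are taken with respect to all linear functionals \<open>\<phi>\<close>.\<close>

definition has_lfd :: "('x::euclidean_space measure \<Rightarrow> 'b::real_normed_vector) \<Rightarrow>
    ('x measure \<Rightarrow> 'x \<Rightarrow> 'b) \<Rightarrow> bool" where
  "has_lfd h D \<longleftrightarrow>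
     (\<forall>\<phi> :: 'b \<Rightarrow>\<^sub>L real. has_lfd_real (\<lambda>\<mu>. \<phi> (h \<mu>)) (\<lambda>\<mu> x. \<phi> (D \<mu> x)))"

definition has_lfd2 :: "('x::euclidean_space measure \<Rightarrow> 'b::real_normed_vector) \<Rightarrow>
    ('x measure \<Rightarrow> 'x \<Rightarrow> 'b) \<Rightarrow> ('x measure \<Rightarrow> 'x \<Rightarrow> 'x \<Rightarrow> 'b) \<Rightarrow> bool" where
  "has_lfd2 h D H \<longleftrightarrow>
     (\<forall>\<phi> :: 'b \<Rightarrow>\<^sub>L real.
        has_lfd2_real (\<lambda>\<mu>. \<phi> (h \<mu>)) (\<lambda>\<mu> x. \<phi> (D \<mu> x)) (\<lambda>\<mu> x y. \<phi> (H \<mu> x y)))"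

text \<open>The normalised linear functional derivative is unique on \<open>P2\<close>.\<close>

definition lfd :: "('x::euclidean_space measure \<Rightarrow> 'b::real_normed_vector) \<Rightarrow>
    'x measure \<Rightarrow> 'x \<Rightarrow> 'b" where
  "lfd h = (SOME D. has_lfd h D)"

definition mixed_deriv :: "('x::euclidean_space \<Rightarrow> 'x \<Rightarrow> 'b::real_normed_vector) \<Rightarrow>
    'x \<Rightarrow> 'x \<Rightarrow> 'x \<Rightarrow>\<^sub>L 'x \<Rightarrow>\<^sub>L 'b" where
  "mixed_deriv H x y = fd (\<lambda>x'. fd (\<lambda>y'. H x' y') y) x"

text \<open>Second-order regular differentiability. The second-order linear functional derivative \<open>H\<close> is an
  explicit argument because its defining expansion fixes only the symmetric part of \<open>H\<close>.\<close>

definition regular2 :: "('x::euclidean_space measure \<Rightarrow> 'b::real_normed_vector) \<Rightarrow>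
    ('x measure \<Rightarrow> 'x \<Rightarrow> 'x \<Rightarrow> 'b) \<Rightarrow> bool" where
  "regular2 h H \<longleftrightarrow>
     has_lfd h (lfd h) \<and> has_lfd2 h (lfd h) H \<and>
     (\<forall>\<mu>\<in>P2. \<forall>x. lfd h \<mu> differentiable (at x) \<and> fd (lfd h \<mu>) differentiable (at x)) \<and>
     (\<forall>\<mu>\<in>P2. \<forall>x y. H \<mu> x differentiable (at y) \<and>
        (\<lambda>x'. fd (H \<mu> x') y) differentiable (at x)) \<and>
     jcont UNIV (\<lambda>x \<mu>. fd (fd (lfd h \<mu>)) x) \<and>
     jcont UNIV (\<lambda>(x, y) \<mu>. mixed_deriv (H \<mu>) x y) \<and>
     (\<exists>c. bounded_on_bounded c \<and>
        (\<forall>\<mu>\<in>P2. \<forall>x. norm (fd (fd (lfd h \<mu>)) x) \<le> c \<mu>) \<and>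
        (\<forall>\<mu>\<in>P2. \<forall>x y. norm (mixed_deriv (H \<mu>) x y) \<le> c \<mu>))"

subsection \<open>The L-derivative\<close>

text \<open>The lift lives on the unit interval with Lebesgue measure, which is atomless and hence carries
  random vectors of every law.\<close>

definition Omega :: "real measure" where
  "Omega = uniform_measure lborel {0..1}"

definition sq_integrable :: "(real \<Rightarrow> 'b::real_normed_vector) \<Rightarrow> bool" where
  "sq_integrable X \<longleftrightarrow> X \<in> borel_measurable Omega \<and> integrable Omega (\<lambda>\<omega>. (norm (X \<omega>))\<^sup>2)"

definition l2norm :: "(real \<Rightarrow> 'b::real_normed_vector) \<Rightarrow> real" where
  "l2norm X = sqrt (\<integral>\<omega>. (norm (X \<omega>))\<^sup>2 \<partial>Omega)"

text \<open>\<open>h\<close> is L-differentiable at \<open>\<mu>\<close> with derivative represented by \<open>D\<close>: at some \<open>X\<close> of law \<open>\<mu>\<close> the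
  lift has Frechet derivative \<open>Y \<mapsto> E (D(X) Y)\<close> on square-integrable random vectors.
  For real-valued \<open>h\<close>, \<open>D x\<close> is the linear functional given by the gradient vector at \<open>x\<close>.\<close>

definition has_L_deriv :: "('x::euclidean_space measure \<Rightarrow> 'b::real_normed_vector) \<Rightarrow>
    'x measure \<Rightarrow> ('x \<Rightarrow> 'x \<Rightarrow>\<^sub>L 'b) \<Rightarrow> bool" where
  "has_L_deriv h \<mu> D \<longleftrightarrow>
     D \<in> borel_measurable borel \<and>
     (\<exists>X. sq_integrable X \<and> distr Omega borel X = \<mu> \<and> sq_integrable (\<lambda>\<omega>. D (X \<omega>)) \<and>
        (\<forall>\<phi> :: 'b \<Rightarrow>\<^sub>L real. \<forall>\<epsilon>>0. \<exists>\<delta>>0. \<forall>Y. sq_integrable Y \<longrightarrow> l2norm Y < \<delta> \<longrightarrow>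
           \<bar>\<phi> (h (distr Omega borel (\<lambda>\<omega>. X \<omega> + Y \<omega>))) - \<phi> (h (distr Omega borel X))
              - (\<integral>\<omega>. \<phi> (D (X \<omega>) (Y \<omega>)) \<partial>Omega)\<bar> \<le> \<epsilon> * l2norm Y))"

definition L_differentiable :: "('x::euclidean_space measure \<Rightarrow> 'b::real_normed_vector) \<Rightarrow>
    'x measure \<Rightarrow> bool" where
  "L_differentiable h \<mu> \<longleftrightarrow> (\<exists>D. has_L_deriv h \<mu> D)"

text \<open>At a single \<open>\<mu>\<close> the representative is determined only \<open>\<mu>\<close>-almost everywhere. The jointly
  continuous version is unique on \<open>P2\<close>, because the measures of full support are \<open>W\<^sub>2\<close>-dense.
  For regularly differentiable \<open>h\<close> it exists and is the spatial derivative of \<open>lfd h\<close>.\<close>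

definition has_L_deriv_cont :: "('x::euclidean_space measure \<Rightarrow> 'b::real_normed_vector) \<Rightarrow>
    ('x measure \<Rightarrow> 'x \<Rightarrow> 'x \<Rightarrow>\<^sub>L 'b) \<Rightarrow> bool" where
  "has_L_deriv_cont h D \<longleftrightarrow>
     (\<forall>\<mu>\<in>P2. has_L_deriv h \<mu> (D \<mu>)) \<and> jcont UNIV (\<lambda>x \<mu>. D \<mu> x)"

definition L_deriv :: "('x::euclidean_space measure \<Rightarrow> 'b::real_normed_vector) \<Rightarrow>
    'x measure \<Rightarrow> 'x \<Rightarrow> 'x \<Rightarrow>\<^sub>L 'b" where
  "L_deriv h = (SOME D. has_L_deriv_cont h D)"

section \<open>Assumptions on the coefficients\<close>

text \<open>Partial derivatives of functions of \<open>(x, \<mu>, \<alpha>)\<close>.\<close>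

definition d_x :: "('x::euclidean_space \<Rightarrow> 'x measure \<Rightarrow> 'a::euclidean_space \<Rightarrow> 'b::real_normed_vector) \<Rightarrow>
    'x \<Rightarrow> 'x measure \<Rightarrow> 'a \<Rightarrow> 'x \<Rightarrow>\<^sub>L 'b" where
  "d_x F x \<mu> \<alpha> = fd (\<lambda>x'. F x' \<mu> \<alpha>) x"

definition d_a :: "('x::euclidean_space \<Rightarrow> 'x measure \<Rightarrow> 'a::euclidean_space \<Rightarrow> 'b::real_normed_vector) \<Rightarrow>
    'x \<Rightarrow> 'x measure \<Rightarrow> 'a \<Rightarrow> 'a \<Rightarrow>\<^sub>L 'b" where
  "d_a F x \<mu> \<alpha> = fd (\<lambda>\<alpha>'. F x \<mu> \<alpha>') \<alpha>"

definition d_mu :: "('x::euclidean_space \<Rightarrow> 'x measure \<Rightarrow> 'a::euclidean_space \<Rightarrow> 'b::real_normed_vector) \<Rightarrow>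
    'x \<Rightarrow> 'x measure \<Rightarrow> 'a \<Rightarrow> 'x \<Rightarrow> 'x \<Rightarrow>\<^sub>L 'b" where
  "d_mu F x \<mu> \<alpha> y = L_deriv (\<lambda>\<mu>'. F x \<mu>' \<alpha>) \<mu> y"

definition diff_x :: "('x::euclidean_space \<Rightarrow> 'x measure \<Rightarrow> 'a::euclidean_space \<Rightarrow> 'b::real_normed_vector) \<Rightarrow> bool" where
  "diff_x F \<longleftrightarrow> (\<forall>x. \<forall>\<mu>\<in>P2. \<forall>\<alpha>. (\<lambda>x'. F x' \<mu> \<alpha>) differentiable (at x))"

definition diff_a :: "('x::euclidean_space \<Rightarrow> 'x measure \<Rightarrow> 'a::euclidean_space \<Rightarrow> 'b::real_normed_vector) \<Rightarrow> bool" where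
  "diff_a F \<longleftrightarrow> (\<forall>x. \<forall>\<mu>\<in>P2. \<forall>\<alpha>. (\<lambda>\<alpha>'. F x \<mu> \<alpha>') differentiable (at \<alpha>))"

definition twice_diff :: "('x::euclidean_space \<Rightarrow> 'x measure \<Rightarrow> 'a::euclidean_space \<Rightarrow> 'b::real_normed_vector) \<Rightarrow> bool" where
  "twice_diff F \<longleftrightarrow> diff_x F \<and> diff_a F \<and>
     diff_x (d_x F) \<and> diff_a (d_x F) \<and> diff_x (d_a F) \<and> diff_a (d_a F)"

text \<open>Functions of \<open>(x, \<mu>, \<alpha>, y, z)\<close>, where \<open>y\<close> and \<open>z\<close> are the additional variables of derivatives in the
  measure. A function that does not depend on some of these variables is covered as well: choosing
  equal values for them removes their contribution from the right-hand side.\<close>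

definition jlip :: "('x \<Rightarrow> 'x measure \<Rightarrow> 'x \<Rightarrow> 'x measure \<Rightarrow> real) \<Rightarrow>
    ('x::euclidean_space \<Rightarrow> 'x measure \<Rightarrow> 'a::euclidean_space \<Rightarrow> 'x \<Rightarrow> 'x \<Rightarrow> 'b::real_normed_vector) \<Rightarrow> bool" where
  "jlip C F \<longleftrightarrow> (\<forall>x x'. \<forall>\<mu>\<in>P2. \<forall>\<mu>'\<in>P2. \<forall>\<alpha> \<alpha>' y y' z z'.
     norm (F x \<mu> \<alpha> y z - F x' \<mu>' \<alpha>' y' z') \<le>
       C x \<mu> x' \<mu>' * (norm (x - x') + wasserstein 2 \<mu> \<mu>' + norm (\<alpha> - \<alpha>')
         + norm (y - y') + norm (z - z')))"

definition jlipschitz ::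
    "('x::euclidean_space \<Rightarrow> 'x measure \<Rightarrow> 'a::euclidean_space \<Rightarrow> 'x \<Rightarrow> 'x \<Rightarrow> 'b::real_normed_vector) \<Rightarrow> bool" where
  "jlipschitz F \<longleftrightarrow> (\<exists>L. jlip (\<lambda>_ _ _ _. L) F)"

definition jcont_all ::
    "('x::euclidean_space \<Rightarrow> 'x measure \<Rightarrow> 'a::euclidean_space \<Rightarrow> 'x \<Rightarrow> 'x \<Rightarrow> 'b::real_normed_vector) \<Rightarrow> bool" where
  "jcont_all F \<longleftrightarrow> jcont UNIV (\<lambda>(x, \<alpha>, y, z) \<mu>. F x \<mu> \<alpha> y z)"

definition norm_le ::
    "('x::euclidean_space \<Rightarrow> 'x measure \<Rightarrow> 'a::euclidean_space \<Rightarrow> 'x \<Rightarrow> 'x \<Rightarrow> 'b::real_normed_vector) \<Rightarrow>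
      real \<Rightarrow> bool" where
  "norm_le F B \<longleftrightarrow> (\<forall>x. \<forall>\<mu>\<in>P2. \<forall>\<alpha> y z. norm (F x \<mu> \<alpha> y z) \<le> B)"

definition decaying :: "real \<Rightarrow> real \<Rightarrow>
    ('x::euclidean_space \<Rightarrow> 'x measure \<Rightarrow> 'a::euclidean_space \<Rightarrow> 'x \<Rightarrow> 'x \<Rightarrow> 'b::real_normed_vector) \<Rightarrow> bool" where
  "decaying lbar Lip F \<longleftrightarrow>
     jcont_all F \<and>
     (\<forall>x. \<forall>\<mu>\<in>P2. \<forall>\<alpha> y z. norm (F x \<mu> \<alpha> y z) \<le> lbar / (1 + norm x + mnorm 1 \<mu>)) \<and>
     jlip (\<lambda>x \<mu> x' \<mu>'.
       Lip / (1 + max (norm x) (norm x') + max (mnorm 1 \<mu>) (mnorm 1 \<mu>'))) F"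

definition a1 :: "('x::euclidean_space \<Rightarrow> 'x measure \<Rightarrow> 'a::euclidean_space \<Rightarrow> 'x) \<Rightarrow>
    real \<Rightarrow> real \<Rightarrow> real \<Rightarrow> real \<Rightarrow> bool" where
  "a1 f lam_f Lam_f lbar_f Lip_f \<longleftrightarrow>
     0 < lam_f \<and> 0 < Lam_f \<and> 0 < lbar_f \<and> 0 < Lip_f \<and>
     twice_diff f \<and>
     (\<forall>y. diff_x (\<lambda>x \<mu> \<alpha>. d_mu f x \<mu> \<alpha> y)) \<and>
     (\<forall>x \<alpha>. \<exists>D. has_L_deriv_cont (\<lambda>\<mu>. d_a f x \<mu> \<alpha>) D) \<and>
     jcont_all (\<lambda>x \<mu> \<alpha> y z. d_x f x \<mu> \<alpha>) \<and>
     jcont_all (\<lambda>x \<mu> \<alpha> y z. d_a f x \<mu> \<alpha>) \<and>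
     jcont_all (\<lambda>x \<mu> \<alpha> y z. d_mu f x \<mu> \<alpha> y) \<and>
     (\<forall>x. \<forall>\<mu>\<in>P2. \<forall>\<alpha> \<xi>.
        (\<Sum>i\<in>Basis. \<Sum>j\<in>Basis.
           ((\<xi> \<bullet> i) *\<^sub>R grad (\<lambda>\<alpha>'. f x \<mu> \<alpha>' \<bullet> i) \<alpha>) \<bullet> ((\<xi> \<bullet> j) *\<^sub>R grad (\<lambda>\<alpha>'. f x \<mu> \<alpha>' \<bullet> j) \<alpha>))
        \<ge> lam_f * (norm \<xi>)\<^sup>2) \<and>
     norm_le (\<lambda>x \<mu> \<alpha> y z. d_a f x \<mu> \<alpha>) Lam_f \<and>
     norm_le (\<lambda>x \<mu> \<alpha> y z. d_mu f x \<mu> \<alpha> y) Lam_f \<and>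
     norm_le (\<lambda>x \<mu> \<alpha> y z. d_x f x \<mu> \<alpha>) Lam_f \<and>
     (\<exists>H. (\<forall>x \<alpha>. regular2 (\<lambda>\<mu>. f x \<mu> \<alpha>) (H x \<alpha>)) \<and>
        decaying lbar_f Lip_f (\<lambda>x \<mu> \<alpha> y z. mixed_deriv (H x \<alpha> \<mu>) y z)) \<and>
     decaying lbar_f Lip_f (\<lambda>x \<mu> \<alpha> y z. d_a (d_a f) x \<mu> \<alpha>) \<and>
     decaying lbar_f Lip_f (\<lambda>x \<mu> \<alpha> y z. d_mu (d_a f) x \<mu> \<alpha> y) \<and>
     decaying lbar_f Lip_f (\<lambda>x \<mu> \<alpha> y z. d_a (d_x f) x \<mu> \<alpha>) \<and>
     decaying lbar_f Lip_f (\<lambda>x \<mu> \<alpha> y z. d_x (d_x f) x \<mu> \<alpha>) \<and>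
     decaying lbar_f Lip_f (\<lambda>x \<mu> \<alpha> y z. fd (d_mu f x \<mu> \<alpha>) y) \<and>
     decaying lbar_f Lip_f (\<lambda>x \<mu> \<alpha> y z. d_x (\<lambda>x' \<mu>' \<alpha>'. d_mu f x' \<mu>' \<alpha>' y) x \<mu> \<alpha>)"

text \<open>The functions \<open>G\<close> and \<open>K\<close> attached to the running and the terminal cost; for \<open>G\<close> the
  control \<open>\<alpha>\<close> is a frozen parameter.\<close>

definition potential :: "('x::euclidean_space \<Rightarrow> 'x measure \<Rightarrow> real) \<Rightarrow> 'x \<Rightarrow> 'x measure \<Rightarrow> real" where
  "potential k x \<mu> = k x \<mu> + (\<integral>x'. lfd (k x') \<mu> x \<partial>\<mu>)"

definition convex_monotone :: "real \<Rightarrow> real \<Rightarrow>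
    ('x::euclidean_space \<Rightarrow> 'x measure \<Rightarrow> real) \<Rightarrow> bool" where
  "convex_monotone lam l K \<longleftrightarrow>
     (\<forall>x. \<forall>\<mu>\<in>P2. (\<lambda>y. K y \<mu>) differentiable (at x) \<and> fd (\<lambda>y. K y \<mu>) differentiable (at x) \<and>
        (\<forall>\<xi>. fd (fd (\<lambda>y. K y \<mu>)) x \<xi> \<xi> \<ge> lam * (norm \<xi>)\<^sup>2)) \<and>
     (\<forall>\<mu>\<in>P2. \<forall>\<mu>'\<in>P2.
        int_diff \<mu>' \<mu> (\<lambda>x. K x \<mu>' - K x \<mu>) \<ge> - l * (norm (int_diff \<mu> \<mu>' (\<lambda>y. y)))\<^sup>2)"

definition a2 :: "('x::euclidean_space \<Rightarrow> 'x measure \<Rightarrow> 'a::euclidean_space \<Rightarrow> real) \<Rightarrow>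
    real \<Rightarrow> real \<Rightarrow> real \<Rightarrow> real \<Rightarrow> bool" where
  "a2 g lam_g Lam_g lbar_g l_g \<longleftrightarrow>
     0 < lam_g \<and> 0 < Lam_g \<and> 0 < lbar_g \<and> 0 \<le> l_g \<and> l_g \<le> lam_g / 2 \<and>
     twice_diff g \<and>
     (\<forall>y. diff_x (\<lambda>x \<mu> \<alpha>. d_mu g x \<mu> \<alpha> y)) \<and>
     (\<forall>y. diff_a (\<lambda>x \<mu> \<alpha>. d_mu g x \<mu> \<alpha> y)) \<and>
     (\<forall>x. \<forall>\<mu>\<in>P2. \<forall>\<alpha> \<xi>. d_a (d_a g) x \<mu> \<alpha> \<xi> \<xi> \<ge> lam_g * (norm \<xi>)\<^sup>2) \<and>
     (\<forall>\<alpha>. convex_monotone lam_g l_g (potential (\<lambda>x \<mu>. g x \<mu> \<alpha>))) \<and>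
     (\<exists>H. (\<forall>x \<alpha>. regular2 (\<lambda>\<mu>. g x \<mu> \<alpha>) (H x \<alpha>)) \<and>
        jlipschitz (\<lambda>x \<mu> \<alpha> y z. mixed_deriv (H x \<alpha> \<mu>) y z) \<and>
        norm_le (\<lambda>x \<mu> \<alpha> y z. mixed_deriv (H x \<alpha> \<mu>) y z) Lam_g) \<and>
     jlipschitz (\<lambda>x \<mu> \<alpha> y z. d_a (d_a g) x \<mu> \<alpha>) \<and>
     jlipschitz (\<lambda>x \<mu> \<alpha> y z. d_x (\<lambda>x' \<mu>' \<alpha>'. d_mu g x' \<mu>' \<alpha>' y) x \<mu> \<alpha>) \<and>
     jlipschitz (\<lambda>x \<mu> \<alpha> y z. d_x (d_x g) x \<mu> \<alpha>) \<and>
     jlipschitz (\<lambda>x \<mu> \<alpha> y z. fd (d_mu g x \<mu> \<alpha>) y) \<and>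
     jlipschitz (\<lambda>x \<mu> \<alpha> y z. d_x (d_a g) x \<mu> \<alpha>) \<and>
     jlipschitz (\<lambda>x \<mu> \<alpha> y z. d_a (\<lambda>x' \<mu>' \<alpha>'. d_mu g x' \<mu>' \<alpha>' y) x \<mu> \<alpha>) \<and>
     norm_le (\<lambda>x \<mu> \<alpha> y z. d_a (d_a g) x \<mu> \<alpha>) Lam_g \<and>
     norm_le (\<lambda>x \<mu> \<alpha> y z. d_x (\<lambda>x' \<mu>' \<alpha>'. d_mu g x' \<mu>' \<alpha>' y) x \<mu> \<alpha>) Lam_g \<and>
     norm_le (\<lambda>x \<mu> \<alpha> y z. d_x (d_x g) x \<mu> \<alpha>) Lam_g \<and>
     norm_le (\<lambda>x \<mu> \<alpha> y z. fd (d_mu g x \<mu> \<alpha>) y) Lam_g \<and>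
     norm_le (\<lambda>x \<mu> \<alpha> y z. d_x (d_a g) x \<mu> \<alpha>) lbar_g \<and>
     norm_le (\<lambda>x \<mu> \<alpha> y z. d_a (\<lambda>x' \<mu>' \<alpha>'. d_mu g x' \<mu>' \<alpha>' y) x \<mu> \<alpha>) lbar_g"

text \<open>The terminal cost does not depend on a control; to reuse the definitions above it is given a
  dummy real argument.\<close>

definition a3 :: "('x::euclidean_space \<Rightarrow> 'x measure \<Rightarrow> real) \<Rightarrow> real \<Rightarrow> real \<Rightarrow> real \<Rightarrow> bool" where
  "a3 k lam_k Lam_k l_k \<longleftrightarrow>
     0 < lam_k \<and> 0 < Lam_k \<and> 0 \<le> l_k \<and> l_k \<le> lam_k / 2 \<and>
     (let k' = (\<lambda>x \<mu> (_::real). k x \<mu>) in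
       diff_x k' \<and> diff_x (d_x k') \<and>
       (\<forall>y. diff_x (\<lambda>x \<mu> \<alpha>. d_mu k' x \<mu> \<alpha> y)) \<and>
       convex_monotone lam_k l_k (potential k) \<and>
       (\<exists>H. (\<forall>x. regular2 (k x) (H x)) \<and>
          jlipschitz (\<lambda>x \<mu> (_::real) y z. mixed_deriv (H x \<mu>) y z) \<and>
          norm_le (\<lambda>x \<mu> (_::real) y z. mixed_deriv (H x \<mu>) y z) Lam_k) \<and>
       jlipschitz (\<lambda>x \<mu> \<alpha> y z. d_x (\<lambda>x' \<mu>' \<alpha>'. d_mu k' x' \<mu>' \<alpha>' y) x \<mu> \<alpha>) \<and>
       jlipschitz (\<lambda>x \<mu> \<alpha> y z. d_x (d_x k') x \<mu> \<alpha>) \<and>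
       jlipschitz (\<lambda>x \<mu> \<alpha> y z. fd (d_mu k' x \<mu> \<alpha>) y) \<and>
       norm_le (\<lambda>x \<mu> \<alpha> y z. d_x (\<lambda>x' \<mu>' \<alpha>'. d_mu k' x' \<mu>' \<alpha>' y) x \<mu> \<alpha>) Lam_k \<and>
       norm_le (\<lambda>x \<mu> \<alpha> y z. d_x (d_x k') x \<mu> \<alpha>) Lam_k \<and>
       norm_le (\<lambda>x \<mu> \<alpha> y z. fd (d_mu k' x \<mu> \<alpha>) y) Lam_k)"

definition h1 :: "('x::euclidean_space \<Rightarrow> 'x measure \<Rightarrow> 'a::euclidean_space \<Rightarrow> 'x) \<Rightarrow>
    ('x \<Rightarrow> 'x measure \<Rightarrow> 'a \<Rightarrow> real) \<Rightarrow> ('x \<Rightarrow> 'x measure \<Rightarrow> real) \<Rightarrow> bool" where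
  "h1 f g k \<longleftrightarrow>
     f 0 dirac0 0 = 0 \<and>
     d_x g 0 dirac0 0 = 0 \<and> d_a g 0 dirac0 0 = 0 \<and> d_mu g 0 dirac0 0 0 = 0 \<and>
     fd (\<lambda>x. k x dirac0) 0 = 0 \<and> L_deriv (k 0) dirac0 0 = 0"

section \<open>Constants\<close>

definition Lbar_k :: "real \<Rightarrow> real" where "Lbar_k Lam_k = 3 * Lam_k"

definition lam_z :: "real \<Rightarrow> real \<Rightarrow> real \<Rightarrow> real" where
  "lam_z lam_f lam_g Lam_g = lam_f\<^sup>2 / (Lam_g + lam_g / 20)"

definition lam_x :: "real \<Rightarrow> real" where "lam_x lam_g = 17 / 20 * lam_g"

definition lambar_k :: "real \<Rightarrow> real" where "lambar_k lam_k = 1 / 4 * lam_k"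

definition lambar_z :: "real \<Rightarrow> real \<Rightarrow> real \<Rightarrow> real" where
  "lambar_z lam_f lam_g Lam_g = 1 / 2 * lam_z lam_f lam_g Lam_g"

definition lambar_x :: "real \<Rightarrow> real" where "lambar_x lam_g = 1 / 40 * lam_g"

definition kappa1 :: "real \<Rightarrow> real \<Rightarrow> real \<Rightarrow> real \<Rightarrow> real" where
  "kappa1 lam_f lam_g Lam_g lam_k = Min {lam_k / 4, lam_z lam_f lam_g Lam_g / 2, lam_g / 40}"

definition kappa2 :: "real \<Rightarrow> real \<Rightarrow> real \<Rightarrow> real \<Rightarrow> real" where
  "kappa2 lam_f lam_g Lam_g lam_k = Min {lam_k / 4, lam_z lam_f lam_g Lam_g / 4, lam_g / 5}"

definition L1_star :: "real \<Rightarrow> real \<Rightarrow> real \<Rightarrow> real \<Rightarrow> real \<Rightarrow> real \<Rightarrow> real" where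
  "L1_star lam_f Lam_f lam_g Lam_g lam_k Lam_k = Max {
     4 * Lam_k\<^sup>2 / lam_k,
     1 / lam_z lam_f lam_g Lam_g * (2 * Lam_g + 3 / 20 * lam_g),
     1 / lam_x lam_g * (5 / 2 * Lam_f + 2 * Lam_g + 3 / 20 * lam_g)}"

definition L4_star :: "real \<Rightarrow> real \<Rightarrow> real \<Rightarrow> real \<Rightarrow> real \<Rightarrow> real \<Rightarrow> real" where
  "L4_star lam_f Lam_f lam_g Lam_g lam_k Lam_k =
     (let \<kappa>1 = kappa1 lam_f lam_g Lam_g lam_k in Max {
       Lam_k\<^sup>2 / (\<kappa>1 * lam_k),
       1 / (4 * \<kappa>1 * lam_x lam_g) * (25 / 16 * Lam_f\<^sup>2 + (2 * Lam_g + 1 / 5 * lam_g)\<^sup>2)})"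

definition L5_star :: "real \<Rightarrow> real \<Rightarrow> real \<Rightarrow> real \<Rightarrow> real \<Rightarrow> real \<Rightarrow> real" where
  "L5_star lam_f Lam_f lam_g Lam_g lam_k Lam_k =
     (let \<kappa>2 = kappa2 lam_f lam_g Lam_g lam_k in Max {
       9 * Lam_k\<^sup>2 / (4 * \<kappa>2 * lambar_k lam_k),
       25 * Lam_f\<^sup>2 / (64 * \<kappa>2 * lambar_z lam_f lam_g Lam_g),
       1 / (4 * \<kappa>2 * lambar_x lam_g) * (25 / 16 * Lam_f\<^sup>2 + 9 * (1 / 10 * lam_g + Lam_g)\<^sup>2)})"

definition L6_star :: "real \<Rightarrow> real \<Rightarrow> real \<Rightarrow> real \<Rightarrow> real \<Rightarrow> real \<Rightarrow> real" where
  "L6_star lam_f Lam_f lam_g Lam_g lam_k Lam_k = Max {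
     27 * Lam_k\<^sup>2 / lambar_k lam_k,
     (Lam_g + lam_g / 10) / lambar_x lam_g,
     (Lam_g + lam_g / 10) / lambar_z lam_f lam_g Lam_g,
     12 * Lam_k\<^sup>2 / lam_k,
     (2 * Lam_g + lam_g / 5) / lam_x lam_g,
     6 * Lam_k\<^sup>2 / lambar_k lam_k,
     (2 * Lam_g + 3 * lam_g / 20) / lambar_x lam_g,
     (15 / 4 * Lam_f + 7 * Lam_g + 13 / 20 * lam_g) / lambar_z lam_f lam_g Lam_g}"

definition L0_star :: "nat \<Rightarrow> real \<Rightarrow> real \<Rightarrow> real \<Rightarrow> real \<Rightarrow> real \<Rightarrow> real \<Rightarrow> real" where
  "L0_star d lam_f Lam_f lam_g Lam_g lam_k Lam_k =
     (let L1 = L1_star lam_f Lam_f lam_g Lam_g lam_k Lam_k;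
          L4 = L4_star lam_f Lam_f lam_g Lam_g lam_k Lam_k;
          L5 = L5_star lam_f Lam_f lam_g Lam_g lam_k Lam_k;
          L6 = L6_star lam_f Lam_f lam_g Lam_g lam_k Lam_k
      in real d * max L1 (sqrt ((L4 * (2 + L5) + 1) * L1 * L6)))"

text \<open>\<open>d\<close> is the dimension of the state space.\<close>

definition h2 :: "nat \<Rightarrow> real \<Rightarrow> real \<Rightarrow> real \<Rightarrow> real \<Rightarrow> real \<Rightarrow> real \<Rightarrow> real \<Rightarrow> real \<Rightarrow> bool" where
  "h2 d lam_f Lam_f lbar_f lam_g Lam_g lbar_g lam_k Lam_k \<longleftrightarrow>
     8 * lbar_g \<le> lam_g \<and>
     lbar_f \<le> lam_g / (40 * max (Lbar_k Lam_k) (L0_star d lam_f Lam_f lam_g Lam_g lam_k Lam_k))"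

section \<open>The Bellman equation\<close>

text \<open>The infimum over \<open>a\<close> is attained under the standing assumptions, so that the minimum exists.\<close>

definition hamiltonian :: "('x::euclidean_space \<Rightarrow> 'x measure \<Rightarrow> 'a::euclidean_space \<Rightarrow> 'x) \<Rightarrow>
    ('x \<Rightarrow> 'x measure \<Rightarrow> 'a \<Rightarrow> real) \<Rightarrow> 'x \<Rightarrow> 'x measure \<Rightarrow> 'x \<Rightarrow> real" where
  "hamiltonian f g x \<mu> z = (LEAST y. \<exists>a. y = f x \<mu> a \<bullet> z + g x \<mu> a)"

text \<open>\<open>vt\<close> is the time derivative of \<open>v\<close> and \<open>Dv t m x\<close> the vector representing the L-derivative.
  At the end points of \<open>{0..T}\<close> derivatives in time are one-sided.\<close>

definition regular_solution :: "real \<Rightarrow>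
    ('x::euclidean_space \<Rightarrow> 'x measure \<Rightarrow> 'a::euclidean_space \<Rightarrow> 'x) \<Rightarrow>
    ('x \<Rightarrow> 'x measure \<Rightarrow> 'a \<Rightarrow> real) \<Rightarrow> ('x \<Rightarrow> 'x measure \<Rightarrow> real) \<Rightarrow>
    (real \<Rightarrow> 'x measure \<Rightarrow> real) \<Rightarrow> bool" where
  "regular_solution T f g k v \<longleftrightarrow> (\<exists>(vt :: real \<Rightarrow> 'x measure \<Rightarrow> real) (Dv :: real \<Rightarrow> 'x measure \<Rightarrow> 'x \<Rightarrow> 'x).
     (\<forall>t\<in>{0..T}. \<forall>m\<in>P2.
        ((\<lambda>s. v s m) has_real_derivative vt t m) (at t within {0..T}) \<and>
        has_L_deriv (v t) m (\<lambda>x. blinfun_inner_left (Dv t m x))) \<and>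
     jcont {0..T} vt \<and>
     jcont ({0..T} \<times> UNIV) (\<lambda>(t, x) m. Dv t m x) \<and>
     (\<forall>t\<in>{0..T}. \<forall>m\<in>P2.
        (\<lambda>s. vt s m) differentiable (at t within {0..T}) \<and>
        L_differentiable (vt t) m) \<and>
     (\<forall>t\<in>{0..T}. \<forall>m\<in>P2. \<forall>x.
        (\<lambda>s. Dv s m x) differentiable (at t within {0..T}) \<and>
        Dv t m differentiable (at x) \<and>
        L_differentiable (\<lambda>\<nu>. Dv t \<nu> x) m) \<and>
     (\<forall>t\<in>{0..T}. \<forall>m\<in>P2. vt t m + (\<integral>x. hamiltonian f g x m (Dv t m x) \<partial>m) = 0) \<and>
     (\<forall>m\<in>P2. v T m = (\<integral>x. k x m \<partial>m)))"

end

theory Submission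
  imports Defs
begin

text \<open>
  The equation is of first order, and therefore it restricts to laws with finitely many atoms: for
  fixed weights \<open>w\<^sub>i > 0\<close> the function \<open>u(t, x) = v(t, \<Sum>\<^sub>i w\<^sub>i \<delta>\<^sub>x\<^sub>i)\<close> of finitely many points is
  continuously differentiable, its gradient with respect to the weighted inner product consists of
  the vectors \<open>P\<^sub>i = \<partial>\<^sub>m v(t, m)(x\<^sub>i)\<close>, and it solves a Hamilton-Jacobi-Bellman equation whose
  Hamiltonian is the minimum over \<open>(a\<^sub>i)\<close> of \<open>\<Sum>\<^sub>i w\<^sub>i (f(x\<^sub>i, m, a\<^sub>i) \<bullet> P\<^sub>i + g(x\<^sub>i, m, a\<^sub>i))\<close>. Finitely
  supported laws are dense and solutions are continuous (\<open>L_deriv_continuous_approx\<close>), so that it is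
  enough to compare two solutions \<open>U\<close> and \<open>V\<close> of the finite-dimensional equation with the same
  terminal value.

  Along a trajectory driven by controls that are minimal for \<open>U\<close>, the difference \<open>V - U\<close> does not
  decrease. As it vanishes at time \<open>T\<close>, it is nonpositive at the starting point, provided that
  the trajectory lives up to time \<open>T\<close>. Nothing is assumed about the growth of solutions, so the
  point is to exclude a blow-up. Write \<open>A\<close> and \<open>P\<close> for the derivatives of \<open>U\<close> in time and space. The
  expression \<open>A + P \<bullet> F + G\<close> is nonnegative everywhere and vanishes on the trajectory; comparing the
  trajectory \<open>x\<close> with its translate \<open>x + \<xi>\<close> under the same control shows that the costate \<open>P\<close> moves
  with speed at most \<open>C (1 + |x| + |P|)\<close>, and so does \<open>x\<close>. Gronwall's lemma then bounds both. The
  minimal controls need not be unique or continuous, because \<open>f \<bullet> z + g\<close> need not be convex in the control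
  for large \<open>z\<close>; for this reason the argument is carried out for an Euler scheme, with errors
  controlled by uniform continuity on bounded sets, and no differential equation is solved
  (\<open>bellman_comparison\<close>).

  The linear growth needs global Lipschitz bounds for \<open>f\<close> and quadratic bounds for \<open>g\<close> with respect to
  the law (\<open>a1_drift_bounds\<close>, \<open>a2_cost_bounds\<close>). The hypotheses bound the operator \<open>L_deriv\<close>, which is
  a choice; \<open>regular2_has_L_deriv_cont\<close> shows that there is something to choose, and
  \<open>L_deriv_cont_unique\<close> identifies the choice with the spatial derivative of the linear functional
  derivative. An L-derivative is tied to one unspecified random vector with the given law;
  \<open>transfer_label\<close> moves it to a convenient one.
\<close>

section \<open>Weighted configuration spaces\<close>

text \<open>Tuples of points indexed by a finite set \<open>S\<close> of positive weights of total mass one. A tuple is a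
  function on the whole index type; values outside \<open>S\<close> are irrelevant.\<close>

locale weighted =
  fixes S :: "'i set" and w :: "'i \<Rightarrow> real"
  assumes finS: "finite S" and wpos: "\<And>i. i \<in> S \<Longrightarrow> 0 < w i" and wsum: "sum w S = 1"
begin

text \<open>The inner product and the norm of \<open>L\<^sup>2\<close> of the weights. The norm is also used for tuples of
  controls and of real numbers.\<close>

definition ip :: "('i \<Rightarrow> 'x::euclidean_space) \<Rightarrow> ('i \<Rightarrow> 'x) \<Rightarrow> real" where
  "ip x y = (\<Sum>i\<in>S. w i * (x i \<bullet> y i))"

definition nrm :: "('i \<Rightarrow> 'v::real_normed_vector) \<Rightarrow> real" where
  "nrm x = L2_set (\<lambda>i. sqrt (w i) * norm (x i)) S"

lemma nrm_nonneg [simp]: "0 \<le> nrm x"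
  by (simp add: nrm_def)

lemma nrm_power2: "(nrm x)\<^sup>2 = (\<Sum>i\<in>S. w i * (norm (x i))\<^sup>2)"
  unfolding nrm_def L2_set_def
  using wpos by (subst real_sqrt_pow2)
    (auto intro!: sum_nonneg sum.cong simp: power_mult_distrib less_imp_le)

lemma nrm_mono: "(\<And>i. i \<in> S \<Longrightarrow> norm (x i) \<le> norm (y i)) \<Longrightarrow> nrm x \<le> nrm y"
  unfolding nrm_def using wpos by (intro L2_set_mono mult_left_mono) (auto simp: less_imp_le)

lemma nrm_cong: "(\<And>i. i \<in> S \<Longrightarrow> norm (x i) = norm (y i)) \<Longrightarrow> nrm x = nrm y"
  by (intro antisym nrm_mono) auto

lemma nrm_triangle: "nrm (\<lambda>i. x i + y i) \<le> nrm x + nrm y"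
proof -
  have "nrm (\<lambda>i. x i + y i) \<le> L2_set (\<lambda>i. sqrt (w i) * norm (x i) + sqrt (w i) * norm (y i)) S"
    unfolding nrm_def
  proof (rule L2_set_mono)
    fix i assume "i \<in> S"
    then have "sqrt (w i) * norm (x i + y i) \<le> sqrt (w i) * (norm (x i) + norm (y i))"
      using wpos by (intro mult_left_mono norm_triangle_ineq) (simp add: less_imp_le)
    then show "sqrt (w i) * norm (x i + y i) \<le> sqrt (w i) * norm (x i) + sqrt (w i) * norm (y i)"
      by (simp add: distrib_left)
    show "0 \<le> sqrt (w i) * norm (x i + y i)" using wpos[OF \<open>i \<in> S\<close>] by simp
  qed
  also have "\<dots> \<le> nrm x + nrm y"
    unfolding nrm_def by (rule L2_set_triangle_ineq)
  finally show ?thesis .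
qed

lemma nrm_scale: "nrm (\<lambda>i. c *\<^sub>R x i) = \<bar>c\<bar> * nrm x"
proof -
  have "(nrm (\<lambda>i. c *\<^sub>R x i))\<^sup>2 = (\<bar>c\<bar> * nrm x)\<^sup>2"
    unfolding power_mult_distrib nrm_power2
    by (simp add: power_mult_distrib sum_distrib_left algebra_simps)
  then show ?thesis by (metis abs_ge_zero nrm_nonneg mult_nonneg_nonneg power2_eq_imp_eq)
qed

lemma nrm_const: "nrm (\<lambda>_. c) = norm c"
proof -
  have "(nrm (\<lambda>_. c))\<^sup>2 = (norm c)\<^sup>2"
    unfolding nrm_power2 by (simp add: wsum flip: sum_distrib_right)
  then show ?thesis by (metis norm_ge_zero nrm_nonneg power2_eq_imp_eq)
qed

lemma nrm_bound: "0 \<le> c \<Longrightarrow> (\<And>i. i \<in> S \<Longrightarrow> norm (x i) \<le> c) \<Longrightarrow> nrm x \<le> c"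
  using nrm_mono[of x "\<lambda>_. c"] nrm_const[of c] by simp

lemma norm_le_nrm: assumes "i \<in> S" shows "norm (x i) \<le> nrm x / sqrt (w i)"
proof -
  have "sqrt (w i) * norm (x i) \<le> nrm x"
    unfolding nrm_def using assms finS
    by (intro member_le_L2_set) (auto simp: less_imp_le wpos)
  then show ?thesis using wpos[OF assms] by (simp add: field_simps)
qed

lemma ip_self: "ip x x = (nrm x)\<^sup>2"
  unfolding nrm_power2 ip_def by (simp add: power2_norm_eq_inner)

lemma ip_le: "\<bar>ip x y\<bar> \<le> nrm x * nrm y"
proof -
  have "\<bar>ip x y\<bar> \<le> (\<Sum>i\<in>S. \<bar>sqrt (w i) * norm (x i)\<bar> * \<bar>sqrt (w i) * norm (y i)\<bar>)"
    unfolding ip_def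
  proof (intro order_trans[OF sum_abs] sum_mono)
    fix i assume "i \<in> S"
    then have w0: "0 \<le> w i" using wpos by (auto simp: less_imp_le)
    have "\<bar>w i * (x i \<bullet> y i)\<bar> \<le> w i * (norm (x i) * norm (y i))"
      using w0 by (simp add: abs_mult mult_left_mono Cauchy_Schwarz_ineq2)
    also have "\<dots> = (sqrt (w i) * sqrt (w i)) * (norm (x i) * norm (y i))"
      using w0 by simp
    also have "\<dots> = \<bar>sqrt (w i) * norm (x i)\<bar> * \<bar>sqrt (w i) * norm (y i)\<bar>"
      using w0 by (simp add: abs_mult algebra_simps)
    finally show "\<bar>w i * (x i \<bullet> y i)\<bar> \<le> \<bar>sqrt (w i) * norm (x i)\<bar> * \<bar>sqrt (w i) * norm (y i)\<bar>" .
  qed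
  also have "\<dots> \<le> nrm x * nrm y"
    unfolding nrm_def by (rule L2_set_mult_ineq)
  finally show ?thesis .
qed

lemma ip_diff_left: "ip (\<lambda>i. x i - y i) z = ip x z - ip y z"
  by (simp add: ip_def inner_diff_left algebra_simps sum_subtractf)

lemma ip_diff_right: "ip z (\<lambda>i. x i - y i) = ip z x - ip z y"
  by (simp add: ip_def inner_diff_right algebra_simps sum_subtractf)

lemma ip_scale_right: "ip z (\<lambda>i. c *\<^sub>R x i) = c * ip z x"
  by (simp add: ip_def sum_distrib_left algebra_simps)

lemma bounded_subsequence:
  fixes f :: "nat \<Rightarrow> 'i \<Rightarrow> 'x::euclidean_space"
  assumes "\<And>n. nrm (f n) \<le> B"
  shows "\<exists>r l. strict_mono (r :: nat \<Rightarrow> nat) \<and> (\<lambda>n. nrm (\<lambda>i. f (r n) i - l i)) \<longlonglongrightarrow> 0"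
proof -
  have "\<exists>r l. strict_mono (r :: nat \<Rightarrow> nat) \<and> (\<forall>i\<in>J. (\<lambda>n. f (r n) i) \<longlonglongrightarrow> l i)" if "J \<subseteq> S" for J
    using finite_subset[OF that finS] that
  proof (induction J rule: finite_induct)
    case empty
    have "strict_mono (\<lambda>n::nat. n)" by (auto simp: strict_mono_def)
    then show ?case by blast
  next
    case (insert j J)
    then obtain r l where r: "strict_mono (r :: nat \<Rightarrow> nat)" "\<forall>i\<in>J. (\<lambda>n. f (r n) i) \<longlonglongrightarrow> l i"
      by auto
    have "\<forall>n. f (r n) j \<in> cball 0 (B / sqrt (w j))"
    proof
      fix n
      have j: "j \<in> S" using insert by auto
      have "norm (f (r n) j) \<le> nrm (f (r n)) / sqrt (w j)" by (rule norm_le_nrm[OF j])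
      also have "\<dots> \<le> B / sqrt (w j)" using assms wpos[OF j] by (simp add: divide_right_mono)
      finally show "f (r n) j \<in> cball 0 (B / sqrt (w j))" by simp
    qed
    then obtain l' r' where r': "strict_mono (r' :: nat \<Rightarrow> nat)" "((\<lambda>n. f (r n) j) \<circ> r') \<longlonglongrightarrow> l'"
      using seq_compactE[OF compact_imp_seq_compact[OF compact_cball[of 0 "B / sqrt (w j)"]],
          of "\<lambda>n. f (r n) j"] by blast
    have "(\<lambda>n. f ((r \<circ> r') n) i) \<longlonglongrightarrow> (l(j := l')) i" if "i \<in> insert j J" for i
    proof (cases "i = j")
      case True then show ?thesis using r'(2) by (simp add: o_def)
    next
      case False
      then have "(\<lambda>n. f (r n) i) \<longlonglongrightarrow> l i" using that r by auto
      from LIMSEQ_subseq_LIMSEQ[OF this r'(1)] False show ?thesis by (simp add: o_def)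
    qed
    moreover have "strict_mono (r \<circ> r')" using r(1) r'(1) by (rule strict_mono_o)
    ultimately show ?case by blast
  qed
  then obtain r l where r: "strict_mono (r :: nat \<Rightarrow> nat)" "\<forall>i\<in>S. (\<lambda>n. f (r n) i) \<longlonglongrightarrow> l i"
    by blast
  have "(\<lambda>n. (nrm (\<lambda>i. f (r n) i - l i))\<^sup>2) \<longlonglongrightarrow> (\<Sum>i\<in>S. w i * (norm (l i - l i))\<^sup>2)"
    unfolding nrm_power2 using r(2) by (intro tendsto_intros) auto
  then have "(\<lambda>n. sqrt ((nrm (\<lambda>i. f (r n) i - l i))\<^sup>2)) \<longlonglongrightarrow> sqrt 0"
    by (intro tendsto_real_sqrt) simp
  then show ?thesis using r(1) by auto
qed

text \<open>Joint continuity in time and configuration on \<open>[0, T]\<close>.\<close>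

definition jcontinuous :: "real \<Rightarrow> (real \<Rightarrow> ('i \<Rightarrow> 'x::euclidean_space) \<Rightarrow> 'm::metric_space) \<Rightarrow> bool" where
  "jcontinuous T \<Phi> \<longleftrightarrow> (\<forall>t\<in>{0..T}. \<forall>x. \<forall>\<epsilon>>0. \<exists>\<delta>>0. \<forall>t'\<in>{0..T}. \<forall>x'.
     \<bar>t' - t\<bar> < \<delta> \<longrightarrow> nrm (\<lambda>i. x' i - x i) < \<delta> \<longrightarrow> dist (\<Phi> t' x') (\<Phi> t x) < \<epsilon>)"

text \<open>Bounded sets of configurations are relatively compact for \<open>nrm\<close>, hence continuity is uniform there.\<close>

lemma jcontinuous_uniform:
  fixes \<Phi> :: "real \<Rightarrow> ('i \<Rightarrow> 'x::euclidean_space) \<Rightarrow> 'm::metric_space"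
  assumes "jcontinuous T \<Phi>" "0 < \<epsilon>"
  shows "\<exists>\<delta>>0. \<forall>t\<in>{0..T}. \<forall>t'\<in>{0..T}. \<forall>x x'. nrm x \<le> R \<longrightarrow> \<bar>t' - t\<bar> < \<delta> \<longrightarrow>
     nrm (\<lambda>i. x' i - x i) < \<delta> \<longrightarrow> dist (\<Phi> t' x') (\<Phi> t x) < \<epsilon>"
proof (rule ccontr)
  assume neg: "\<not> ?thesis"
  define bad where "bad n t t' x x' \<longleftrightarrow> t \<in> {0..T} \<and> t' \<in> {0..T} \<and> nrm x \<le> R \<and> \<bar>t' - t\<bar> < 1 / Suc n \<and>
      nrm (\<lambda>i. x' i - x i) < 1 / Suc n \<and> \<not> dist (\<Phi> t' x') (\<Phi> t x) < \<epsilon>" for n t t' x x'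
  have "\<exists>t t' x x'. bad n t t' x x'" for n
  proof (rule ccontr)
    assume "\<not> ?thesis"
    then have "\<forall>t\<in>{0..T}. \<forall>t'\<in>{0..T}. \<forall>x x'. nrm x \<le> R \<longrightarrow> \<bar>t' - t\<bar> < 1 / Suc n \<longrightarrow>
       nrm (\<lambda>i. x' i - x i) < 1 / Suc n \<longrightarrow> dist (\<Phi> t' x') (\<Phi> t x) < \<epsilon>"
      unfolding bad_def by blast
    moreover have "0 < 1 / real (Suc n)" by simp
    ultimately show False using neg by blast
  qed
  then have "\<forall>n. \<exists>z. bad n (fst z) (fst (snd z)) (fst (snd (snd z))) (snd (snd (snd z)))" by simp
  from choice[OF this] obtain z where
    z: "\<forall>n. bad n (fst (z n)) (fst (snd (z n))) (fst (snd (snd (z n)))) (snd (snd (snd (z n))))" ..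
  define t t' x x' where "t n = fst (z n)" and "t' n = fst (snd (z n))"
    and "x n = fst (snd (snd (z n)))" and "x' n = snd (snd (snd (z n)))" for n
  have bad: "bad n (t n) (t' n) (x n) (x' n)" for n
    unfolding t_def t'_def x_def x'_def by (rule z[rule_format])
  have *: "t n \<in> {0..T}" "t' n \<in> {0..T}" "nrm (x n) \<le> R" "\<bar>t' n - t n\<bar> < 1 / Suc n"
      "nrm (\<lambda>i. x' n i - x n i) < 1 / Suc n" "\<not> dist (\<Phi> (t' n) (x' n)) (\<Phi> (t n) (x n)) < \<epsilon>" for n
    using bad[of n] unfolding bad_def by blast+
  obtain r l where r: "strict_mono (r :: nat \<Rightarrow> nat)" "(\<lambda>n. nrm (\<lambda>i. x (r n) i - l i)) \<longlonglongrightarrow> 0"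
    using bounded_subsequence[of x R] *(3) by blast
  have "\<forall>n. t (r n) \<in> {0..T}" using * by auto
  then obtain s r' where r': "s \<in> {0..T}" "strict_mono (r' :: nat \<Rightarrow> nat)" "((\<lambda>n. t (r n)) \<circ> r') \<longlonglongrightarrow> s"
    using seq_compactE[OF compact_imp_seq_compact[OF compact_Icc[of 0 T]], of "\<lambda>n. t (r n)"] by blast
  define q where "q n = r (r' n)" for n
  have q: "strict_mono q" using strict_mono_o[OF r(1) r'(2)] by (simp add: q_def[abs_def] o_def)
  have tq: "(\<lambda>n. t (q n)) \<longlonglongrightarrow> s" using r'(3) by (simp add: o_def q_def)
  have xq: "(\<lambda>n. nrm (\<lambda>i. x (q n) i - l i)) \<longlonglongrightarrow> 0"
    using LIMSEQ_subseq_LIMSEQ[OF r(2) r'(2)] by (simp add: o_def q_def)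
  have inv: "(\<lambda>n. 1 / real (Suc (q n))) \<longlonglongrightarrow> 0"
    using LIMSEQ_subseq_LIMSEQ[OF LIMSEQ_Suc[OF lim_1_over_n] q] by (simp add: o_def)
  obtain \<delta> where \<delta>: "\<delta> > 0" "\<And>t' x'. t' \<in> {0..T} \<Longrightarrow> \<bar>t' - s\<bar> < \<delta> \<Longrightarrow> nrm (\<lambda>i. x' i - l i) < \<delta> \<Longrightarrow>
      dist (\<Phi> t' x') (\<Phi> s l) < \<epsilon> / 2"
    using assms(1)[unfolded jcontinuous_def, rule_format, OF r'(1) half_gt_zero[OF assms(2)]] by blast
  have "\<forall>\<^sub>F n in sequentially. dist (t (q n)) s < \<delta> / 2"
    using tq \<delta>(1) by (intro tendstoD) auto
  moreover have "\<forall>\<^sub>F n in sequentially. dist (nrm (\<lambda>i. x (q n) i - l i)) 0 < \<delta> / 2"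
    using xq \<delta>(1) by (intro tendstoD) auto
  moreover have "\<forall>\<^sub>F n in sequentially. dist (1 / real (Suc (q n))) 0 < \<delta> / 2"
    using inv \<delta>(1) by (intro tendstoD) auto
  ultimately have "\<forall>\<^sub>F n in sequentially. dist (t (q n)) s < \<delta> / 2 \<and>
      dist (nrm (\<lambda>i. x (q n) i - l i)) 0 < \<delta> / 2 \<and> dist (1 / real (Suc (q n))) 0 < \<delta> / 2"
    by eventually_elim auto
  then obtain n where n: "dist (t (q n)) s < \<delta> / 2" "dist (nrm (\<lambda>i. x (q n) i - l i)) 0 < \<delta> / 2"
      "dist (1 / real (Suc (q n))) 0 < \<delta> / 2"
    using eventually_happens'[OF sequentially_bot] by blast
  have a: "nrm (\<lambda>i. x (q n) i - l i) < \<delta> / 2" "1 / real (Suc (q n)) < \<delta> / 2" "\<bar>t (q n) - s\<bar> < \<delta> / 2"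
    using n by (auto simp: dist_real_def)
  have "nrm (\<lambda>i. x' (q n) i - l i) \<le> nrm (\<lambda>i. x' (q n) i - x (q n) i) + nrm (\<lambda>i. x (q n) i - l i)"
    using nrm_triangle[of "\<lambda>i. x' (q n) i - x (q n) i" "\<lambda>i. x (q n) i - l i"] by simp
  also have "\<dots> < \<delta>" using a *(5)[of "q n"] by linarith
  finally have b: "nrm (\<lambda>i. x' (q n) i - l i) < \<delta>" .
  have c: "\<bar>t' (q n) - s\<bar> < \<delta>" using a *(4)[of "q n"] by linarith
  have "dist (\<Phi> (t' (q n)) (x' (q n))) (\<Phi> s l) < \<epsilon> / 2" using b c *(2) by (intro \<delta>(2)) auto
  moreover have "dist (\<Phi> (t (q n)) (x (q n))) (\<Phi> s l) < \<epsilon> / 2"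
    using a \<delta>(1) *(1) by (intro \<delta>(2)) auto
  ultimately have "dist (\<Phi> (t' (q n)) (x' (q n))) (\<Phi> (t (q n)) (x (q n))) < \<epsilon>"
    using dist_triangle_half_r by (metis dist_commute)
  then show False using *(6) by blast
qed

end

section \<open>Comparison of finite-dimensional solutions\<close>

lemma discrete_gronwall:
  fixes z :: "nat \<Rightarrow> real"
  assumes q: "0 \<le> q"
    and step: "\<And>k. k \<le> N \<Longrightarrow> (\<And>j. j < k \<Longrightarrow> z j \<le> c * (1 + q) ^ j) \<Longrightarrow> z k \<le> c + q * (\<Sum>j<k. z j)"
  shows "k \<le> N \<Longrightarrow> z k \<le> c * (1 + q) ^ k"
proof (induction k rule: less_induct)
  case (less k)
  have IH: "z j \<le> c * (1 + q) ^ j" if "j < k" for j using less that by auto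
  have "z k \<le> c + q * (\<Sum>j<k. z j)" using step[OF less.prems] IH by blast
  also have "\<dots> \<le> c + q * (\<Sum>j<k. c * (1 + q) ^ j)"
    using IH q by (intro add_left_mono mult_left_mono sum_mono) auto
  also have "\<dots> = c * (1 + q) ^ k"
  proof (induction k)
    case (Suc k) then show ?case by (simp add: algebra_simps)
  qed simp
  finally show ?case .
qed

context weighted
begin

text \<open>\<open>U\<close> is continuously differentiable on \<open>[0, T]\<close> times the configuration space, with time derivative
  \<open>A\<close> and spatial gradient \<open>P\<close> with respect to \<open>ip\<close>. Differentiability is stated along straight lines in
  space-time and in space, which is all that is used.\<close>

definition c1_along :: "real \<Rightarrow> (real \<Rightarrow> ('i \<Rightarrow> 'x::euclidean_space) \<Rightarrow> real) \<Rightarrow>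
    (real \<Rightarrow> ('i \<Rightarrow> 'x) \<Rightarrow> real) \<Rightarrow> (real \<Rightarrow> ('i \<Rightarrow> 'x) \<Rightarrow> 'i \<Rightarrow> 'x) \<Rightarrow> bool" where
  "c1_along T U A P \<longleftrightarrow>
     (\<forall>t\<in>{0..T}. \<forall>x \<eta> h. 0 < h \<longrightarrow> t + h \<le> T \<longrightarrow> (\<forall>s\<in>{0..h}.
        ((\<lambda>s. U (t + s) (\<lambda>i. x i + s *\<^sub>R \<eta> i)) has_real_derivative
          A (t + s) (\<lambda>i. x i + s *\<^sub>R \<eta> i) + ip (P (t + s) (\<lambda>i. x i + s *\<^sub>R \<eta> i)) \<eta>) (at s within {0..h}))) \<and>
     (\<forall>t\<in>{0..T}. \<forall>x \<xi> s.
        ((\<lambda>s. U t (\<lambda>i. x i + s *\<^sub>R \<xi> i)) has_real_derivative ip (P t (\<lambda>i. x i + s *\<^sub>R \<xi> i)) \<xi>) (at s)) \<and>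
     jcontinuous T A \<and> (\<forall>i\<in>S. jcontinuous T (\<lambda>t x. P t x i))"

lemma costate_uniform:
  fixes P :: "real \<Rightarrow> ('i \<Rightarrow> 'x::euclidean_space) \<Rightarrow> 'i \<Rightarrow> 'x"
  assumes P: "\<forall>i\<in>S. jcontinuous T (\<lambda>t x. P t x i)" and "0 < \<epsilon>"
  shows "\<exists>\<delta>>0. \<forall>t\<in>{0..T}. \<forall>t'\<in>{0..T}. \<forall>x x'. nrm x \<le> R \<longrightarrow> \<bar>t' - t\<bar> < \<delta> \<longrightarrow>
     nrm (\<lambda>i. x' i - x i) < \<delta> \<longrightarrow> nrm (\<lambda>i. P t' x' i - P t x i) \<le> \<epsilon>"
proof -
  let ?Q = "\<lambda>i \<delta>. \<forall>t\<in>{0..T}. \<forall>t'\<in>{0..T}. \<forall>x x'. nrm x \<le> R \<longrightarrow> \<bar>t' - t\<bar> < \<delta> \<longrightarrow>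
     nrm (\<lambda>i. x' i - x i) < \<delta> \<longrightarrow> dist (P t' x' i) (P t x i) < \<epsilon>"
  have "\<forall>i\<in>S. \<exists>\<delta>. 0 < \<delta> \<and> ?Q i \<delta>"
    using jcontinuous_uniform[OF P[rule_format] \<open>0 < \<epsilon>\<close>] by blast
  from bchoice[OF this] obtain d where d: "\<forall>i\<in>S. 0 < d i \<and> ?Q i (d i)" ..
  define \<delta> where "\<delta> = Min (insert 1 (d ` S))"
  have \<delta>: "0 < \<delta>" using d finS by (auto simp: \<delta>_def)
  have le: "\<delta> \<le> d i" if "i \<in> S" for i using that finS by (auto simp: \<delta>_def)
  have "nrm (\<lambda>i. P t' x' i - P t x i) \<le> \<epsilon>"
    if "t \<in> {0..T}" "t' \<in> {0..T}" "nrm x \<le> R" "\<bar>t' - t\<bar> < \<delta>" "nrm (\<lambda>i. x' i - x i) < \<delta>" for t t' x x'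
  proof (rule nrm_bound)
    fix i assume i: "i \<in> S"
    have "dist (P t' x' i) (P t x i) < \<epsilon>"
      using d i that le[OF i] by (meson order_less_le_trans)
    then show "norm (P t' x' i - P t x i) \<le> \<epsilon>" by (simp add: dist_norm)
  qed (use \<open>0 < \<epsilon>\<close> in simp)
  then show ?thesis using \<delta> by blast
qed

text \<open>Mean value estimates for one time step in direction \<open>\<eta>\<close> and for a translation by \<open>\<xi>\<close>; \<open>e\<close> bounds the
  oscillation of the derivatives on the segment.\<close>

lemma c1_along_step:
  assumes U: "c1_along T U A P" and t: "t \<in> {0..T}" and h: "0 < h" "t + h \<le> T"
    and A: "\<And>s. s \<in> {0..h} \<Longrightarrow> \<bar>A (t + s) (\<lambda>i. x i + s *\<^sub>R \<eta> i) - A t x\<bar> \<le> e"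
    and P: "\<And>s. s \<in> {0..h} \<Longrightarrow> nrm (\<lambda>i. P (t + s) (\<lambda>i. x i + s *\<^sub>R \<eta> i) i - P t x i) \<le> e"
  shows "\<bar>U (t + h) (\<lambda>i. x i + h *\<^sub>R \<eta> i) - U t x - h * (A t x + ip (P t x) \<eta>)\<bar> \<le> h * (e * (1 + nrm \<eta>))"
proof -
  let ?x = "\<lambda>s i. x i + s *\<^sub>R \<eta> i"
  define D where "D s = A (t + s) (?x s) + ip (P (t + s) (?x s)) \<eta>" for s
  have "((\<lambda>s. U (t + s) (?x s)) has_real_derivative D s) (at s within {0..h})" if "0 \<le> s" "s \<le> h" for s
    using U t h that unfolding c1_along_def D_def by auto
  then have "\<And>s. 0 \<le> s \<Longrightarrow> s \<le> h \<Longrightarrow>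
      ((\<lambda>s. U (t + s) (?x s)) has_derivative ((*) (D s))) (at s within {0..h})"
    by (simp add: has_field_derivative_def)
  from mvt_very_simple[OF less_imp_le[OF h(1)] this] obtain s where
    s: "s \<in> {0..h}" "U (t + h) (?x h) - U (t + 0) (?x 0) = D s * (h - 0)" by blast
  have "D s - (A t x + ip (P t x) \<eta>) =
      (A (t + s) (?x s) - A t x) + ip (\<lambda>i. P (t + s) (?x s) i - P t x i) \<eta>"
    by (simp add: D_def ip_diff_left)
  also have "\<bar>\<dots>\<bar> \<le> e + e * nrm \<eta>"
    using A[OF s(1)] ip_le[of "\<lambda>i. P (t + s) (?x s) i - P t x i" \<eta>]
      mult_right_mono[OF P[OF s(1)] nrm_nonneg[of \<eta>]] by linarith
  finally have *: "\<bar>D s - (A t x + ip (P t x) \<eta>)\<bar> \<le> e * (1 + nrm \<eta>)" by (simp add: distrib_left)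
  have "U (t + h) (?x h) - U t x - h * (A t x + ip (P t x) \<eta>) = h * (D s - (A t x + ip (P t x) \<eta>))"
    using s(2) by (simp add: algebra_simps)
  then show ?thesis using * h(1) by (simp add: abs_mult)
qed

lemma c1_along_space:
  assumes U: "c1_along T U A P" and t: "t \<in> {0..T}"
    and P: "\<And>s. s \<in> {0..1} \<Longrightarrow> nrm (\<lambda>i. P t (\<lambda>i. x i + s *\<^sub>R \<xi> i) i - P t x i) \<le> e"
  shows "\<bar>U t (\<lambda>i. x i + \<xi> i) - U t x - ip (P t x) \<xi>\<bar> \<le> e * nrm \<xi>"
proof -
  let ?x = "\<lambda>s i. x i + s *\<^sub>R \<xi> i"
  have "((\<lambda>s. U t (?x s)) has_real_derivative ip (P t (?x s)) \<xi>) (at s)" for s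
    using U t unfolding c1_along_def by auto
  from MVT2[of 0 1, OF _ this] obtain s where
    s: "0 < s" "s < 1" "U t (?x 1) - U t (?x 0) = (1 - 0) * ip (P t (?x s)) \<xi>" by auto
  have "U t (\<lambda>i. x i + \<xi> i) - U t x - ip (P t x) \<xi> = ip (\<lambda>i. P t (?x s) i - P t x i) \<xi>"
    using s(3) by (simp add: ip_diff_left)
  also have "\<bar>\<dots>\<bar> \<le> e * nrm \<xi>"
    using ip_le[of "\<lambda>i. P t (?x s) i - P t x i" \<xi>] P[of s] s
      mult_right_mono[OF P[of s] nrm_nonneg[of \<xi>]] by auto
  finally show ?thesis .
qed

text \<open>The functions \<open>A\<close>, \<open>P\<close> and \<open>B\<close>, \<open>Q\<close> are the derivatives of the two solutions. The solution \<open>V\<close> need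
  only be a subsolution; the solution \<open>U\<close> has to attain the minimum at some control, with \<open>F\<close> and the
  increments of \<open>G\<close> growing at most linearly in the configuration and the costate. No growth of \<open>U\<close> or \<open>V\<close>
  is assumed.\<close>

theorem bellman_comparison:
  fixes F :: "('i \<Rightarrow> 'x::euclidean_space) \<Rightarrow> 'c \<Rightarrow> 'i \<Rightarrow> 'x" and G :: "('i \<Rightarrow> 'x) \<Rightarrow> 'c \<Rightarrow> real"
  assumes U: "c1_along T U A P" and V: "c1_along T V B Q"
    and C: "0 \<le> C"
    and U_ge: "\<And>t x b. t \<in> {0..T} \<Longrightarrow> 0 \<le> A t x + ip (P t x) (F x b) + G x b"
    and V_ge: "\<And>t x b. t \<in> {0..T} \<Longrightarrow> 0 \<le> B t x + ip (Q t x) (F x b) + G x b"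
    and U_min: "\<And>t x. t \<in> {0..T} \<Longrightarrow> \<exists>a. A t x + ip (P t x) (F x a) + G x a = 0 \<and>
        nrm (F x a) \<le> C * (1 + nrm x + nrm (P t x)) \<and>
        (\<forall>\<xi>. nrm \<xi> \<le> 1 \<longrightarrow> G (\<lambda>i. x i + \<xi> i) a - G x a \<le> C * (1 + nrm x + nrm (P t x)) * nrm \<xi>)"
    and F_lip: "\<And>x \<xi> b q. \<bar>ip q (\<lambda>i. F (\<lambda>i. x i + \<xi> i) b i - F x b i)\<bar> \<le> C * nrm \<xi> * nrm q"
    and terminal: "\<And>x. U T x = V T x"
    and t0: "t0 \<in> {0..T}"
  shows "V t0 x0 \<le> U t0 x0"
proof (cases "t0 = T")
  case True then show ?thesis using terminal by simp
next
  case False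
  then have tT: "0 \<le> t0" "t0 < T" using t0 by auto
  define good where "good t x a \<longleftrightarrow> A t x + ip (P t x) (F x a) + G x a = 0 \<and>
        nrm (F x a) \<le> C * (1 + nrm x + nrm (P t x)) \<and>
        (\<forall>\<xi>. nrm \<xi> \<le> 1 \<longrightarrow> G (\<lambda>i. x i + \<xi> i) a - G x a \<le> C * (1 + nrm x + nrm (P t x)) * nrm \<xi>)" for t x a
  define \<alpha> where "\<alpha> t x = (SOME a. good t x a)" for t x
  have good: "good t x (\<alpha> t x)" if "t \<in> {0..T}" for t x
    unfolding \<alpha>_def by (rule someI_ex) (use U_min[OF that] in \<open>simp add: good_def\<close>)
  have \<alpha>: "A t x + ip (P t x) (F x (\<alpha> t x)) + G x (\<alpha> t x) = 0"
      "nrm (F x (\<alpha> t x)) \<le> C * (1 + nrm x + nrm (P t x))"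
      "nrm \<xi> \<le> 1 \<Longrightarrow> G (\<lambda>i. x i + \<xi> i) (\<alpha> t x) - G x (\<alpha> t x) \<le> C * (1 + nrm x + nrm (P t x)) * nrm \<xi>"
    if "t \<in> {0..T}" for t x \<xi>
    using good[OF that, of x] unfolding good_def by blast+
  \<comment> \<open>\<open>Z\<close> is the Gronwall bound for \<open>1 + |x| + |P|\<close>; the slack 1 in \<open>c\<close> absorbs the discretisation errors.\<close>
  define c where "c = 2 + nrm x0 + nrm (P t0 x0)"
  define Z where "Z = c * exp (3 * C * T)"
  have c2: "2 \<le> c" by (simp add: c_def)
  have expge: "1 \<le> exp (3 * C * T)" using C tT by simp
  have Z1: "c \<le> Z" using mult_left_mono[OF expge, of c] c2 by (simp add: Z_def)
  have Z0: "0 \<le> Z" using Z1 c2 by linarith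
  have CZ: "0 \<le> C * Z" using C Z0 by simp
  define R where "R = Z + 2"
  have contU: "jcontinuous T A" "\<forall>i\<in>S. jcontinuous T (\<lambda>t x. P t x i)"
    and contV: "jcontinuous T B" "\<forall>i\<in>S. jcontinuous T (\<lambda>t x. Q t x i)"
    using U V unfolding c1_along_def by auto
  obtain d where d: "0 < d" "\<And>t t' x x'. t \<in> {0..T} \<Longrightarrow> t' \<in> {0..T} \<Longrightarrow> nrm x \<le> R \<Longrightarrow> \<bar>t' - t\<bar> < d \<Longrightarrow>
     nrm (\<lambda>i. x' i - x i) < d \<Longrightarrow> nrm (\<lambda>i. P t' x' i - P t x i) \<le> 1/4"
    using costate_uniform[OF contU(2), of "1/4" R] by auto
  \<comment> \<open>Size of the translations: the gradient varies by at most 1/4 under them.\<close>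
  define r where "r = min (d / 2) 1"
  have r: "0 < r" "r \<le> 1" "r < d" using d(1) by (auto simp: r_def)
  have shift: "nrm (\<lambda>i. P t (\<lambda>i. x i + s *\<^sub>R \<xi> i) i - P t x i) \<le> 1/4"
    if "t \<in> {0..T}" "nrm x \<le> R" "nrm \<xi> = r" "s \<in> {0..1}" for t x \<xi> s
  proof (rule d(2))
    have "nrm (\<lambda>i. s *\<^sub>R \<xi> i) \<le> 1 * r" unfolding nrm_scale using that r by (intro mult_mono) auto
    then show "nrm (\<lambda>i. x i + s *\<^sub>R \<xi> i - x i) < d" using r by simp
  qed (use that d in auto)
  have "V t0 x0 - U t0 x0 \<le> \<epsilon>" if "0 < \<epsilon>" for \<epsilon>
  proof -
    \<comment> \<open>Error allowed per unit of time. It has to be small against \<open>r\<close> as well, since the costate is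
      read off from increments of \<open>U\<close> by division by \<open>r\<close>.\<close>
    define e1 where "e1 = min \<epsilon> (r / 2) / (T - t0)"
    have "e1 * (T - t0) = min \<epsilon> (r / 2)" using tT by (simp add: e1_def)
    then have e1: "0 < e1" "e1 * (T - t0) \<le> \<epsilon>" "e1 * (T - t0) \<le> r / 2"
      using that tT r by (auto simp: e1_def)
    define e where "e = e1 / (2 * (1 + C * Z))"
    have e: "0 < e" using e1 CZ by (simp add: e_def add_pos_nonneg)
    have e_eq: "2 * (e * (1 + C * Z)) = e1" using CZ by (simp add: e_def add_pos_nonneg field_simps)
    obtain dA where dA: "0 < dA" "\<And>t t' x x'. t \<in> {0..T} \<Longrightarrow> t' \<in> {0..T} \<Longrightarrow> nrm x \<le> R \<Longrightarrow> \<bar>t' - t\<bar> < dA \<Longrightarrow>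
       nrm (\<lambda>i. x' i - x i) < dA \<Longrightarrow> dist (A t' x') (A t x) < e"
      using jcontinuous_uniform[OF contU(1) e, of R] by auto
    obtain dP where dP: "0 < dP" "\<And>t t' x x'. t \<in> {0..T} \<Longrightarrow> t' \<in> {0..T} \<Longrightarrow> nrm x \<le> R \<Longrightarrow> \<bar>t' - t\<bar> < dP \<Longrightarrow>
       nrm (\<lambda>i. x' i - x i) < dP \<Longrightarrow> nrm (\<lambda>i. P t' x' i - P t x i) \<le> e"
      using costate_uniform[OF contU(2) e, of R] by auto
    obtain dB where dB: "0 < dB" "\<And>t t' x x'. t \<in> {0..T} \<Longrightarrow> t' \<in> {0..T} \<Longrightarrow> nrm x \<le> R \<Longrightarrow> \<bar>t' - t\<bar> < dB \<Longrightarrow>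
       nrm (\<lambda>i. x' i - x i) < dB \<Longrightarrow> dist (B t' x') (B t x) < e"
      using jcontinuous_uniform[OF contV(1) e, of R] by auto
    obtain dQ where dQ: "0 < dQ" "\<And>t t' x x'. t \<in> {0..T} \<Longrightarrow> t' \<in> {0..T} \<Longrightarrow> nrm x \<le> R \<Longrightarrow> \<bar>t' - t\<bar> < dQ \<Longrightarrow>
       nrm (\<lambda>i. x' i - x i) < dQ \<Longrightarrow> nrm (\<lambda>i. Q t' x' i - Q t x i) \<le> e"
      using costate_uniform[OF contV(2) e, of R] by auto
    define \<delta> where "\<delta> = min (min dA dP) (min dB dQ) / (1 + C * Z)"
    have \<delta>: "0 < \<delta>" using dA dP dB dQ CZ by (simp add: \<delta>_def add_pos_nonneg)
    obtain N :: nat where N: "(T - t0) / \<delta> < real N" using reals_Archimedean2 by blast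
    have N0: "0 < N"
    proof -
      have "0 < (T - t0) / \<delta>" using tT \<delta> by simp
      then show ?thesis using N by (metis gr0I less_trans less_irrefl of_nat_0)
    qed
    define h where "h = (T - t0) / real N"
    have h0: "0 < h" using tT N0 by (simp add: h_def)
    have hN: "real N * h = T - t0" using N0 by (simp add: h_def)
    have h\<delta>: "h < \<delta>" using N \<delta> N0 by (simp add: h_def field_simps)
    have hd: "s * (1 + C * Z) < dA \<and> s * (1 + C * Z) < dP \<and> s * (1 + C * Z) < dB \<and> s * (1 + C * Z) < dQ"
      if "s \<in> {0..h}" for s
    proof -
      have "s * (1 + C * Z) < \<delta> * (1 + C * Z)"
        using that h\<delta> CZ by (intro mult_strict_right_mono) auto
      also have "\<dots> = min (min dA dP) (min dB dQ)" using CZ by (simp add: \<delta>_def)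
      finally show ?thesis by simp
    qed
    have small: "s < min (min dA dP) (min dB dQ) \<and> nrm (\<lambda>i. s *\<^sub>R \<eta> i) < min (min dA dP) (min dB dQ)"
      if "s \<in> {0..h}" "nrm \<eta> \<le> C * Z" for s and \<eta> :: "'i \<Rightarrow> 'x"
    proof -
      have "s \<le> s * (1 + C * Z)" using that CZ by (simp add: distrib_left)
      moreover have "nrm (\<lambda>i. s *\<^sub>R \<eta> i) \<le> s * (1 + C * Z)"
        unfolding nrm_scale using that by (intro mult_mono) auto
      ultimately show ?thesis using hd[OF that(1)] by auto
    qed
    have stepU: "\<bar>U (t + h) (\<lambda>i. x i + h *\<^sub>R \<eta> i) - U t x - h * (A t x + ip (P t x) \<eta>)\<bar> \<le> h * (e1 / 2)"
      and stepV: "\<bar>V (t + h) (\<lambda>i. x i + h *\<^sub>R \<eta> i) - V t x - h * (B t x + ip (Q t x) \<eta>)\<bar> \<le> h * (e1 / 2)"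
      if t: "t \<in> {0..T}" "t + h \<le> T" and x: "nrm x \<le> R" and \<eta>: "nrm \<eta> \<le> C * Z" for t x \<eta>
    proof -
      have le: "h * (e * (1 + nrm \<eta>)) \<le> h * (e1 / 2)"
        using \<eta> h0 e e_eq[symmetric] by (auto intro!: mult_left_mono)
      have "\<bar>U (t + h) (\<lambda>i. x i + h *\<^sub>R \<eta> i) - U t x - h * (A t x + ip (P t x) \<eta>)\<bar> \<le> h * (e * (1 + nrm \<eta>))"
      proof (rule c1_along_step[OF U t(1) h0 t(2)])
        fix s assume s: "s \<in> {0..h}"
        show "\<bar>A (t + s) (\<lambda>i. x i + s *\<^sub>R \<eta> i) - A t x\<bar> \<le> e"
          using dA(2)[of t "t + s" x "\<lambda>i. x i + s *\<^sub>R \<eta> i"] small[OF s \<eta>] s t x by (auto simp: dist_real_def)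
        show "nrm (\<lambda>i. P (t + s) (\<lambda>i. x i + s *\<^sub>R \<eta> i) i - P t x i) \<le> e"
          using small[OF s \<eta>] s t x by (intro dP(2)) auto
      qed
      with le show "\<bar>U (t + h) (\<lambda>i. x i + h *\<^sub>R \<eta> i) - U t x - h * (A t x + ip (P t x) \<eta>)\<bar> \<le> h * (e1 / 2)"
        by linarith
      have "\<bar>V (t + h) (\<lambda>i. x i + h *\<^sub>R \<eta> i) - V t x - h * (B t x + ip (Q t x) \<eta>)\<bar> \<le> h * (e * (1 + nrm \<eta>))"
      proof (rule c1_along_step[OF V t(1) h0 t(2)])
        fix s assume s: "s \<in> {0..h}"
        show "\<bar>B (t + s) (\<lambda>i. x i + s *\<^sub>R \<eta> i) - B t x\<bar> \<le> e"
          using dB(2)[of t "t + s" x "\<lambda>i. x i + s *\<^sub>R \<eta> i"] small[OF s \<eta>] s t x by (auto simp: dist_real_def)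
        show "nrm (\<lambda>i. Q (t + s) (\<lambda>i. x i + s *\<^sub>R \<eta> i) i - Q t x i) \<le> e"
          using small[OF s \<eta>] s t x by (intro dQ(2)) auto
      qed
      with le show "\<bar>V (t + h) (\<lambda>i. x i + h *\<^sub>R \<eta> i) - V t x - h * (B t x + ip (Q t x) \<eta>)\<bar> \<le> h * (e1 / 2)"
        by linarith
    qed
    \<comment> \<open>Euler scheme \<open>X\<close> at the times \<open>\<tau>\<close>; each step uses a control that is minimal for \<open>U\<close> at its start.\<close>
    define \<tau> where "\<tau> k = t0 + real k * h" for k
    define X where "X = rec_nat x0 (\<lambda>k x i. x i + h *\<^sub>R F x (\<alpha> (\<tau> k) x) i)"
    define \<eta> where "\<eta> k = F (X k) (\<alpha> (\<tau> k) (X k))" for k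
    define a where "a k = \<alpha> (\<tau> k) (X k)" for k
    have X0: "X 0 = x0" by (simp add: X_def)
    have XS: "X (Suc k) = (\<lambda>i. X k i + h *\<^sub>R \<eta> k i)" for k by (simp add: X_def \<eta>_def)
    have \<tau>S: "\<tau> (Suc k) = \<tau> k + h" for k by (simp add: \<tau>_def algebra_simps)
    have \<tau>0: "\<tau> 0 = t0" and \<tau>N: "\<tau> N = T" using hN by (auto simp: \<tau>_def)
    have \<tau>in: "\<tau> k \<in> {0..T}" if "k \<le> N" for k
    proof -
      have "real k * h \<le> real N * h" using that h0 by (intro mult_right_mono) auto
      then show ?thesis using hN tT h0 by (auto simp: \<tau>_def)
    qed
    define z where "z k = 1 + nrm (X k) + nrm (P (\<tau> k) (X k))" for k
    have z0: "0 \<le> z k" for k by (simp add: z_def add_nonneg_nonneg)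
    have \<eta>z: "nrm (\<eta> k) \<le> C * z k" if "k \<le> N" for k
      using \<alpha>(2)[OF \<tau>in[OF that]] by (simp add: \<eta>_def z_def)
    define q where "q = 3 * C * h"
    have q0: "0 \<le> q" using C h0 by (simp add: q_def)
    have powZ: "c * (1 + q) ^ k \<le> Z" if "k \<le> N" for k
    proof -
      have "(1 + q) ^ k \<le> exp q ^ k" using q0 by (intro power_mono exp_ge_add_one_self) auto
      also have "\<dots> = exp (real k * q)" by (simp add: exp_of_nat_mult)
      also have "\<dots> \<le> exp (3 * C * T)"
      proof -
        have "real k * h \<le> T" using \<tau>in[OF that] tT by (auto simp: \<tau>_def)
        from mult_left_mono[OF this, of "3 * C"] show ?thesis using C by (simp add: q_def mult_ac)
      qed
      finally show ?thesis using c2 by (simp add: Z_def mult_left_mono)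
    qed
    have zbound: "z k \<le> c * (1 + q) ^ k" if "k \<le> N" for k
    proof (rule discrete_gronwall[OF q0 _ that])
      fix k assume k: "k \<le> N" and IH: "\<And>j. j < k \<Longrightarrow> z j \<le> c * (1 + q) ^ j"
      have zZ: "z j \<le> Z" if "j < k" for j using IH[OF that] powZ[of j] that k by linarith
      have \<eta>Z: "nrm (\<eta> j) \<le> C * Z" if "j < k" for j
        using \<eta>z[of j] mult_left_mono[OF zZ[OF that] C] that k by linarith
      have Xk: "nrm (X m) \<le> nrm x0 + C * h * (\<Sum>j<m. z j)" if "m \<le> k" for m
        using that
      proof (induction m)
        case 0 then show ?case by (simp add: X0)
      next
        case (Suc m)
        have "nrm (X (Suc m)) \<le> nrm (X m) + h * nrm (\<eta> m)"
          unfolding XS using nrm_triangle[of "X m" "\<lambda>i. h *\<^sub>R \<eta> m i"] h0 by (simp add: nrm_scale)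
        also have "h * nrm (\<eta> m) \<le> h * (C * z m)"
          using \<eta>z[of m] Suc.prems k h0 by (intro mult_left_mono) auto
        finally show ?case using Suc by (simp add: algebra_simps)
      qed
      have geo: "c + q * (\<Sum>j<m. z j) \<le> Z" if "m \<le> k" for m
      proof -
        have "c + q * (\<Sum>j<m. z j) \<le> c + q * (\<Sum>j<m. c * (1 + q) ^ j)"
          using IH that q0 by (intro add_left_mono mult_left_mono sum_mono) auto
        also have "\<dots> = c * (1 + q) ^ m"
        proof (induction m)
          case (Suc m) then show ?case by (simp add: algebra_simps)
        qed simp
        also have "\<dots> \<le> Z" using powZ[of m] that k by simp
        finally show ?thesis .
      qed
      have sumz: "0 \<le> (\<Sum>j<m. z j)" for m by (intro sum_nonneg z0)
      have XZ: "nrm (X m) \<le> Z" if "m \<le> k" for m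
      proof -
        have "C * h * (\<Sum>j<m. z j) \<le> q * (\<Sum>j<m. z j)"
          using C h0 sumz by (intro mult_right_mono) (auto simp: q_def)
        moreover have "nrm x0 \<le> c" by (simp add: c_def add_nonneg_nonneg)
        ultimately show ?thesis using Xk[OF that] geo[OF that] by linarith
      qed
      define p where "p i = P (\<tau> k) (X k) i - P t0 x0 i" for i
      have main: "nrm p \<le> 1 + 2 * C * h * (\<Sum>j<k. z j)"
      proof (cases "nrm p = 0")
        case True then show ?thesis using C h0 sumz by simp
      next
        case False
        then have p0: "0 < nrm p" by (simp add: order_le_neq_trans)
        \<comment> \<open>Translate against the increment \<open>p\<close> of the costate. Since \<open>A + P \<bullet> F + G\<close> is minimal on the
          trajectory, the gap \<open>\<Delta>\<close> between the two paths decreases slowly, and \<open>p\<close> is small.\<close>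
        define \<xi> where "\<xi> i = (- r / nrm p) *\<^sub>R p i" for i
        have \<xi>r: "nrm \<xi> = r" unfolding \<xi>_def[abs_def] nrm_scale using p0 r by simp
        define \<Delta> where "\<Delta> j = U (\<tau> j) (\<lambda>i. X j i + \<xi> i) - U (\<tau> j) (X j)" for j
        have inc: "\<Delta> j - h * (2 * C * z j * r + e1) \<le> \<Delta> (Suc j)" if j: "j < k" for j
        proof -
          have jN: "j \<le> N" using j k by simp
          have tj: "\<tau> j \<in> {0..T}" "\<tau> j + h \<le> T"
            using \<tau>in[OF jN] \<tau>in[of "Suc j"] j k \<tau>S[of j] by auto
          have xj: "nrm (X j) \<le> R" using XZ[of j] j by (simp add: R_def)
          have xj': "nrm (\<lambda>i. X j i + \<xi> i) \<le> R"
            using nrm_triangle[of "X j" \<xi>] XZ[of j] j \<xi>r r by (simp add: R_def)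
          define x' where "x' i = X j i + \<xi> i" for i
          have s1: "\<bar>U (\<tau> j + h) (\<lambda>i. x' i + h *\<^sub>R \<eta> j i) - U (\<tau> j) x'
              - h * (A (\<tau> j) x' + ip (P (\<tau> j) x') (\<eta> j))\<bar> \<le> h * (e1 / 2)"
            using stepU[OF tj xj' \<eta>Z[OF j]] by (simp add: x'_def[abs_def])
          have s2: "\<bar>U (\<tau> j + h) (\<lambda>i. X j i + h *\<^sub>R \<eta> j i) - U (\<tau> j) (X j)
              - h * (A (\<tau> j) (X j) + ip (P (\<tau> j) (X j)) (\<eta> j))\<bar> \<le> h * (e1 / 2)"
            by (rule stepU[OF tj xj \<eta>Z[OF j]])
          have \<Delta>S: "\<Delta> (Suc j) = U (\<tau> j + h) (\<lambda>i. x' i + h *\<^sub>R \<eta> j i) - U (\<tau> j + h) (\<lambda>i. X j i + h *\<^sub>R \<eta> j i)"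
            by (simp add: \<Delta>_def XS \<tau>S x'_def add_ac)
          have \<Delta>j: "\<Delta> j = U (\<tau> j) x' - U (\<tau> j) (X j)" by (simp add: \<Delta>_def x'_def[abs_def])
          have eq: "A (\<tau> j) (X j) + ip (P (\<tau> j) (X j)) (\<eta> j) = - G (X j) (a j)"
            using \<alpha>(1)[OF tj(1), of "X j"] by (simp add: \<eta>_def a_def)
          have ge: "0 \<le> A (\<tau> j) x' + ip (P (\<tau> j) x') (F x' (a j)) + G x' (a j)"
            by (rule U_ge[OF tj(1)])
          have Pn: "nrm (P (\<tau> j) x') \<le> nrm (P (\<tau> j) (X j)) + 1"
            using nrm_triangle[of "\<lambda>i. P (\<tau> j) x' i - P (\<tau> j) (X j) i" "P (\<tau> j) (X j)"]
              shift[OF tj(1) xj \<xi>r, of 1] by (simp add: x'_def[abs_def])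
          have Pz: "nrm (P (\<tau> j) x') \<le> z j"
            unfolding z_def using Pn nrm_nonneg[of "X j"] by linarith
          have "\<bar>ip (P (\<tau> j) x') (\<lambda>i. F x' (a j) i - F (X j) (a j) i)\<bar> \<le> C * nrm \<xi> * nrm (P (\<tau> j) x')"
            unfolding x'_def[abs_def] by (rule F_lip)
          also have "\<dots> \<le> C * r * z j"
            unfolding \<xi>r using C r Pz by (intro mult_left_mono) auto
          finally have Fb: "ip (P (\<tau> j) x') (F x' (a j)) - ip (P (\<tau> j) x') (\<eta> j) \<le> C * r * z j"
            by (simp add: ip_diff_right \<eta>_def a_def)
          have Gb: "G x' (a j) - G (X j) (a j) \<le> C * z j * r"
            using \<alpha>(3)[OF tj(1), of \<xi> "X j"] \<xi>r r by (simp add: x'_def[abs_def] a_def z_def)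
          have "- (2 * C * z j * r) \<le> (A (\<tau> j) x' + ip (P (\<tau> j) x') (\<eta> j)) - (A (\<tau> j) (X j) + ip (P (\<tau> j) (X j)) (\<eta> j))"
            using eq ge Fb Gb by (simp add: algebra_simps)
          from mult_left_mono[OF this less_imp_le[OF h0]]
          have "- (h * (2 * C * z j * r)) \<le> h * (A (\<tau> j) x' + ip (P (\<tau> j) x') (\<eta> j)) - h * (A (\<tau> j) (X j) + ip (P (\<tau> j) (X j)) (\<eta> j))"
            by (simp only: right_diff_distrib mult_minus_right)
          moreover have "h * (2 * C * z j * r + e1) = h * (2 * C * z j * r) + h * (e1 / 2) + h * (e1 / 2)"
            by (simp add: algebra_simps)
          ultimately show ?thesis using s1 s2 unfolding \<Delta>S \<Delta>j by linarith
        qed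
        have space: "\<bar>U t (\<lambda>i. x i + \<xi> i) - U t x - ip (P t x) \<xi>\<bar> \<le> 1/4 * r"
          if "t \<in> {0..T}" "nrm x \<le> R" for t x
          unfolding \<xi>r[symmetric] by (rule c1_along_space[OF U that(1)]) (rule shift[OF that \<xi>r])
        have "\<Delta> 0 - (\<Sum>j<m. h * (2 * C * z j * r + e1)) \<le> \<Delta> m" if "m \<le> k" for m
          using that
        proof (induction m)
          case (Suc m) then show ?case using inc[of m] by simp
        qed simp
        then have "\<Delta> 0 - (\<Sum>j<k. h * (2 * C * z j * r + e1)) \<le> \<Delta> k" by simp
        moreover have "(\<Sum>j<k. h * (2 * C * z j * r + e1)) = 2 * C * h * (\<Sum>j<k. z j) * r + real k * h * e1"
          by (simp add: sum.distrib sum_distrib_left sum_distrib_right algebra_simps)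
        moreover have "real k * h * e1 \<le> r / 2"
        proof -
          have "real k * h \<le> T - t0" using \<tau>in[OF k] by (auto simp: \<tau>_def)
          from mult_right_mono[OF this less_imp_le[OF e1(1)]] show ?thesis using e1(3) by (simp add: mult.commute)
        qed
        moreover have "\<Delta> k \<le> ip (P (\<tau> k) (X k)) \<xi> + 1/4 * r"
          using space[OF \<tau>in[OF k], of "X k"] XZ[of k] unfolding \<Delta>_def R_def by linarith
        moreover have "ip (P t0 x0) \<xi> - 1/4 * r \<le> \<Delta> 0"
          using space[OF t0, of x0] XZ[of 0] unfolding \<Delta>_def R_def \<tau>0 X0 by linarith
        moreover have "ip (P (\<tau> k) (X k)) \<xi> - ip (P t0 x0) \<xi> = - r * nrm p"
        proof -
          have "ip (P (\<tau> k) (X k)) \<xi> - ip (P t0 x0) \<xi> = ip p \<xi>"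
            by (simp add: p_def[abs_def] ip_diff_left)
          also have "\<dots> = (- r / nrm p) * ip p p" unfolding \<xi>_def[abs_def] by (rule ip_scale_right)
          also have "\<dots> = - r * nrm p" using p0 by (simp add: ip_self power2_eq_square)
          finally show ?thesis .
        qed
        ultimately have "r * nrm p \<le> r + 2 * C * h * (\<Sum>j<k. z j) * r" by linarith
        also have "\<dots> = r * (1 + 2 * C * h * (\<Sum>j<k. z j))" by (simp add: algebra_simps)
        finally show ?thesis using r(1) by simp
      qed
      have "nrm (P (\<tau> k) (X k)) \<le> nrm p + nrm (P t0 x0)"
        using nrm_triangle[of p "P t0 x0"] by (simp add: p_def)
      then have "z k \<le> c + (C * h * (\<Sum>j<k. z j) + 2 * C * h * (\<Sum>j<k. z j))"
        using main Xk[of k] unfolding z_def c_def by linarith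
      then show "z k \<le> c + q * (\<Sum>j<k. z j)" by (simp add: q_def algebra_simps)
    qed
    have D: "V (\<tau> k) (X k) - U (\<tau> k) (X k) \<le> V (\<tau> (Suc k)) (X (Suc k)) - U (\<tau> (Suc k)) (X (Suc k)) + h * e1"
      if k: "k < N" for k
    proof -
      have zZ: "z k \<le> Z" using zbound[of k] powZ[of k] k by simp
      have tk: "\<tau> k \<in> {0..T}" "\<tau> k + h \<le> T"
        using \<tau>in[of k] \<tau>in[of "Suc k"] k \<tau>S[of k] by auto
      have xk: "nrm (X k) \<le> R"
        using zZ nrm_nonneg[of "P (\<tau> k) (X k)"] unfolding z_def R_def by linarith
      have \<eta>Z: "nrm (\<eta> k) \<le> C * Z" using \<eta>z[of k] mult_left_mono[OF zZ C] k by linarith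
      have "A (\<tau> k) (X k) + ip (P (\<tau> k) (X k)) (\<eta> k) = - G (X k) (a k)"
        using \<alpha>(1)[OF tk(1), of "X k"] by (simp add: \<eta>_def a_def)
      moreover have "0 \<le> B (\<tau> k) (X k) + ip (Q (\<tau> k) (X k)) (\<eta> k) + G (X k) (a k)"
        unfolding \<eta>_def a_def by (rule V_ge[OF tk(1)])
      ultimately have "A (\<tau> k) (X k) + ip (P (\<tau> k) (X k)) (\<eta> k) \<le> B (\<tau> k) (X k) + ip (Q (\<tau> k) (X k)) (\<eta> k)"
        by linarith
      from mult_left_mono[OF this less_imp_le[OF h0]]
      have "h * (A (\<tau> k) (X k) + ip (P (\<tau> k) (X k)) (\<eta> k)) \<le> h * (B (\<tau> k) (X k) + ip (Q (\<tau> k) (X k)) (\<eta> k))" .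
      moreover have "h * (e1 / 2) + h * (e1 / 2) = h * e1" by simp
      ultimately show ?thesis
        using stepU[OF tk xk \<eta>Z] stepV[OF tk xk \<eta>Z] unfolding XS \<tau>S by linarith
    qed
    have "V t0 x0 - U t0 x0 \<le> V (\<tau> k) (X k) - U (\<tau> k) (X k) + real k * (h * e1)" if "k \<le> N" for k
      using that
    proof (induction k)
      case 0 then show ?case by (simp add: \<tau>0 X0)
    next
      case (Suc k) then show ?case using D[of k] by (simp add: algebra_simps)
    qed
    from this[of N] have "V t0 x0 - U t0 x0 \<le> (real N * h) * e1"
      by (simp add: \<tau>N terminal mult.assoc)
    then show ?thesis using e1(2) hN by (simp add: mult.commute)
  qed
  then have "V t0 x0 - U t0 x0 \<le> 0" by (rule field_le_epsilon[of _ 0, simplified])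
  then show ?thesis by simp
qed

end

section \<open>Finitely valued random vectors on the unit interval\<close>

text \<open>The law of a random vector on the unit interval.\<close>

abbreviation law :: "(real \<Rightarrow> 'x::euclidean_space) \<Rightarrow> 'x measure" where
  "law X \<equiv> distr Omega borel X"

lemma sets_Omega [simp, measurable_cong]: "sets Omega = sets borel"
  by (simp add: Omega_def)

lemma space_Omega [simp]: "space Omega = UNIV"
  by (simp add: Omega_def)

lemma prob_space_Omega: "prob_space Omega"
  unfolding Omega_def by (rule prob_space_uniform_measure) auto

interpretation Om: prob_space Omega
  by (rule prob_space_Omega)

lemma measurable_Omega: "measurable Omega N = measurable borel N"
  by (rule measurable_cong_sets) auto

lemma measure_Omega: "A \<in> sets borel \<Longrightarrow> measure Omega A = measure lborel ({0..1} \<inter> A)"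
  unfolding Omega_def by (subst measure_uniform_measure) auto

lemma Omega_atomless:
  assumes A: "A \<in> sets borel" and c: "0 \<le> c" "c \<le> measure Omega A"
  obtains B where "B \<in> sets borel" "B \<subseteq> A" "measure Omega B = c"
proof -
  define F where "F t = measure Omega (A \<inter> {..t})" for t
  have meas: "A \<inter> {..t} \<in> sets Omega" for t using A by auto
  have le: "F t - F s \<le> t - s" if "s \<le> t" for s t
  proof -
    have "F t = measure Omega (A \<inter> {..s} \<union> A \<inter> {s<..t})"
      unfolding F_def using that by (intro arg_cong[where f = "measure Omega"]) auto
    also have "\<dots> \<le> F s + measure Omega (A \<inter> {s<..t})"
      unfolding F_def using A by (intro measure_Un_le) auto
    also have "measure Omega (A \<inter> {s<..t}) \<le> measure Omega {s<..t}"
      using A by (intro Om.finite_measure_mono) auto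
    also have "\<dots> \<le> measure lborel {s<..t}"
      unfolding measure_Omega[of "{s<..t}", simplified]
      using that by (intro measure_mono_fmeasurable) (auto simp: fmeasurable_def)
    also have "\<dots> = t - s" using that by simp
    finally show ?thesis by simp
  qed
  have mono: "F s \<le> F t" if "s \<le> t" for s t
    unfolding F_def using that A by (intro Om.finite_measure_mono) auto
  have "continuous_on {-1..1} F"
  proof (rule continuous_onI)
    fix x e :: real assume "0 < e"
    have "dist (F x') (F x) \<le> dist x' x" for x'
      using le[of x x'] le[of x' x] mono[of x x'] mono[of x' x] unfolding dist_real_def
      by (cases "x \<le> x'") (auto simp: abs_if)
    then show "\<exists>d>0. \<forall>x'\<in>{-1..1}. dist x' x < d \<longrightarrow> dist (F x') (F x) \<le> e"
      using \<open>0 < e\<close> by (meson le_less_trans less_imp_le)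
  qed
  moreover have "F (-1) = 0"
  proof -
    have "{0..1} \<inter> (A \<inter> {..-1}) = ({}::real set)" by auto
    then show ?thesis unfolding F_def measure_Omega[OF meas[unfolded sets_Omega]] by simp
  qed
  moreover have "F 1 = measure Omega A"
  proof -
    have "{0..1} \<inter> (A \<inter> {..1}) = {0..1} \<inter> A" by auto
    then show ?thesis unfolding F_def measure_Omega[OF meas[unfolded sets_Omega]] measure_Omega[OF A] by simp
  qed
  ultimately obtain t where "F t = c" using IVT'[of F "-1" c 1] c by auto
  then show ?thesis using that[of "A \<inter> {..t}"] A by (auto simp: F_def)
qed

text \<open>The disjoint sets \<open>A z\<close> are cut into pieces of prescribed measures \<open>w j\<close>, the piece \<open>j\<close> being taken
  from \<open>A (\<pi> j)\<close>.\<close>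

lemma split_level_sets:
  assumes "finite J" and "\<And>j. j \<in> J \<Longrightarrow> 0 \<le> w j" and "\<And>z. A z \<in> sets borel" and "disjoint_family A"
    and "\<And>z. (\<Sum>j\<in>{j\<in>J. \<pi> j = z}. w j) \<le> measure Omega (A z)"
  shows "\<exists>B. (\<forall>j\<in>J. B j \<in> sets borel \<and> B j \<subseteq> A (\<pi> j) \<and> measure Omega (B j) = w j) \<and> disjoint_family_on B J"
  using assms
proof (induction J arbitrary: A rule: finite_induct)
  case empty
  then show ?case by (auto simp: disjoint_family_on_def)
next
  case (insert k J)
  have sum_k: "(\<Sum>j\<in>{j\<in>insert k J. \<pi> j = \<pi> k}. w j) = w k + (\<Sum>j\<in>{j\<in>J. \<pi> j = \<pi> k}. w j)"
  proof -
    have "{j\<in>insert k J. \<pi> j = \<pi> k} = insert k {j\<in>J. \<pi> j = \<pi> k}" by auto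
    then show ?thesis using insert.hyps by simp
  qed
  have rest: "0 \<le> (\<Sum>j\<in>{j\<in>J. \<pi> j = \<pi> k}. w j)"
    using insert.prems(1) by (intro sum_nonneg) auto
  have "w k \<le> measure Omega (A (\<pi> k))" using insert.prems(4)[of "\<pi> k"] sum_k rest by linarith
  then obtain Bk where Bk: "Bk \<in> sets borel" "Bk \<subseteq> A (\<pi> k)" "measure Omega Bk = w k"
    using Omega_atomless[OF insert.prems(2)[of "\<pi> k"], of "w k"] insert.prems(1)[of k] by auto
  define A' where "A' = A(\<pi> k := A (\<pi> k) - Bk)"
  have sub: "A' z \<subseteq> A z" for z by (auto simp: A'_def)
  have "\<exists>B. (\<forall>j\<in>J. B j \<in> sets borel \<and> B j \<subseteq> A' (\<pi> j) \<and> measure Omega (B j) = w j) \<and> disjoint_family_on B J"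
  proof (rule insert.IH)
    show "\<And>j. j \<in> J \<Longrightarrow> 0 \<le> w j" using insert.prems(1) by auto
    show "\<And>z. A' z \<in> sets borel" using insert.prems(2) Bk(1) by (auto simp: A'_def)
    show "disjoint_family A'"
      using insert.prems(3) sub unfolding disjoint_family_on_def by blast
    fix z
    show "(\<Sum>j\<in>{j\<in>J. \<pi> j = z}. w j) \<le> measure Omega (A' z)"
    proof (cases "z = \<pi> k")
      case True
      have "measure Omega (A (\<pi> k) - Bk) = measure Omega (A (\<pi> k)) - measure Omega Bk"
        using insert.prems(2) Bk by (intro Om.finite_measure_Diff) auto
      then show ?thesis using True insert.prems(4)[of "\<pi> k"] sum_k Bk(3) by (simp add: A'_def)
    next
      case False
      then have "{j\<in>insert k J. \<pi> j = z} = {j\<in>J. \<pi> j = z}" by auto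
      then show ?thesis using False insert.prems(4)[of z] by (simp add: A'_def)
    qed
  qed
  then obtain B where B: "\<forall>j\<in>J. B j \<in> sets borel \<and> B j \<subseteq> A' (\<pi> j) \<and> measure Omega (B j) = w j"
      "disjoint_family_on B J" by blast
  have disj: "Bk \<inter> B j = {}" if "j \<in> J" for j
  proof (cases "\<pi> j = \<pi> k")
    case True
    then have "A' (\<pi> j) = A (\<pi> k) - Bk" by (simp add: A'_def)
    then have "B j \<subseteq> A (\<pi> k) - Bk" using B(1) that by blast
    then show ?thesis by auto
  next
    case False
    then have "A (\<pi> j) \<inter> A (\<pi> k) = {}" using insert.prems(3) by (auto simp: disjoint_family_on_def)
    moreover have "B j \<subseteq> A (\<pi> j)" using B(1) that sub by blast
    ultimately show ?thesis using Bk(2) by blast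
  qed
  have "(\<forall>j\<in>insert k J. (B(k := Bk)) j \<in> sets borel \<and> (B(k := Bk)) j \<subseteq> A (\<pi> j) \<and> measure Omega ((B(k := Bk)) j) = w j)"
  proof
    fix j assume "j \<in> insert k J"
    then show "(B(k := Bk)) j \<in> sets borel \<and> (B(k := Bk)) j \<subseteq> A (\<pi> j) \<and> measure Omega ((B(k := Bk)) j) = w j"
      using B(1)[rule_format, of j] Bk sub[of "\<pi> j"] insert.hyps(2) by (cases "j = k") auto
  qed
  moreover have "disjoint_family_on (B(k := Bk)) (insert k J)"
    using B(2) disj insert.hyps(2) unfolding disjoint_family_on_def by (auto split: if_splits)
  ultimately show ?case by blast
qed

lemma simple_Omega_iff:
  "simple_function Omega V \<longleftrightarrow> finite (range V) \<and> (\<forall>l. {\<omega>. V \<omega> = l} \<in> sets borel)"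
proof -
  have "V -` {l} = {\<omega>. V \<omega> = l}" for l by auto
  moreover have "{\<omega>. V \<omega> = l} \<in> sets borel" if "l \<notin> range V" for l
  proof -
    have "{\<omega>. V \<omega> = l} = {}" using that by auto
    then show ?thesis by simp
  qed
  ultimately show ?thesis unfolding simple_function_def by fastforce
qed

lemma integral_simple:
  fixes \<phi> :: "'l \<Rightarrow> 'b::{banach, second_countable_topology}"
  assumes "simple_function Omega V"
  shows "integrable Omega (\<lambda>\<omega>. \<phi> (V \<omega>))"
    and "(\<integral>\<omega>. \<phi> (V \<omega>) \<partial>Omega) = (\<Sum>l\<in>range V. measure Omega {\<omega>. V \<omega> = l} *\<^sub>R \<phi> l)"
proof -
  have V: "finite (range V)" "\<And>l. {\<omega>. V \<omega> = l} \<in> sets borel"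
    using assms unfolding simple_Omega_iff by auto
  have eq: "\<phi> (V \<omega>) = (\<Sum>l\<in>range V. indicator {\<omega>. V \<omega> = l} \<omega> *\<^sub>R \<phi> l)" for \<omega>
  proof -
    have "(\<Sum>l\<in>range V. indicator {\<omega>. V \<omega> = l} \<omega> *\<^sub>R \<phi> l) = (\<Sum>l\<in>{V \<omega>}. indicator {\<omega>. V \<omega> = l} \<omega> *\<^sub>R \<phi> l)"
      using V(1) by (intro sum.mono_neutral_right) auto
    then show ?thesis by simp
  qed
  have int: "integrable Omega (\<lambda>\<omega>. indicator {\<omega>. V \<omega> = l} \<omega> *\<^sub>R \<phi> l)" for l
    using V(2) by (intro integrable_scaleR_left) (auto simp: integrable_indicator_iff Om.emeasure_eq_measure)
  show "integrable Omega (\<lambda>\<omega>. \<phi> (V \<omega>))"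
    unfolding eq by (intro Bochner_Integration.integrable_sum int)
  have "(\<integral>\<omega>. \<phi> (V \<omega>) \<partial>Omega) = (\<Sum>l\<in>range V. \<integral>\<omega>. indicator {\<omega>. V \<omega> = l} \<omega> *\<^sub>R \<phi> l \<partial>Omega)"
    unfolding eq by (intro Bochner_Integration.integral_sum int)
  also have "\<dots> = (\<Sum>l\<in>range V. measure Omega {\<omega>. V \<omega> = l} *\<^sub>R \<phi> l)"
    using V(2) by (intro sum.cong refl, subst integral_scaleR_left)
      (auto simp: integrable_indicator_iff Om.emeasure_eq_measure)
  finally show "(\<integral>\<omega>. \<phi> (V \<omega>) \<partial>Omega) = (\<Sum>l\<in>range V. measure Omega {\<omega>. V \<omega> = l} *\<^sub>R \<phi> l)" .
qed

lemma simple_imp_measurable: "simple_function Omega V \<Longrightarrow> V \<in> measurable Omega N" if "range V \<subseteq> space N"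
proof (rule measurableI)
  assume "simple_function Omega V"
  then have V: "finite (range V)" "\<And>l. {\<omega>. V \<omega> = l} \<in> sets borel"
    unfolding simple_Omega_iff by auto
  fix A
  have "V -` A \<inter> space Omega = (\<Union>l\<in>range V \<inter> A. {\<omega>. V \<omega> = l})" by auto
  also have "\<dots> \<in> sets Omega" using V by (auto intro!: sets.finite_UN)
  finally show "V -` A \<inter> space Omega \<in> sets Omega" .
qed (use that in auto)

lemma simple_comp: "simple_function Omega V \<Longrightarrow> simple_function Omega (\<lambda>\<omega>. \<phi> (V \<omega>))"
  using simple_function_compose[of Omega V \<phi>] by (simp add: o_def)

lemma simple_comp2:
  "simple_function Omega V \<Longrightarrow> simple_function Omega W \<Longrightarrow> simple_function Omega (\<lambda>\<omega>. \<phi> (V \<omega>) (W \<omega>))"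
  by (rule simple_function_compose2)

lemma simple_borel [simp]: "simple_function Omega V \<Longrightarrow> V \<in> borel_measurable Omega"
  by (rule simple_imp_measurable) auto

lemma simple_integrable [simp]:
  fixes \<phi> :: "'l \<Rightarrow> 'b::{banach, second_countable_topology}"
  shows "simple_function Omega V \<Longrightarrow> integrable Omega (\<lambda>\<omega>. \<phi> (V \<omega>))"
  by (rule integral_simple)

text \<open>Law and expectation of a function of a finitely valued variable depend on its point masses only.\<close>

lemma same_masses:
  fixes \<phi> :: "'l \<Rightarrow> 'b::{banach, second_countable_topology}" and \<psi> :: "'l \<Rightarrow> 'x::euclidean_space"
  assumes V: "simple_function Omega V" and W: "simple_function Omega W"
    and eq: "\<And>l. measure Omega {\<omega>. V \<omega> = l} = measure Omega {\<omega>. W \<omega> = l}"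
  shows "(\<integral>\<omega>. \<phi> (V \<omega>) \<partial>Omega) = (\<integral>\<omega>. \<phi> (W \<omega>) \<partial>Omega)"
    and "law (\<lambda>\<omega>. \<psi> (V \<omega>)) = law (\<lambda>\<omega>. \<psi> (W \<omega>))"
proof -
  have fin: "finite (range V)" "finite (range W)" using V W unfolding simple_Omega_iff by auto
  have zero: "measure Omega {\<omega>. V \<omega> = l} = 0" if "l \<notin> range V" for l V
  proof -
    have "{\<omega>. V \<omega> = l} = {}" using that by auto
    then show ?thesis by simp
  qed
  have eq': "(\<integral>\<omega>. \<phi> (V \<omega>) \<partial>Omega) = (\<integral>\<omega>. \<phi> (W \<omega>) \<partial>Omega)"
    for \<phi> :: "'l \<Rightarrow> 'c::{banach, second_countable_topology}"
  proof -
    have "(\<integral>\<omega>. \<phi> (V \<omega>) \<partial>Omega) = (\<Sum>l\<in>range V \<union> range W. measure Omega {\<omega>. V \<omega> = l} *\<^sub>R \<phi> l)"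
      unfolding integral_simple(2)[OF V] using fin zero by (intro sum.mono_neutral_left) auto
    also have "\<dots> = (\<integral>\<omega>. \<phi> (W \<omega>) \<partial>Omega)"
      unfolding integral_simple(2)[OF W] eq using fin zero by (intro sum.mono_neutral_right) auto
    finally show ?thesis .
  qed
  show "(\<integral>\<omega>. \<phi> (V \<omega>) \<partial>Omega) = (\<integral>\<omega>. \<phi> (W \<omega>) \<partial>Omega)" by (rule eq')
  show "law (\<lambda>\<omega>. \<psi> (V \<omega>)) = law (\<lambda>\<omega>. \<psi> (W \<omega>))"
  proof (rule measure_eqI)
    fix A assume "A \<in> sets (law (\<lambda>\<omega>. \<psi> (V \<omega>)))"
    then have A: "A \<in> sets borel" by simp
    have *: "emeasure (law (\<lambda>\<omega>. \<psi> (U \<omega>))) A = ennreal (\<integral>\<omega>. indicator A (\<psi> (U \<omega>)) \<partial>Omega)"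
      if U: "simple_function Omega U" for U
    proof -
      have m: "(\<lambda>\<omega>. \<psi> (U \<omega>)) \<in> borel_measurable Omega" by (rule simple_borel[OF simple_comp[OF U]])
      have "(\<integral>\<omega>. indicator A (\<psi> (U \<omega>)) \<partial>Omega) = (\<integral>\<omega>. indicator ((\<lambda>\<omega>. \<psi> (U \<omega>)) -` A) \<omega> \<partial>Omega :: real)"
        by (intro Bochner_Integration.integral_cong) (auto simp: indicator_def)
      also have "\<dots> = measure Omega ((\<lambda>\<omega>. \<psi> (U \<omega>)) -` A)" by simp
      finally show ?thesis using m A by (simp add: emeasure_distr Om.emeasure_eq_measure)
    qed
    show "emeasure (law (\<lambda>\<omega>. \<psi> (V \<omega>))) A = emeasure (law (\<lambda>\<omega>. \<psi> (W \<omega>))) A"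
      unfolding *[OF V] *[OF W] using eq'[of "\<lambda>l. indicator A (\<psi> l) :: real"] by simp
  qed simp
qed

text \<open>If \<open>X\<close> has the law of a function \<open>\<pi>\<close> of a finitely valued label \<open>V\<close>, then \<open>X\<close> is itself the function
  \<open>\<pi>\<close> of a label with the distribution of \<open>V\<close>, because the unit interval has no atoms.\<close>

lemma transfer_label:
  fixes X :: "real \<Rightarrow> 'x::euclidean_space"
  assumes V: "simple_function Omega V" and X: "X \<in> borel_measurable Omega"
    and law: "law X = law (\<lambda>\<omega>. \<pi> (V \<omega>))"
  obtains W where "simple_function Omega W"
    "\<And>l. measure Omega {\<omega>. W \<omega> = l} = measure Omega {\<omega>. V \<omega> = l}" "AE \<omega> in Omega. X \<omega> = \<pi> (W \<omega>)"
proof -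
  define J where "J = range V"
  define A where "A z = {\<omega>. X \<omega> = z}" for z
  define w where "w l = measure Omega {\<omega>. V \<omega> = l}" for l
  have fin: "finite J" and Vm: "\<And>l. {\<omega>. V \<omega> = l} \<in> sets borel"
    using V unfolding simple_Omega_iff J_def by auto
  have Am: "A z \<in> sets borel" for z
  proof -
    have "X -` {z} \<inter> space Omega \<in> sets Omega" using X by (rule measurable_sets) simp
    moreover have "X -` {z} \<inter> space Omega = A z" by (auto simp: A_def)
    ultimately show ?thesis by simp
  qed
  have mass: "measure Omega (A z) = (\<Sum>j\<in>{j\<in>J. \<pi> j = z}. w j)" for z
  proof -
    have m: "(\<lambda>\<omega>. \<pi> (V \<omega>)) \<in> borel_measurable Omega" by (rule simple_borel[OF simple_comp[OF V]])
    have "measure Omega (A z) = measure (law X) {z}"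
      using X by (simp add: measure_distr A_def vimage_def)
    also have "\<dots> = measure Omega {\<omega>. \<pi> (V \<omega>) = z}"
      unfolding law using m by (simp add: measure_distr vimage_def)
    also have "{\<omega>. \<pi> (V \<omega>) = z} = (\<Union>j\<in>{j\<in>J. \<pi> j = z}. {\<omega>. V \<omega> = j})"
      by (auto simp: J_def)
    also have "measure Omega \<dots> = (\<Sum>j\<in>{j\<in>J. \<pi> j = z}. w j)"
      unfolding w_def using fin Vm
      by (intro Om.finite_measure_finite_Union) (auto simp: disjoint_family_on_def)
    finally show ?thesis .
  qed
  have "\<exists>B. (\<forall>j\<in>J. B j \<in> sets borel \<and> B j \<subseteq> A (\<pi> j) \<and> measure Omega (B j) = w j) \<and> disjoint_family_on B J"
    using fin Am mass by (intro split_level_sets) (auto simp: w_def disjoint_family_on_def A_def)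
  then obtain B where B: "\<And>j. j \<in> J \<Longrightarrow> B j \<in> sets borel" "\<And>j. j \<in> J \<Longrightarrow> B j \<subseteq> A (\<pi> j)"
      "\<And>j. j \<in> J \<Longrightarrow> measure Omega (B j) = w j" "disjoint_family_on B J" by blast
  define E where "E = (\<Union>j\<in>J. B j)"
  define W where "W \<omega> = (if \<omega> \<in> E then (THE j. j \<in> J \<and> \<omega> \<in> B j) else V 0)" for \<omega>
  have W: "W \<omega> = j" if "j \<in> J" "\<omega> \<in> B j" for j \<omega>
  proof -
    have "(THE j. j \<in> J \<and> \<omega> \<in> B j) = j"
      using that B(4) by (intro the_equality) (auto simp: disjoint_family_on_def)
    then show ?thesis using that by (auto simp: W_def E_def)
  qed
  have Em: "E \<in> sets borel" using B(1) fin by (auto simp: E_def)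
  have "measure Omega E = (\<Sum>j\<in>J. w j)"
    unfolding E_def using B fin by (subst Om.finite_measure_finite_Union) auto
  also have "\<dots> = measure Omega (\<Union>j\<in>J. {\<omega>. V \<omega> = j})"
    unfolding w_def using fin Vm
    by (subst Om.finite_measure_finite_Union) (auto simp: disjoint_family_on_def)
  also have "(\<Union>j\<in>J. {\<omega>. V \<omega> = j}) = space Omega" by (auto simp: J_def)
  finally have E1: "measure Omega E = 1" using Om.prob_space by simp
  have E0: "measure Omega (- E) = 0"
    using Om.prob_compl[of E] Em E1 by (simp add: Compl_eq_Diff_UNIV)
  have WJ: "W \<omega> \<in> J" for \<omega>
  proof (cases "\<omega> \<in> E")
    case True
    then obtain j where "j \<in> J" "\<omega> \<in> B j" by (auto simp: E_def)
    then show ?thesis using W by simp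
  next
    case False
    then show ?thesis by (simp add: W_def J_def)
  qed
  have lev: "{\<omega>. W \<omega> = j} = (if j \<in> J then B j else {}) \<union> (if j = V 0 then - E else {})" for j
  proof (intro set_eqI)
    fix \<omega>
    show "\<omega> \<in> {\<omega>. W \<omega> = j} \<longleftrightarrow> \<omega> \<in> (if j \<in> J then B j else {}) \<union> (if j = V 0 then - E else {})"
    proof (cases "\<omega> \<in> E")
      case True
      then obtain i where i: "i \<in> J" "\<omega> \<in> B i" by (auto simp: E_def)
      have "j \<in> J \<Longrightarrow> \<omega> \<in> B j \<Longrightarrow> i = j" using W i by metis
      then show ?thesis using i W[OF i] True by auto
    next
      case False
      then show ?thesis by (auto simp: W_def E_def)
    qed
  qed
  have "{\<omega>. W \<omega> = j} \<in> sets borel" for j unfolding lev using B(1) Em by auto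
  moreover have "finite (range W)" using fin WJ by (meson finite_subset image_subsetI)
  ultimately have Ws: "simple_function Omega W" unfolding simple_Omega_iff by auto
  have "measure Omega {\<omega>. W \<omega> = l} = w l" for l
  proof (cases "l \<in> J")
    case True
    have "measure Omega {\<omega>. W \<omega> = l} = measure Omega (B l \<union> (if l = V 0 then - E else {}))"
      unfolding lev using True by simp
    also have "\<dots> = measure Omega (B l)"
      using E0 Em B(1)[OF True] by (intro Om.measure_zero_union) auto
    finally show ?thesis using B(3)[OF True] by simp
  next
    case False
    then have "{\<omega>. W \<omega> = l} = {}" "{\<omega>. V \<omega> = l} = {}" using WJ by (auto simp: J_def)
    then show ?thesis by (simp add: w_def)
  qed
  moreover have "AE \<omega> in Omega. X \<omega> = \<pi> (W \<omega>)"
  proof (rule AE_I)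
    show "{\<omega> \<in> space Omega. X \<omega> \<noteq> \<pi> (W \<omega>)} \<subseteq> - E"
      using B(2) W by (force simp: E_def A_def)
    show "emeasure Omega (- E) = 0" using E0 by (simp add: Om.emeasure_eq_measure)
  qed (use Em in auto)
  ultimately show ?thesis using that Ws by (simp add: w_def)
qed

lemma sq_integrable_simple [simp]: "simple_function Omega V \<Longrightarrow> sq_integrable (V :: real \<Rightarrow> 'b::real_normed_vector)"
  unfolding sq_integrable_def
  by (auto intro: simple_integrable[where \<phi> = "\<lambda>x. (norm x)\<^sup>2"])

text \<open>The representative in the definition of the L-derivative is arbitrary. For a finitely valued \<open>Z\<close>
  the expansion holds at \<open>Z\<close> itself, for finitely valued perturbations \<open>\<Xi>\<close>: the pair \<open>(Z, \<Xi>)\<close> is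
  reproduced on the given representative.\<close>

lemma L_deriv_simple:
  fixes h :: "'x::euclidean_space measure \<Rightarrow> 'b::real_normed_vector" and \<phi> :: "'b \<Rightarrow>\<^sub>L real"
  assumes h: "has_L_deriv h (law Z) D" and Z: "simple_function Omega Z" and "0 < \<epsilon>"
  shows "\<exists>\<delta>>0. \<forall>\<Xi>. simple_function Omega \<Xi> \<longrightarrow> l2norm \<Xi> < \<delta> \<longrightarrow>
    \<bar>\<phi> (h (law (\<lambda>\<omega>. Z \<omega> + \<Xi> \<omega>))) - \<phi> (h (law Z)) - (\<integral>\<omega>. \<phi> (D (Z \<omega>) (\<Xi> \<omega>)) \<partial>Omega)\<bar> \<le> \<epsilon> * l2norm \<Xi>"
proof -
  obtain X where X: "sq_integrable X" "law X = law Z" "D \<in> borel_measurable borel"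
     and F: "\<And>\<phi> :: 'b \<Rightarrow>\<^sub>L real. \<And>\<epsilon>. 0 < \<epsilon> \<Longrightarrow> \<exists>\<delta>>0. \<forall>Y. sq_integrable Y \<longrightarrow> l2norm Y < \<delta> \<longrightarrow>
           \<bar>\<phi> (h (law (\<lambda>\<omega>. X \<omega> + Y \<omega>))) - \<phi> (h (law X))
              - (\<integral>\<omega>. \<phi> (D (X \<omega>) (Y \<omega>)) \<partial>Omega)\<bar> \<le> \<epsilon> * l2norm Y"
    using h unfolding has_L_deriv_def by blast
  have Xm: "X \<in> borel_measurable Omega" using X by (simp add: sq_integrable_def)
  obtain \<delta> where \<delta>: "0 < \<delta>" "\<And>Y. sq_integrable Y \<Longrightarrow> l2norm Y < \<delta> \<Longrightarrow>
           \<bar>\<phi> (h (law (\<lambda>\<omega>. X \<omega> + Y \<omega>))) - \<phi> (h (law X))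
              - (\<integral>\<omega>. \<phi> (D (X \<omega>) (Y \<omega>)) \<partial>Omega)\<bar> \<le> \<epsilon> * l2norm Y"
    using F[OF \<open>0 < \<epsilon>\<close>, of \<phi>] by blast
  have "\<bar>\<phi> (h (law (\<lambda>\<omega>. Z \<omega> + \<Xi> \<omega>))) - \<phi> (h (law Z)) - (\<integral>\<omega>. \<phi> (D (Z \<omega>) (\<Xi> \<omega>)) \<partial>Omega)\<bar> \<le> \<epsilon> * l2norm \<Xi>"
    if \<Xi>: "simple_function Omega \<Xi>" "l2norm \<Xi> < \<delta>" for \<Xi>
  proof -
    have V: "simple_function Omega (\<lambda>\<omega>. (Z \<omega>, \<Xi> \<omega>))" by (rule simple_comp2[OF Z \<Xi>(1)])
    obtain W where W: "simple_function Omega W"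
        "\<And>l. measure Omega {\<omega>. W \<omega> = l} = measure Omega {\<omega>. (Z \<omega>, \<Xi> \<omega>) = l}"
        "AE \<omega> in Omega. X \<omega> = fst (W \<omega>)"
      using transfer_label[OF V Xm, of fst] X(2) by auto
    define Y where "Y \<omega> = snd (W \<omega>)" for \<omega>
    have Y: "simple_function Omega Y" unfolding Y_def[abs_def] by (rule simple_comp[OF W(1)])
    have W1: "simple_function Omega (\<lambda>\<omega>. fst (W \<omega>))" by (rule simple_comp[OF W(1)])
    note same = same_masses[OF W(1) V W(2)]
    have Yn: "l2norm Y = l2norm \<Xi>"
      unfolding l2norm_def Y_def using same(1)[of "\<lambda>l. (norm (snd l))\<^sup>2"] by simp
    have "law (\<lambda>\<omega>. X \<omega> + Y \<omega>) = law (\<lambda>\<omega>. fst (W \<omega>) + snd (W \<omega>))"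
      using W(3) borel_measurable_add[OF Xm simple_borel[OF Y]]
        simple_borel[OF simple_comp[OF W(1), of "\<lambda>l. fst l + snd l"]]
      by (intro distr_cong_AE) (auto simp: Y_def)
    also have "\<dots> = law (\<lambda>\<omega>. Z \<omega> + \<Xi> \<omega>)" using same(2)[of "\<lambda>l. fst l + snd l"] by simp
    finally have l: "law (\<lambda>\<omega>. X \<omega> + Y \<omega>) = law (\<lambda>\<omega>. Z \<omega> + \<Xi> \<omega>)" .
    have meas: "(\<lambda>\<omega>. \<phi> (D (X \<omega>) (Y \<omega>))) \<in> borel_measurable Omega"
    proof (rule measurable_compose_countable'[where I = "range Y" and g = Y])
      have DX: "(\<lambda>\<omega>. D (X \<omega>)) \<in> borel_measurable Omega"
        using measurable_compose[OF Xm X(3)] .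
      fix y
      show "(\<lambda>\<omega>. \<phi> (D (X \<omega>) y)) \<in> borel_measurable Omega"
        by (rule measurable_compose[OF DX borel_measurable_continuous_onI])
          (intro continuous_intros)
    next
      show "Y \<in> measurable Omega (count_space (range Y))" by (rule simple_imp_measurable[OF _ Y]) simp
      show "countable (range Y)" using Y by (simp add: simple_Omega_iff countable_finite)
    qed
    have "(\<integral>\<omega>. \<phi> (D (X \<omega>) (Y \<omega>)) \<partial>Omega) = (\<integral>\<omega>. \<phi> (D (fst (W \<omega>)) (snd (W \<omega>))) \<partial>Omega)"
      using W(3) meas simple_comp[OF W(1), of "\<lambda>l. \<phi> (D (fst l) (snd l))"]
      by (intro integral_cong_AE) (auto simp: Y_def)
    also have "\<dots> = (\<integral>\<omega>. \<phi> (D (Z \<omega>) (\<Xi> \<omega>)) \<partial>Omega)"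
      using same(1)[of "\<lambda>l. \<phi> (D (fst l) (snd l))"] by simp
    finally show ?thesis using \<delta>(2)[of Y] Y \<Xi>(2) Yn l X(2) by simp
  qed
  then show ?thesis using \<delta>(1) by blast
qed

section \<open>The Wasserstein distance and second moments\<close>

lemma law_P2: "sq_integrable X \<Longrightarrow> law X \<in> P2"
  unfolding P2_def sq_integrable_def
  by (auto intro!: Om.prob_space_distr simp: integrable_distr_eq)

text \<open>The joint law of \<open>X\<close> and \<open>Y\<close> is a coupling.\<close>

lemma wasserstein_le:
  assumes X: "X \<in> borel_measurable Omega" and Y: "Y \<in> borel_measurable Omega"
  shows "wasserstein 2 (law X) (law Y) \<le> l2norm (\<lambda>\<omega>. X \<omega> - Y \<omega>)"
proof -
  define \<pi> where "\<pi> = distr Omega borel (\<lambda>\<omega>. (X \<omega>, Y \<omega>))"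
  have m: "(\<lambda>\<omega>. (X \<omega>, Y \<omega>)) \<in> borel_measurable Omega" using X Y by measurable
  have "\<pi> \<in> couplings (law X) (law Y)"
  proof -
    have f: "fst \<in> borel_measurable (borel :: ('a \<times> 'a) measure)" "snd \<in> borel_measurable (borel :: ('a \<times> 'a) measure)"
      by (auto intro!: borel_measurable_continuous_onI continuous_intros)
    show ?thesis
      unfolding couplings_def \<pi>_def using m by (simp add: distr_distr[OF f(1)] distr_distr[OF f(2)] o_def)
  qed
  moreover have "bdd_below ((\<lambda>\<pi>. \<integral>z. norm (fst z - snd z) powr 2 \<partial>\<pi>) ` couplings (law X) (law Y))"
    by (rule bdd_belowI[where m = 0]) auto
  ultimately have "(INF \<pi>\<in>couplings (law X) (law Y). \<integral>z. norm (fst z - snd z) powr 2 \<partial>\<pi>)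
      \<le> (\<integral>z. norm (fst z - snd z) powr 2 \<partial>\<pi>)"
    by (intro cINF_lower)
  also have "\<dots> = (\<integral>\<omega>. (norm (X \<omega> - Y \<omega>))\<^sup>2 \<partial>Omega)"
    unfolding \<pi>_def using m
    by (subst integral_distr) (auto intro!: borel_measurable_continuous_onI continuous_intros)
  finally have le: "(INF \<pi>\<in>couplings (law X) (law Y). \<integral>z. norm (fst z - snd z) powr 2 \<partial>\<pi>)
      \<le> (\<integral>\<omega>. (norm (X \<omega> - Y \<omega>))\<^sup>2 \<partial>Omega)" .
  have "0 \<le> (INF \<pi>\<in>couplings (law X) (law Y). \<integral>z. norm (fst z - snd z) powr 2 \<partial>\<pi>)"
    using \<open>\<pi> \<in> couplings (law X) (law Y)\<close> by (intro cINF_greatest) auto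
  then show ?thesis
    unfolding wasserstein_def l2norm_def using powr_mono2[OF _ _ le, of "1/2"]
    by (simp add: powr_half_sqrt)
qed

section \<open>Mean value inequalities\<close>

lemma fd_has_derivative: "F differentiable (at x) \<Longrightarrow> (F has_derivative blinfun_apply (fd F x)) (at x)"
proof -
  assume "F differentiable (at x)"
  then have "(F has_derivative frechet_derivative F (at x)) (at x)"
    by (simp add: frechet_derivative_works)
  moreover from this have "blinfun_apply (fd F x) = frechet_derivative F (at x)"
    unfolding fd_def by (intro bounded_linear_Blinfun_apply has_derivative_bounded_linear)
  ultimately show ?thesis by simp
qed

lemma fd_lipschitz:
  assumes "\<And>y. F differentiable (at y)" "\<And>y. norm (fd F y) \<le> C"
  shows "norm (F y - F x) \<le> C * norm (y - x)"
  using assms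
  by (intro differentiable_bound[where S = UNIV and f' = "\<lambda>y. blinfun_apply (fd F y)"])
     (auto intro: fd_has_derivative simp flip: norm_blinfun.rep_eq)

lemma fd_taylor:
  assumes F: "\<And>y. F differentiable (at y)" "\<And>y. fd F differentiable (at y)"
    and C: "\<And>y. norm (fd (fd F) y) \<le> C"
  shows "norm (F (x + v) - F x - fd F x v) \<le> C * (norm v)\<^sup>2"
proof -
  have C0: "0 \<le> C" using C[of x] norm_ge_zero order_trans by blast
  have *: "norm (F (x + v) - F x - fd F x ((x + v) - x)) \<le> norm ((x + v) - x) * (C * norm v)"
  proof (rule differentiable_bound_linearization[where S = "cball x (norm v)"])
    fix t :: real assume t: "t \<in> {0..1}"
    then have "\<bar>t\<bar> * norm v \<le> 1 * norm v" by (intro mult_right_mono) auto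
    then show "x + t *\<^sub>R (x + v - x) \<in> cball x (norm v)" by (simp add: dist_norm)
  next
    fix y assume "y \<in> cball x (norm v)"
    then have y: "norm (y - x) \<le> norm v" by (simp add: dist_norm norm_minus_commute)
    show "(F has_derivative blinfun_apply (fd F y)) (at y within cball x (norm v))"
      using fd_has_derivative[OF F(1)] by (rule has_derivative_at_withinI)
    have "onorm (blinfun_apply (fd F y) - blinfun_apply (fd F x)) = norm (fd F y - fd F x)"
      by (simp add: norm_blinfun.rep_eq minus_blinfun.rep_eq fun_diff_def)
    also have "\<dots> \<le> C * norm (y - x)" by (rule fd_lipschitz[OF F(2) C])
    also have "\<dots> \<le> C * norm v" using y C0 by (rule mult_left_mono)
    finally show "onorm (blinfun_apply (fd F y) - blinfun_apply (fd F x)) \<le> C * norm v" .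
  qed auto
  then show ?thesis by (simp add: power2_eq_square mult_ac)
qed

lemma mixed_difference:
  assumes "\<And>x y. H x differentiable (at y)" "\<And>x y. (\<lambda>x'. fd (H x') y) differentiable (at x)"
    and C: "\<And>x y. norm (fd (\<lambda>x'. fd (H x') y) x) \<le> C"
  shows "norm (H x1 y1 - H x0 y1 - (H x1 y0 - H x0 y0)) \<le> C * norm (x1 - x0) * norm (y1 - y0)"
proof (rule differentiable_bound[where S = UNIV and
      f' = "\<lambda>y v. fd (H x1) y v - fd (H x0) y v" and f = "\<lambda>y. H x1 y - H x0 y"])
  fix y
  show "((\<lambda>y. H x1 y - H x0 y) has_derivative (\<lambda>v. fd (H x1) y v - fd (H x0) y v)) (at y within UNIV)"
    using assms(1) by (auto intro!: has_derivative_diff fd_has_derivative)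
  have "onorm (\<lambda>v. fd (H x1) y v - fd (H x0) y v) = norm (fd (H x1) y - fd (H x0) y)"
    by (simp add: norm_blinfun.rep_eq minus_blinfun.rep_eq)
  also have "\<dots> \<le> C * norm (x1 - x0)" by (rule fd_lipschitz[OF assms(2) C])
  finally show "onorm (\<lambda>v. fd (H x1) y v - fd (H x0) y v) \<le> C * norm (x1 - x0)" .
qed auto

section \<open>Joint continuity\<close>

text \<open>The filter of neighbourhoods of a point and a measure, which turns joint continuity into a
  statement about limits.\<close>

definition jnhds :: "'p::metric_space set \<Rightarrow> 'p \<Rightarrow> 'x::euclidean_space measure \<Rightarrow> ('p \<times> 'x measure) filter" where
  "jnhds S p \<mu> = (INF \<delta>\<in>{0<..}. principal {(p', \<mu>'). p' \<in> S \<and> \<mu>' \<in> P2 \<and> dist p' p < \<delta> \<and> wasserstein 2 \<mu>' \<mu> < \<delta>})"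

lemma eventually_jnhds:
  "eventually P (jnhds S p \<mu>) \<longleftrightarrow>
    (\<exists>\<delta>>0. \<forall>p'\<in>S. \<forall>\<mu>'\<in>P2. dist p' p < \<delta> \<longrightarrow> wasserstein 2 \<mu>' \<mu> < \<delta> \<longrightarrow> P (p', \<mu>'))"
  unfolding jnhds_def
proof (subst eventually_INF_base)
  fix a b :: real assume "a \<in> {0<..}" "b \<in> {0<..}"
  then show "\<exists>x\<in>{0<..}. principal {(p', \<mu>'). p' \<in> S \<and> \<mu>' \<in> P2 \<and> dist p' p < x \<and> wasserstein 2 \<mu>' \<mu> < x}
     \<le> inf (principal {(p', \<mu>'). p' \<in> S \<and> \<mu>' \<in> P2 \<and> dist p' p < a \<and> wasserstein 2 \<mu>' \<mu> < a})
           (principal {(p', \<mu>'). p' \<in> S \<and> \<mu>' \<in> P2 \<and> dist p' p < b \<and> wasserstein 2 \<mu>' \<mu> < b})"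
    by (intro bexI[of _ "min a b"]) auto
qed (auto simp: eventually_principal)

lemma jcont_tendsto:
  "jcont S F \<longleftrightarrow> (\<forall>p\<in>S. \<forall>\<mu>\<in>P2. ((\<lambda>z. F (fst z) (snd z)) \<longlongrightarrow> F p \<mu>) (jnhds S p \<mu>))"
  unfolding jcont_def tendsto_iff eventually_jnhds by simp

lemma jcont_inner_components:
  fixes F :: "'p::metric_space \<Rightarrow> 'x::euclidean_space measure \<Rightarrow> 'b::euclidean_space"
  assumes "\<And>b. b \<in> Basis \<Longrightarrow> jcont S (\<lambda>p \<mu>. F p \<mu> \<bullet> b)"
  shows "jcont S F"
  unfolding jcont_tendsto
proof (intro ballI)
  fix p and \<mu> :: "'x measure" assume "p \<in> S" "\<mu> \<in> P2"
  then show "((\<lambda>z. F (fst z) (snd z)) \<longlongrightarrow> F p \<mu>) (jnhds S p \<mu>)"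
    using assms unfolding jcont_tendsto by (subst tendsto_componentwise_iff) blast
qed

lemma jcont_shift:
  fixes F :: "'p::real_normed_vector \<Rightarrow> 'x::euclidean_space measure \<Rightarrow> 'b::metric_space"
  assumes "jcont UNIV F" shows "jcont UNIV (\<lambda>p \<mu>. F (p + v) \<mu>)"
  unfolding jcont_def
proof (intro ballI allI impI)
  fix p and \<mu> :: "'x measure" and \<epsilon> :: real assume *: "\<mu> \<in> P2" "0 < \<epsilon>"
  obtain \<delta> where "\<delta> > 0" "\<And>p' \<mu>'. \<mu>' \<in> P2 \<Longrightarrow> dist p' (p + v) < \<delta> \<Longrightarrow> wasserstein 2 \<mu>' \<mu> < \<delta> \<Longrightarrow>
      dist (F p' \<mu>') (F (p + v) \<mu>) < \<epsilon>"
    using assms * unfolding jcont_def by (metis UNIV_I)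
  then show "\<exists>\<delta>>0. \<forall>p'\<in>UNIV. \<forall>\<mu>'\<in>P2. dist p' p < \<delta> \<longrightarrow> wasserstein 2 \<mu>' \<mu> < \<delta> \<longrightarrow>
      dist (F (p' + v) \<mu>') (F (p + v) \<mu>) < \<epsilon>"
    by (intro exI[of _ \<delta>]) auto
qed

lemma wasserstein_self: "X \<in> borel_measurable Omega \<Longrightarrow> wasserstein 2 (law X) (law X) \<le> 0"
  using wasserstein_le[of X X] by (simp add: l2norm_def)

lemma jcont_imp_continuous:
  assumes F: "jcont UNIV (\<lambda>x \<mu>. F \<mu> x)" and X: "sq_integrable X"
  shows "continuous_on UNIV (F (law X))"
  unfolding continuous_on_iff
proof (intro ballI allI impI)
  fix x and e :: real assume "0 < e"
  moreover have m: "law X \<in> P2" by (rule law_P2[OF X])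
  ultimately obtain \<delta> where \<delta>: "\<delta> > 0" "\<forall>p'\<in>UNIV. \<forall>\<mu>'\<in>P2. dist p' x < \<delta> \<longrightarrow> wasserstein 2 \<mu>' (law X) < \<delta> \<longrightarrow>
      dist (F \<mu>' p') (F (law X) x) < e"
    using F unfolding jcont_def by blast
  have "wasserstein 2 (law X) (law X) < \<delta>"
    using wasserstein_self[of X] X \<delta>(1) by (simp add: sq_integrable_def)
  then show "\<exists>d>0. \<forall>x'\<in>UNIV. dist x' x < d \<longrightarrow> dist (F (law X) x') (F (law X) x) < e"
    using \<delta> m by blast
qed

section \<open>Second moments\<close>

text \<open>The second moment of a measure.\<close>

definition sm :: "'x::euclidean_space measure \<Rightarrow> real" where
  "sm \<mu> = (\<integral>x. (norm x)\<^sup>2 \<partial>\<mu>)"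

lemma mnorm_2: "mnorm 2 \<mu> = sqrt (sm \<mu>)"
  by (simp add: mnorm_def sm_def powr_half_sqrt)

lemma sm_nonneg [simp]: "0 \<le> sm \<mu>" by (simp add: sm_def)

lemma P2D:
  assumes "\<mu> \<in> P2"
  shows "sets \<mu> = sets borel" "prob_space \<mu>" "integrable \<mu> (\<lambda>x. (norm x)\<^sup>2)" "space \<mu> = UNIV"
  using assms sets_eq_imp_space_eq[of \<mu> borel] by (auto simp: P2_def)

lemma norm_sq_le: "(norm (a + b))\<^sup>2 \<le> 2 * (norm a)\<^sup>2 + 2 * (norm (b :: 'b::real_normed_vector))\<^sup>2"
proof -
  have "(norm (a + b))\<^sup>2 \<le> (norm a + norm b)\<^sup>2" by (intro power_mono norm_triangle_ineq) auto
  also have "\<dots> \<le> 2 * (norm a)\<^sup>2 + 2 * (norm b)\<^sup>2"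
    using sum_squares_bound[of "norm a" "norm b"] by (simp add: power2_sum)
  finally show ?thesis .
qed

text \<open>A ball in the Wasserstein distance has bounded second moments.\<close>

lemma wasserstein_moment:
  assumes X: "sq_integrable (X :: real \<Rightarrow> 'x::euclidean_space)" and Y: "sq_integrable Y" and W: "wasserstein 2 (law X) (law Y) < \<delta>"
  shows "sm (law X) \<le> 2 * sm (law Y) + 2 * \<delta>\<^sup>2"
proof -
  let ?C = "couplings (law X) (law Y)" and ?I = "\<lambda>\<pi>. \<integral>z. norm (fst z - snd z) powr 2 \<partial>\<pi>"
  have Xm: "X \<in> borel_measurable Omega" "Y \<in> borel_measurable Omega"
    using X Y by (auto simp: sq_integrable_def)
  have f: "fst \<in> borel_measurable (borel :: ('x \<times> 'x) measure)" "snd \<in> borel_measurable (borel :: ('x \<times> 'x) measure)"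
    by (auto intro!: borel_measurable_continuous_onI continuous_intros)
  have m: "(\<lambda>\<omega>. (X \<omega>, Y \<omega>)) \<in> borel_measurable Omega" using Xm by measurable
  have "distr Omega borel (\<lambda>\<omega>. (X \<omega>, Y \<omega>)) \<in> ?C"
    unfolding couplings_def using m by (simp add: distr_distr[OF f(1)] distr_distr[OF f(2)] o_def)
  then have ne: "?C \<noteq> {}" by auto
  have bdd: "bdd_below (?I ` ?C)" by (rule bdd_belowI[where m = 0]) auto
  have I0: "0 \<le> (INF \<pi>\<in>?C. ?I \<pi>)" using ne by (intro cINF_greatest) auto
  have "sqrt (INF \<pi>\<in>?C. ?I \<pi>) < \<delta>" using W unfolding wasserstein_def powr_half_sqrt[OF I0] .
  moreover have "0 \<le> sqrt (INF \<pi>\<in>?C. ?I \<pi>)" using I0 by simp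
  ultimately have "(sqrt (INF \<pi>\<in>?C. ?I \<pi>))\<^sup>2 < \<delta>\<^sup>2" by (intro power_strict_mono) auto
  then have "(INF \<pi>\<in>?C. ?I \<pi>) < \<delta>\<^sup>2" using I0 by simp
  then obtain \<pi> where \<pi>: "\<pi> \<in> ?C" "?I \<pi> < \<delta>\<^sup>2"
    using cINF_less_iff[OF ne bdd] by auto
  have s: "sets \<pi> = sets borel" "distr \<pi> borel fst = law X" "distr \<pi> borel snd = law Y"
    using \<pi>(1) by (auto simp: couplings_def)
  have mf: "fst \<in> borel_measurable \<pi>" "snd \<in> borel_measurable \<pi>"
    using f measurable_cong_sets[OF s(1) refl] by auto
  have ix: "integrable \<pi> (\<lambda>z. (norm (fst z))\<^sup>2)"
    using P2D(3)[OF law_P2[OF X]] mf unfolding s(2)[symmetric] by (subst (asm) integrable_distr_eq) auto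
  have iy: "integrable \<pi> (\<lambda>z. (norm (snd z))\<^sup>2)"
    using P2D(3)[OF law_P2[OF Y]] mf unfolding s(3)[symmetric] by (subst (asm) integrable_distr_eq) auto
  have id: "integrable \<pi> (\<lambda>z. (norm (fst z - snd z))\<^sup>2)"
  proof (rule Bochner_Integration.integrable_bound)
    show "integrable \<pi> (\<lambda>z. 2 * (norm (fst z))\<^sup>2 + 2 * (norm (snd z))\<^sup>2)" using ix iy by auto
    show "(\<lambda>z. (norm (fst z - snd z))\<^sup>2) \<in> borel_measurable \<pi>" using mf by measurable
    show "AE z in \<pi>. norm ((norm (fst z - snd z))\<^sup>2) \<le> norm (2 * (norm (fst z))\<^sup>2 + 2 * (norm (snd z))\<^sup>2)"
      using norm_sq_le[of "fst z" "- snd z" for z] by (intro AE_I2) auto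
  qed
  have "sm (law X) = (\<integral>z. (norm (fst z))\<^sup>2 \<partial>\<pi>)"
    unfolding sm_def s(2)[symmetric] using mf by (subst integral_distr) auto
  also have "\<dots> \<le> (\<integral>z. 2 * (norm (snd z))\<^sup>2 + 2 * (norm (fst z - snd z))\<^sup>2 \<partial>\<pi>)"
    using ix iy id norm_sq_le[of "snd z" "fst z - snd z" for z] by (intro integral_mono) auto
  also have "\<dots> = 2 * (\<integral>z. (norm (snd z))\<^sup>2 \<partial>\<pi>) + 2 * ?I \<pi>" using iy id by simp
  also have "(\<integral>z. (norm (snd z))\<^sup>2 \<partial>\<pi>) = sm (law Y)"
    unfolding sm_def s(3)[symmetric] using mf by (subst integral_distr) auto
  finally show ?thesis using \<pi>(2) by simp
qed

text \<open>The mixture is realised as the result of drawing from \<open>\<mu>\<close> or \<open>\<nu>\<close> after a biased coin toss.\<close>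

lemma mix_P2:
  assumes \<mu>: "\<mu> \<in> P2" and \<nu>: "\<nu> \<in> P2" and \<theta>: "0 \<le> \<theta>" "\<theta> \<le> 1"
  shows "mix \<theta> \<mu> \<nu> \<in> P2" "sm (mix \<theta> \<mu> \<nu>) \<le> sm \<mu> + sm \<nu>"
proof -
  let ?k = "\<lambda>b. if b then \<mu> else \<nu>"
  have pk: "prob_space (?k b)" for b using P2D(2) \<mu> \<nu> by auto
  have sk: "sets (?k b) = sets borel" for b using P2D(1) \<mu> \<nu> by auto
  have k: "?k \<in> measurable (measure_pmf (bernoulli_pmf \<theta>)) (subprob_algebra borel)"
    using sk pk by (auto intro!: prob_space_imp_subprob_space simp: space_subprob_algebra)
  define M where "M = measure_pmf (bernoulli_pmf \<theta>) \<bind> ?k"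
  have nn: "(\<integral>\<^sup>+x. f x \<partial>M) = ennreal \<theta> * (\<integral>\<^sup>+x. f x \<partial>\<mu>) + ennreal (1 - \<theta>) * (\<integral>\<^sup>+x. f x \<partial>\<nu>)"
    if "f \<in> borel_measurable borel" for f
    unfolding M_def using \<theta> by (subst nn_integral_bind[OF that k]) (simp add: mult.commute)
  have em: "emeasure M A = ennreal \<theta> * emeasure \<mu> A + ennreal (1 - \<theta>) * emeasure \<nu> A" if "A \<in> sets borel" for A
    unfolding M_def using \<theta> that by (subst emeasure_bind[OF _ k]) (auto simp: mult.commute)
  have setsM: "sets M = sets borel" unfolding M_def by (rule sets_bind[OF sk]) auto
  then have spM: "space M = UNIV" using sets_eq_imp_space_eq[OF setsM] by simp
  have "mix \<theta> \<mu> \<nu> = measure_of UNIV (sets borel) (emeasure M)"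
    unfolding mix_def using sets.sigma_sets_eq[of "borel :: 'a measure"]
    by (intro measure_of_eq) (auto simp: em)
  also have "\<dots> = M" using measure_of_of_measure[of M] setsM spM by simp
  finally have mixM: "mix \<theta> \<mu> \<nu> = M" .
  have pM: "prob_space M"
  proof (rule prob_spaceI)
    have "emeasure \<mu> UNIV = 1" "emeasure \<nu> UNIV = 1"
      using prob_space.emeasure_space_1[OF P2D(2)] P2D(4) \<mu> \<nu> by metis+
    then show "emeasure M (space M) = 1" unfolding spM using \<theta> em[of UNIV] by (simp flip: ennreal_plus)
  qed
  have n: "(\<integral>\<^sup>+x. ennreal ((norm x)\<^sup>2) \<partial>\<mu>) = ennreal (sm \<mu>)" "(\<integral>\<^sup>+x. ennreal ((norm x)\<^sup>2) \<partial>\<nu>) = ennreal (sm \<nu>)"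
    unfolding sm_def using P2D(3) \<mu> \<nu> by (auto intro!: nn_integral_eq_integral)
  have e: "(\<integral>\<^sup>+x. ennreal ((norm x)\<^sup>2) \<partial>M) = ennreal (\<theta> * sm \<mu> + (1 - \<theta>) * sm \<nu>)"
    using \<theta> by (subst nn) (simp_all add: n ennreal_mult ennreal_plus)
  have mM: "(\<lambda>x. (norm x)\<^sup>2) \<in> borel_measurable M"
    unfolding measurable_cong_sets[OF setsM refl] by measurable
  have iM: "integrable M (\<lambda>x. (norm x)\<^sup>2)"
    using mM e by (intro integrableI_bounded) auto
  show "mix \<theta> \<mu> \<nu> \<in> P2" unfolding P2_def mixM using setsM pM iM by simp
  have "ennreal (sm M) = ennreal (\<theta> * sm \<mu> + (1 - \<theta>) * sm \<nu>)"
    unfolding e[symmetric] sm_def[of M] by (rule nn_integral_eq_integral[OF iM, symmetric]) simp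
  then have "sm M = \<theta> * sm \<mu> + (1 - \<theta>) * sm \<nu>"
    using \<theta> by (subst (asm) ennreal_inj) auto
  also have "\<dots> \<le> sm \<mu> + sm \<nu>" using \<theta> by (intro add_mono mult_left_le_one_le) auto
  finally show "sm (mix \<theta> \<mu> \<nu>) \<le> sm \<mu> + sm \<nu>" by (simp add: mixM)
qed

text \<open>Integrability is not needed, since the integral of a function that is not integrable is zero.\<close>

lemma integral_01_bound:
  fixes f :: "real \<Rightarrow> real"
  assumes "\<And>s. s \<in> {0..1} \<Longrightarrow> \<bar>f s\<bar> \<le> B" "0 \<le> B" shows "\<bar>integral {0..1} f\<bar> \<le> B"
proof (cases "f integrable_on {0..1}")
  case True
  then show ?thesis
    using has_integral_bound_real[OF assms(2) finite.emptyI integrable_integral[OF True]] assms(1) by auto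
qed (use assms in \<open>simp add: not_integrable_integral\<close>)

lemma l2norm_power2: "(l2norm X)\<^sup>2 = (\<integral>\<omega>. (norm (X \<omega>))\<^sup>2 \<partial>Omega)"
  unfolding l2norm_def by simp

lemma l2norm_nonneg [simp]: "0 \<le> l2norm X" by (simp add: l2norm_def)

lemma sm_law: "X \<in> borel_measurable Omega \<Longrightarrow> sm (law X) = (l2norm X)\<^sup>2"
  unfolding sm_def l2norm_power2 by (subst integral_distr) auto

lemma sq_integrable_norm:
  assumes "sq_integrable (X :: real \<Rightarrow> 'b::euclidean_space)"
  shows "integrable Omega (\<lambda>\<omega>. norm (X \<omega>))" "(\<integral>\<omega>. norm (X \<omega>) \<partial>Omega) \<le> l2norm X"
proof -
  have m: "X \<in> borel_measurable Omega" "integrable Omega (\<lambda>\<omega>. (norm (X \<omega>))\<^sup>2)"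
    using assms by (auto simp: sq_integrable_def)
  show i: "integrable Omega (\<lambda>\<omega>. norm (X \<omega>))"
    by (rule Om.square_integrable_imp_integrable) (use m in auto)
  have "0 \<le> Om.variance (\<lambda>\<omega>. norm (X \<omega>))" by (rule Om.variance_positive)
  then have "(\<integral>\<omega>. norm (X \<omega>) \<partial>Omega)\<^sup>2 \<le> (l2norm X)\<^sup>2"
    unfolding l2norm_power2 using Om.variance_eq[OF i m(2)] by simp
  then show "(\<integral>\<omega>. norm (X \<omega>) \<partial>Omega) \<le> l2norm X" by (rule power2_le_imp_le) simp
qed

lemma sq_integrable_add:
  assumes "sq_integrable (X :: real \<Rightarrow> 'b::euclidean_space)" "sq_integrable Y"
  shows "sq_integrable (\<lambda>\<omega>. X \<omega> + Y \<omega>)"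
proof -
  have m: "X \<in> borel_measurable Omega" "integrable Omega (\<lambda>\<omega>. (norm (X \<omega>))\<^sup>2)"
     "Y \<in> borel_measurable Omega" "integrable Omega (\<lambda>\<omega>. (norm (Y \<omega>))\<^sup>2)"
    using assms by (auto simp: sq_integrable_def)
  have "integrable Omega (\<lambda>\<omega>. (norm (X \<omega> + Y \<omega>))\<^sup>2)"
  proof (rule Bochner_Integration.integrable_bound)
    show "integrable Omega (\<lambda>\<omega>. 2 * (norm (X \<omega>))\<^sup>2 + 2 * (norm (Y \<omega>))\<^sup>2)" using m by auto
    show "AE \<omega> in Omega. norm ((norm (X \<omega> + Y \<omega>))\<^sup>2) \<le> norm (2 * (norm (X \<omega>))\<^sup>2 + 2 * (norm (Y \<omega>))\<^sup>2)"
      using norm_sq_le[of "X \<omega>" "Y \<omega>" for \<omega>] by (intro AE_I2) auto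
  qed (use m in measurable)
  then show ?thesis unfolding sq_integrable_def using m by auto
qed

section \<open>Regularly differentiable functions are L-differentiable\<close>

lemma integrable_P2:
  fixes F :: "'x::euclidean_space \<Rightarrow> real"
  assumes "\<mu> \<in> P2" "F \<in> borel_measurable borel" "\<And>x. \<bar>F x\<bar> \<le> c * (1 + (norm x)\<^sup>2)"
  shows "integrable \<mu> F"
proof (rule Bochner_Integration.integrable_bound)
  interpret prob_space \<mu> by (rule P2D(2)[OF assms(1)])
  show "integrable \<mu> (\<lambda>x. c * (1 + (norm x)\<^sup>2))" using P2D(3)[OF assms(1)] by auto
  show "F \<in> borel_measurable \<mu>" using assms(2) measurable_cong_sets[OF P2D(1)[OF assms(1)] refl] by auto
  show "AE x in \<mu>. norm (F x) \<le> norm (c * (1 + (norm x)\<^sup>2))"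
    using assms(3) by (intro AE_I2) (metis abs_of_nonneg abs_ge_self order_trans real_norm_def)
qed

lemma int_diff_law:
  fixes F :: "'x::euclidean_space \<Rightarrow> real"
  assumes X: "sq_integrable X" and Y: "sq_integrable Y" and F: "F \<in> borel_measurable borel"
    and c: "\<And>x. \<bar>F x\<bar> \<le> c * (1 + (norm x)\<^sup>2)"
  shows "int_diff (law (\<lambda>\<omega>. X \<omega> + Y \<omega>)) (law X) F = (\<integral>\<omega>. F (X \<omega> + Y \<omega>) - F (X \<omega>) \<partial>Omega)"
    and "integrable Omega (\<lambda>\<omega>. F (X \<omega> + Y \<omega>) - F (X \<omega>))"
proof -
  have m: "X \<in> borel_measurable Omega" "(\<lambda>\<omega>. X \<omega> + Y \<omega>) \<in> borel_measurable Omega"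
    using X sq_integrable_add[OF X Y] by (auto simp: sq_integrable_def)
  have i: "integrable (law X) F" "integrable (law (\<lambda>\<omega>. X \<omega> + Y \<omega>)) F"
    using integrable_P2[OF law_P2 F c] X sq_integrable_add[OF X Y] by auto
  have i': "integrable Omega (\<lambda>\<omega>. F (X \<omega>))" "integrable Omega (\<lambda>\<omega>. F (X \<omega> + Y \<omega>))"
    using i m F by (auto simp: integrable_distr_eq)
  show "int_diff (law (\<lambda>\<omega>. X \<omega> + Y \<omega>)) (law X) F = (\<integral>\<omega>. F (X \<omega> + Y \<omega>) - F (X \<omega>) \<partial>Omega)"
    unfolding int_diff_def using m F i' by (simp add: integral_distr)
  show "integrable Omega (\<lambda>\<omega>. F (X \<omega> + Y \<omega>) - F (X \<omega>))" using i' by auto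
qed

lemma int_diff_lipschitz:
  fixes F :: "'x::euclidean_space \<Rightarrow> real"
  assumes X: "sq_integrable X" and Y: "sq_integrable Y" and B: "0 \<le> B"
    and F: "F \<in> borel_measurable borel" and c: "\<And>x. \<bar>F x\<bar> \<le> c * (1 + (norm x)\<^sup>2)"
    and lip: "\<And>x y. \<bar>F (x + y) - F x\<bar> \<le> B * norm y"
  shows "\<bar>int_diff (law (\<lambda>\<omega>. X \<omega> + Y \<omega>)) (law X) F\<bar> \<le> B * l2norm Y"
proof -
  note n = sq_integrable_norm[OF Y]
  have "\<bar>int_diff (law (\<lambda>\<omega>. X \<omega> + Y \<omega>)) (law X) F\<bar> \<le> (\<integral>\<omega>. \<bar>F (X \<omega> + Y \<omega>) - F (X \<omega>)\<bar> \<partial>Omega)"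
    unfolding int_diff_law(1)[OF X Y F c] by (rule integral_abs_bound)
  also have "\<dots> \<le> (\<integral>\<omega>. B * norm (Y \<omega>) \<partial>Omega)"
    using int_diff_law(2)[OF X Y F c] n lip by (intro integral_mono) auto
  also have "\<dots> \<le> B * l2norm Y" using n B by (simp add: mult_left_mono)
  finally show ?thesis .
qed

lemma l2norm_add_power2:
  assumes X: "sq_integrable (X :: real \<Rightarrow> 'b::euclidean_space)" and Y: "sq_integrable Y"
  shows "(l2norm (\<lambda>\<omega>. X \<omega> + Y \<omega>))\<^sup>2 \<le> 2 * (l2norm X)\<^sup>2 + 2 * (l2norm Y)\<^sup>2"
proof -
  have i: "integrable Omega (\<lambda>\<omega>. (norm (X \<omega>))\<^sup>2)" "integrable Omega (\<lambda>\<omega>. (norm (Y \<omega>))\<^sup>2)"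
     "integrable Omega (\<lambda>\<omega>. (norm (X \<omega> + Y \<omega>))\<^sup>2)"
    using X Y sq_integrable_add[OF X Y] by (auto simp: sq_integrable_def)
  have "(\<integral>\<omega>. (norm (X \<omega> + Y \<omega>))\<^sup>2 \<partial>Omega) \<le> (\<integral>\<omega>. 2 * (norm (X \<omega>))\<^sup>2 + 2 * (norm (Y \<omega>))\<^sup>2 \<partial>Omega)"
    using i norm_sq_le by (intro integral_mono) auto
  then show ?thesis unfolding l2norm_power2 using i by simp
qed

lemma l2norm_scale: "l2norm (\<lambda>\<omega>. c *\<^sub>R X \<omega>) = \<bar>c\<bar> * l2norm X"
  unfolding l2norm_def by (simp add: power_mult_distrib real_sqrt_mult)

lemma int_diff_diff:
  fixes F G :: "'x::euclidean_space \<Rightarrow> real"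
  assumes "integrable \<nu> F" "integrable \<nu> G" "integrable \<mu> F" "integrable \<mu> G"
  shows "int_diff \<nu> \<mu> (\<lambda>x. F x - G x) = int_diff \<nu> \<mu> F - int_diff \<nu> \<mu> G"
  using assms by (simp add: int_diff_def)

text \<open>A kernel with bounded mixed differences, integrated twice against the difference of two laws, is
  quadratic in the distance of the representatives.\<close>

lemma bilinear_remainder:
  fixes K :: "'x::euclidean_space \<Rightarrow> 'x \<Rightarrow> real"
  assumes X: "sq_integrable X" and Y: "sq_integrable Y" and B: "0 \<le> B"
    and cont: "continuous_on UNIV (\<lambda>(x, y). K x y)"
    and c: "\<And>x y. \<bar>K x y\<bar> \<le> c * (1 + (norm x)\<^sup>2 + (norm y)\<^sup>2)"
    and mixed: "\<And>x1 x0 y1 y0. \<bar>K x1 y1 - K x0 y1 - (K x1 y0 - K x0 y0)\<bar> \<le> B * norm (x1 - x0) * norm (y1 - y0)"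
  defines "\<nu> \<equiv> law (\<lambda>\<omega>. X \<omega> + Y \<omega>)" and "\<mu> \<equiv> law X"
  shows "\<bar>int_diff \<nu> \<mu> (\<lambda>y. int_diff \<nu> \<mu> (\<lambda>x. K x y))\<bar> \<le> B * (l2norm Y)\<^sup>2"
proof -
  have c0: "0 \<le> c" using c[of 0 0] by (simp add: order_trans[OF abs_ge_zero])
  have m: "(\<lambda>x. K x y) \<in> borel_measurable borel" for y
  proof (rule borel_measurable_continuous_onI)
    have "continuous_on UNIV (\<lambda>x::'x. (x, y))" by (intro continuous_intros)
    from continuous_on_compose2[OF cont this] show "continuous_on UNIV (\<lambda>x. K x y)" by simp
  qed
  have b: "\<bar>K x y\<bar> \<le> c * (1 + (norm y)\<^sup>2) * (1 + (norm x)\<^sup>2)" for x y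
  proof -
    have "c * (1 + (norm x)\<^sup>2 + (norm y)\<^sup>2) \<le> c * ((1 + (norm y)\<^sup>2) * (1 + (norm x)\<^sup>2))"
      using c0 by (intro mult_left_mono) (auto simp: algebra_simps)
    then show ?thesis using c[of x y] by (simp add: mult.assoc)
  qed
  have P: "\<nu> \<in> P2" "\<mu> \<in> P2" unfolding \<nu>_def \<mu>_def using X Y sq_integrable_add[OF X Y] by (auto intro: law_P2)
  have i: "integrable \<nu> (\<lambda>x. K x y)" "integrable \<mu> (\<lambda>x. K x y)" for y
    using P by (auto intro: integrable_P2[OF _ m b])
  define I where "I y = int_diff \<nu> \<mu> (\<lambda>x. K x y)" for y
  have lip: "\<bar>I (y + \<eta>) - I y\<bar> \<le> (B * l2norm Y) * norm \<eta>" for y \<eta>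
  proof -
    have "I (y + \<eta>) - I y = int_diff \<nu> \<mu> (\<lambda>x. K x (y + \<eta>) - K x y)"
      unfolding I_def by (rule int_diff_diff[symmetric]) (rule i)+
    also have "\<bar>\<dots>\<bar> \<le> (B * norm \<eta>) * l2norm Y"
      unfolding \<nu>_def \<mu>_def
    proof (rule int_diff_lipschitz[OF X Y])
      show "(\<lambda>x. K x (y + \<eta>) - K x y) \<in> borel_measurable borel" using m by measurable
      show "\<bar>K x (y + \<eta>) - K x y\<bar> \<le> (c * (1 + (norm (y + \<eta>))\<^sup>2) + c * (1 + (norm y)\<^sup>2)) * (1 + (norm x)\<^sup>2)" for x
        using b[of x "y + \<eta>"] b[of x y] abs_triangle_ineq4[of "K x (y + \<eta>)" "K x y"]
        unfolding distrib_right by linarith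
      show "\<bar>K (x + \<xi>) (y + \<eta>) - K (x + \<xi>) y - (K x (y + \<eta>) - K x y)\<bar> \<le> B * norm \<eta> * norm \<xi>" for x \<xi>
      proof -
        have "K (x + \<xi>) (y + \<eta>) - K (x + \<xi>) y - (K x (y + \<eta>) - K x y) =
            K (x + \<xi>) (y + \<eta>) - K x (y + \<eta>) - (K (x + \<xi>) y - K x y)" by simp
        then show ?thesis using mixed[of "x + \<xi>" "y + \<eta>" x y] by (simp add: mult_ac)
      qed
    qed (use B in auto)
    finally show ?thesis by (simp add: mult_ac)
  qed
  have "continuous_on UNIV I"
  proof (rule continuous_on_iff[THEN iffD2], intro ballI allI impI)
    fix y and e :: real assume e: "0 < e"
    define L where "L = B * l2norm Y + 1"
    have L: "0 < L" using B by (simp add: L_def add_nonneg_pos)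
    have "dist (I y') (I y) < e" if "dist y' y < e / L" for y'
    proof -
      have "dist (I y') (I y) \<le> (B * l2norm Y) * norm (y' - y)"
        using lip[of y "y' - y"] by (simp add: dist_real_def)
      also have "\<dots> \<le> L * norm (y' - y)" by (intro mult_right_mono) (auto simp: L_def)
      also have "\<dots> < e" using that L by (simp add: dist_norm field_simps)
      finally show ?thesis .
    qed
    then show "\<exists>d>0. \<forall>x'\<in>UNIV. dist x' y < d \<longrightarrow> dist (I x') (I y) < e"
      using e L by (intro exI[of _ "e / L"]) auto
  qed
  then have Im: "I \<in> borel_measurable borel" by (rule borel_measurable_continuous_onI)
  have grow: "\<bar>I y\<bar> \<le> (\<bar>I 0\<bar> + B * l2norm Y) * (1 + (norm y)\<^sup>2)" for y
  proof -
    have "norm y \<le> 1 + (norm y)\<^sup>2" using sum_squares_bound[of 1 "norm y"] norm_ge_zero[of y] by (simp del: norm_ge_zero)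
    then have "(B * l2norm Y) * norm y \<le> (B * l2norm Y) * (1 + (norm y)\<^sup>2)"
      using B by (intro mult_left_mono) auto
    moreover have "\<bar>I y\<bar> \<le> \<bar>I 0\<bar> + (B * l2norm Y) * norm y" using lip[of 0 y] by simp
    moreover have "\<bar>I 0\<bar> \<le> \<bar>I 0\<bar> * (1 + (norm y)\<^sup>2)" by (simp add: algebra_simps)
    ultimately show ?thesis unfolding distrib_right by linarith
  qed
  have "\<bar>int_diff \<nu> \<mu> I\<bar> \<le> (B * l2norm Y) * l2norm Y"
    unfolding \<nu>_def \<mu>_def by (rule int_diff_lipschitz[OF X Y _ Im grow lip]) (use B in simp)
  then show ?thesis unfolding I_def by (simp add: power2_eq_square mult_ac)
qed

text \<open>Every law in \<open>P2\<close> is carried by the unit interval. This is a fact about Borel spaces; below it is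
  read off from the L-differentiability of a solution at every law.\<close>

definition every_law :: "'x::euclidean_space itself \<Rightarrow> bool" where
  "every_law _ \<longleftrightarrow> (\<forall>m\<in>(P2 :: 'x measure set). \<exists>X. sq_integrable X \<and> law X = m)"

lemma every_lawE:
  fixes m :: "'x::euclidean_space measure"
  assumes "every_law TYPE('x)" "m \<in> P2"
  obtains X where "sq_integrable X" "law X = m"
  using assms unfolding every_law_def by auto

text \<open>Taylor expansion of the lift with a quadratic remainder. The first-order term of the expansion in
  linear functional derivatives is expanded in space, the second-order term is a bilinear
  remainder. The constant \<open>C1\<close> refers to the law of \<open>X\<close> only.\<close>

lemma regular2_expansion:
  fixes h :: "'x::euclidean_space measure \<Rightarrow> 'b::real_normed_vector" and \<phi> :: "'b \<Rightarrow>\<^sub>L real"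
  assumes R: "regular2 h H" and rep: "every_law TYPE('x)"
    and X: "sq_integrable X" and Y: "sq_integrable Y"
    and C1: "\<And>y. norm (fd (fd (lfd h (law X))) y) \<le> C1"
    and C2: "\<And>\<theta> x y. 0 \<le> \<theta> \<Longrightarrow> \<theta> \<le> 1 \<Longrightarrow>
      norm (mixed_deriv (H (mix \<theta> (law (\<lambda>\<omega>. X \<omega> + Y \<omega>)) (law X))) x y) \<le> C2"
  shows "\<bar>\<phi> (h (law (\<lambda>\<omega>. X \<omega> + Y \<omega>))) - \<phi> (h (law X)) - (\<integral>\<omega>. \<phi> (fd (lfd h (law X)) (X \<omega>) (Y \<omega>)) \<partial>Omega)\<bar>
    \<le> norm \<phi> * (C1 + C2) * (l2norm Y)\<^sup>2"
proof -
  define \<nu> \<mu> where "\<nu> = law (\<lambda>\<omega>. X \<omega> + Y \<omega>)" and "\<mu> = law X"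
  define L where "L = lfd h \<mu>"
  have P: "\<nu> \<in> P2" "\<mu> \<in> P2" unfolding \<nu>_def \<mu>_def using X Y sq_integrable_add[OF X Y] by (auto intro: law_P2)
  have Xm: "X \<in> borel_measurable Omega" "Y \<in> borel_measurable Omega"
    using X Y by (auto simp: sq_integrable_def)
  have C0: "0 \<le> C1" "0 \<le> C2"
    using C1[of 0] C2[of 0] by (auto intro: order_trans[OF norm_ge_zero])
  have Ldiff: "L differentiable (at x)" "fd L differentiable (at x)" for x
    using R P unfolding regular2_def L_def by auto
  have lf: "has_lfd_real (\<lambda>\<mu>. \<phi> (h \<mu>)) (\<lambda>\<mu> x. \<phi> (lfd h \<mu> x))"
    and lf2: "has_lfd2_real (\<lambda>\<mu>. \<phi> (h \<mu>)) (\<lambda>\<mu> x. \<phi> (lfd h \<mu> x)) (\<lambda>\<mu> x y. \<phi> (H \<mu> x y))"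
    using R unfolding regular2_def has_lfd_def has_lfd2_def by auto
  have Hd: "H m x differentiable (at y)" "(\<lambda>x'. fd (H m x') y) differentiable (at x)" if "m \<in> P2" for m x y
    using R that unfolding regular2_def by auto
  obtain c where c: "\<And>x. \<bar>\<phi> (L x)\<bar> \<le> c * (1 + (norm x)\<^sup>2)"
    using lf P unfolding has_lfd_real_def L_def by blast
  have "continuous_on UNIV L"
    using Ldiff(1) differentiable_imp_continuous_on[of L UNIV] by (simp add: differentiable_on_def)
  then have Lm: "(\<lambda>x. \<phi> (L x)) \<in> borel_measurable borel"
    by (intro borel_measurable_continuous_onI continuous_intros)
  have Dc: "continuous_on UNIV (fd L)"
    using Ldiff(2) differentiable_imp_continuous_on[of "fd L" UNIV] by (simp add: differentiable_on_def)
  have DXm: "(\<lambda>\<omega>. \<phi> (fd L (X \<omega>) (Y \<omega>))) \<in> borel_measurable Omega"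
  proof (rule borel_measurable_continuous_Pair[OF Xm])
    have "continuous_on UNIV (\<lambda>x::'x \<times> 'x. fd L (fst x))"
      by (rule continuous_on_compose2[OF Dc]) (auto intro: continuous_intros)
    then show "continuous_on UNIV (\<lambda>x::'x \<times> 'x. \<phi> (fd L (fst x) (snd x)))" by (intro continuous_intros)
  qed
  define r where "r \<omega> = (\<phi> (L (X \<omega> + Y \<omega>)) - \<phi> (L (X \<omega>))) - \<phi> (fd L (X \<omega>) (Y \<omega>))" for \<omega>
  have rb: "\<bar>r \<omega>\<bar> \<le> norm \<phi> * C1 * (norm (Y \<omega>))\<^sup>2" for \<omega>
  proof -
    have "r \<omega> = \<phi> (L (X \<omega> + Y \<omega>) - L (X \<omega>) - fd L (X \<omega>) (Y \<omega>))"
      by (simp add: r_def blinfun.diff_right)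
    also have "\<bar>\<dots>\<bar> \<le> norm \<phi> * norm (L (X \<omega> + Y \<omega>) - L (X \<omega>) - fd L (X \<omega>) (Y \<omega>))"
      using norm_blinfun[of \<phi>] by simp
    also have "\<dots> \<le> norm \<phi> * (C1 * (norm (Y \<omega>))\<^sup>2)"
      using fd_taylor[of L C1, OF Ldiff] C1 by (intro mult_left_mono) (auto simp: L_def \<mu>_def)
    finally show ?thesis by (simp add: mult.assoc)
  qed
  note id = int_diff_law[OF X Y Lm c]
  have Yi: "integrable Omega (\<lambda>\<omega>. (norm (Y \<omega>))\<^sup>2)" using Y by (simp add: sq_integrable_def)
  have ri: "integrable Omega r"
  proof (rule Bochner_Integration.integrable_bound)
    show "integrable Omega (\<lambda>\<omega>. norm \<phi> * C1 * (norm (Y \<omega>))\<^sup>2)" using Yi by simp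
    show "r \<in> borel_measurable Omega"
      unfolding r_def[abs_def] using borel_measurable_integrable[OF id(2)] DXm by measurable
    show "AE \<omega> in Omega. norm (r \<omega>) \<le> norm (norm \<phi> * C1 * (norm (Y \<omega>))\<^sup>2)"
      using rb C0 by (intro AE_I2) auto
  qed
  have Di: "integrable Omega (\<lambda>\<omega>. \<phi> (fd L (X \<omega>) (Y \<omega>)))"
    using Bochner_Integration.integrable_diff[OF id(2) ri] by (simp add: r_def)
  have "int_diff \<nu> \<mu> (\<lambda>x. \<phi> (L x)) - (\<integral>\<omega>. \<phi> (fd L (X \<omega>) (Y \<omega>)) \<partial>Omega) = (\<integral>\<omega>. r \<omega> \<partial>Omega)"
    unfolding \<nu>_def \<mu>_def id(1) r_def using id(2) Di by simp
  also have "\<bar>\<dots>\<bar> \<le> (\<integral>\<omega>. norm \<phi> * C1 * (norm (Y \<omega>))\<^sup>2 \<partial>Omega)"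
    using ri Yi rb by (intro order_trans[OF integral_abs_bound] integral_mono) auto
  finally have first: "\<bar>int_diff \<nu> \<mu> (\<lambda>x. \<phi> (L x)) - (\<integral>\<omega>. \<phi> (fd L (X \<omega>) (Y \<omega>)) \<partial>Omega)\<bar> \<le> norm \<phi> * C1 * (l2norm Y)\<^sup>2"
    by (simp add: l2norm_power2)
  have second: "\<bar>integral {0..1} (\<lambda>\<theta>. integral {0..1} (\<lambda>s.
            \<theta> * int_diff \<nu> \<mu> (\<lambda>y. int_diff \<nu> \<mu> (\<lambda>x. \<phi> (H (mix (s * \<theta>) \<nu> \<mu>) x y)))))\<bar>
      \<le> norm \<phi> * C2 * (l2norm Y)\<^sup>2"
  proof (intro integral_01_bound)
    fix \<theta> s :: real assume \<theta>: "\<theta> \<in> {0..1}" and s: "s \<in> {0..1}"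
    define m where "m = mix (s * \<theta>) \<nu> \<mu>"
    have s\<theta>: "0 \<le> s * \<theta>" "s * \<theta> \<le> 1" using \<theta> s by (auto intro: mult_le_one)
    have mP: "m \<in> P2" unfolding m_def by (rule mix_P2[OF P s\<theta>])
    obtain Xm where Xm: "sq_integrable Xm" "law Xm = m" by (rule every_lawE[OF rep mP])
    have "\<bar>int_diff \<nu> \<mu> (\<lambda>y. int_diff \<nu> \<mu> (\<lambda>x. \<phi> (H m x y)))\<bar> \<le> (norm \<phi> * C2) * (l2norm Y)\<^sup>2"
    proof -
      obtain c' where c': "\<And>x y. \<bar>\<phi> (H m x y)\<bar> \<le> c' * (1 + (norm x)\<^sup>2 + (norm y)\<^sup>2)"
        using lf2 mP unfolding has_lfd2_real_def by blast
      have "jcont UNIV (\<lambda>p m. case p of (x, y) \<Rightarrow> \<phi> (H m x y))"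
        using lf2 unfolding has_lfd2_real_def by (simp add: case_prod_unfold)
      from jcont_imp_continuous[of "\<lambda>m p. case p of (x, y) \<Rightarrow> \<phi> (H m x y)", OF this Xm(1)]
      have cont: "continuous_on UNIV (\<lambda>(x, y). \<phi> (H m x y))" unfolding Xm(2) .
      have mixed: "\<bar>\<phi> (H m x1 y1) - \<phi> (H m x0 y1) - (\<phi> (H m x1 y0) - \<phi> (H m x0 y0))\<bar>
          \<le> norm \<phi> * C2 * norm (x1 - x0) * norm (y1 - y0)" for x1 y1 x0 y0
      proof -
        have "\<bar>\<phi> (H m x1 y1 - H m x0 y1 - (H m x1 y0 - H m x0 y0))\<bar>
            \<le> norm \<phi> * norm (H m x1 y1 - H m x0 y1 - (H m x1 y0 - H m x0 y0))"
          using norm_blinfun[of \<phi>] by (metis real_norm_def)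
        also have "\<dots> \<le> norm \<phi> * (C2 * norm (x1 - x0) * norm (y1 - y0))"
        proof (intro mult_left_mono mixed_difference Hd mP)
          show "norm (fd (\<lambda>x'. fd (H m x') y) x) \<le> C2" for x y
            using C2[OF s\<theta>, of x y] by (simp add: mixed_deriv_def m_def \<nu>_def \<mu>_def)
        qed auto
        finally show ?thesis by (simp add: blinfun.diff_right mult.assoc)
      qed
      show ?thesis unfolding \<nu>_def \<mu>_def
        by (rule bilinear_remainder[OF X Y _ cont c' mixed]) (use C0 in simp)
    qed
    moreover have "\<bar>\<theta> * int_diff \<nu> \<mu> (\<lambda>y. int_diff \<nu> \<mu> (\<lambda>x. \<phi> (H m x y)))\<bar>
        \<le> 1 * \<bar>int_diff \<nu> \<mu> (\<lambda>y. int_diff \<nu> \<mu> (\<lambda>x. \<phi> (H m x y)))\<bar>"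
      unfolding abs_mult using \<theta> by (intro mult_right_mono) auto
    ultimately show "\<bar>\<theta> * int_diff \<nu> \<mu> (\<lambda>y. int_diff \<nu> \<mu> (\<lambda>x. \<phi> (H (mix (s * \<theta>) \<nu> \<mu>) x y)))\<bar>
        \<le> norm \<phi> * C2 * (l2norm Y)\<^sup>2"
      unfolding m_def by simp
  qed (use C0 in auto)
  have "\<phi> (h \<nu>) - \<phi> (h \<mu>) = int_diff \<nu> \<mu> (\<lambda>x. \<phi> (L x)) +
      integral {0..1} (\<lambda>\<theta>. integral {0..1} (\<lambda>s.
            \<theta> * int_diff \<nu> \<mu> (\<lambda>y. int_diff \<nu> \<mu> (\<lambda>x. \<phi> (H (mix (s * \<theta>) \<nu> \<mu>) x y)))))"
    using lf2 P unfolding has_lfd2_real_def L_def by blast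
  then show ?thesis
    using first second unfolding \<nu>_def \<mu>_def L_def by (simp add: algebra_simps)
qed

text \<open>Difference quotients in space of \<open>lfd h\<close> are jointly continuous, and they approximate the derivative
  uniformly, because the second spatial derivative is bounded for laws near \<open>\<mu>\<close>.\<close>

lemma regular2_deriv_jcont:
  fixes h :: "'x::euclidean_space measure \<Rightarrow> 'b::euclidean_space"
  assumes R: "regular2 h H" and rep: "every_law TYPE('x)"
  shows "jcont UNIV (\<lambda>x \<mu>. fd (lfd h \<mu>) x)"
  unfolding jcont_tendsto
proof (intro ballI tendsto_componentwise1)
  fix x :: 'x and \<mu> :: "'x measure" and e :: 'x assume \<mu>: "\<mu> \<in> P2" and e: "e \<in> Basis"
  obtain c where c: "bounded_on_bounded c" "\<And>\<mu> x. \<mu> \<in> P2 \<Longrightarrow> norm (fd (fd (lfd h \<mu>)) x) \<le> c \<mu>"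
    using R unfolding regular2_def by blast
  have Ld: "lfd h \<nu> differentiable (at y)" "fd (lfd h \<nu>) differentiable (at y)" if "\<nu> \<in> P2" for \<nu> y
    using R that unfolding regular2_def by auto
  obtain C where C: "\<And>\<nu>. \<nu> \<in> P2 \<Longrightarrow> mnorm 2 \<nu> \<le> sqrt (2 * sm \<mu> + 2) \<Longrightarrow> c \<nu> \<le> C"
    using c(1) unfolding bounded_on_bounded_def by blast
  have near: "c \<nu> \<le> C" if \<nu>: "\<nu> \<in> P2" "wasserstein 2 \<nu> \<mu> < 1" for \<nu>
  proof -
    obtain X where XY: "sq_integrable X" "law X = \<nu>" by (rule every_lawE[OF rep \<nu>(1)])
    obtain Y where Y: "sq_integrable Y" "law Y = \<mu>" by (rule every_lawE[OF rep \<mu>])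
    have "sm \<nu> \<le> 2 * sm \<mu> + 2 * 1\<^sup>2"
      using wasserstein_moment[OF XY(1) Y(1), of 1] that XY Y by simp
    then show ?thesis using C[OF that(1)] by (simp add: mnorm_2)
  qed
  obtain X where X: "sq_integrable X" "law X = \<mu>" by (rule every_lawE[OF rep \<mu>])
  have "wasserstein 2 \<mu> \<mu> < 1"
    using wasserstein_self[of X] X by (simp add: sq_integrable_def)
  then have C0: "0 \<le> C" using near[OF \<mu>] c(2)[OF \<mu>, of 0] norm_ge_zero[of "fd (fd (lfd h \<mu>)) 0"] by linarith
  have jc: "jcont UNIV (\<lambda>x \<mu>. lfd h \<mu> x)"
  proof (rule jcont_inner_components)
    fix b :: 'b
    have "jcont UNIV (\<lambda>x \<mu>. blinfun_inner_left b (lfd h \<mu> x))"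
      using R unfolding regular2_def has_lfd_def has_lfd_real_def by blast
    then show "jcont UNIV (\<lambda>x \<mu>. lfd h \<mu> x \<bullet> b)" by (simp add: inner_commute)
  qed
  show "((\<lambda>z. fd (lfd h (snd z)) (fst z) e) \<longlongrightarrow> fd (lfd h \<mu>) x e) (jnhds UNIV x \<mu>)"
  proof (rule tendstoI)
    fix \<epsilon> :: real assume \<epsilon>: "0 < \<epsilon>"
    define s where "s = \<epsilon> / (4 * (C + 1))"
    have s: "0 < s" using \<epsilon> C0 by (simp add: s_def)
    have sC: "2 * C * s < \<epsilon> / 2"
    proof -
      have "2 * C * s < 2 * (C + 1) * s" using s by simp
      also have "\<dots> = \<epsilon> / 2" using C0 by (simp add: s_def field_simps)
      finally show ?thesis by simp
    qed
    have t1: "((\<lambda>z. lfd h (snd z) (fst z + s *\<^sub>R e)) \<longlongrightarrow> lfd h \<mu> (x + s *\<^sub>R e)) (jnhds UNIV x \<mu>)"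
      using jcont_shift[OF jc, of "s *\<^sub>R e"] \<mu> unfolding jcont_tendsto by auto
    have t2: "((\<lambda>z. lfd h (snd z) (fst z)) \<longlongrightarrow> lfd h \<mu> x) (jnhds UNIV x \<mu>)"
      using jc \<mu> unfolding jcont_tendsto by auto
    have ev1: "\<forall>\<^sub>F z in jnhds UNIV x \<mu>. dist (lfd h (snd z) (fst z + s *\<^sub>R e)) (lfd h \<mu> (x + s *\<^sub>R e)) < \<epsilon> / 4 * s"
      using \<epsilon> s by (intro tendstoD[OF t1]) auto
    have ev2: "\<forall>\<^sub>F z in jnhds UNIV x \<mu>. dist (lfd h (snd z) (fst z)) (lfd h \<mu> x) < \<epsilon> / 4 * s"
      using \<epsilon> s by (intro tendstoD[OF t2]) auto
    have ev3: "\<forall>\<^sub>F z in jnhds UNIV x \<mu>. snd z \<in> P2 \<and> wasserstein 2 (snd z) \<mu> < 1"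
      unfolding eventually_jnhds by (rule exI[of _ 1]) auto
    have quot: "norm (lfd h \<nu> (y + s *\<^sub>R e) - lfd h \<nu> y - s *\<^sub>R fd (lfd h \<nu>) y e) \<le> C * s * s"
      if "\<nu> \<in> P2" "c \<nu> \<le> C" for \<nu> y
    proof -
      have "norm (fd (fd (lfd h \<nu>)) y) \<le> C" for y using c(2)[OF that(1), of y] that(2) by linarith
      from fd_taylor[OF Ld[OF that(1)] this, of y "s *\<^sub>R e"] e s show ?thesis
        by (simp add: blinfun.scaleR_right power2_eq_square)
    qed
    show "\<forall>\<^sub>F z in jnhds UNIV x \<mu>. dist (fd (lfd h (snd z)) (fst z) e) (fd (lfd h \<mu>) x e) < \<epsilon>"
      using ev1 ev2 ev3
    proof eventually_elim
      case (elim z)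
      define \<nu> y where "\<nu> = snd z" and "y = fst z"
      have q1: "norm (lfd h \<nu> (y + s *\<^sub>R e) - lfd h \<nu> y - s *\<^sub>R fd (lfd h \<nu>) y e) \<le> C * s * s"
        using elim near by (intro quot) (auto simp: \<nu>_def)
      have q2: "norm (lfd h \<mu> (x + s *\<^sub>R e) - lfd h \<mu> x - s *\<^sub>R fd (lfd h \<mu>) x e) \<le> C * s * s"
        using \<mu> near \<open>wasserstein 2 \<mu> \<mu> < 1\<close> by (intro quot) auto
      have "s *\<^sub>R (fd (lfd h \<nu>) y e - fd (lfd h \<mu>) x e) =
         (lfd h \<mu> (x + s *\<^sub>R e) - lfd h \<mu> x - s *\<^sub>R fd (lfd h \<mu>) x e)
         - (lfd h \<nu> (y + s *\<^sub>R e) - lfd h \<nu> y - s *\<^sub>R fd (lfd h \<nu>) y e)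
         + (lfd h \<nu> (y + s *\<^sub>R e) - lfd h \<mu> (x + s *\<^sub>R e)) - (lfd h \<nu> y - lfd h \<mu> x)"
        by (simp add: algebra_simps)
      also have "norm \<dots> \<le> C * s * s + C * s * s + \<epsilon> / 4 * s + \<epsilon> / 4 * s"
      proof -
        have tri: "norm (a - b + c - d) \<le> norm a + norm b + norm c + norm d" for a b c d :: 'b
          using norm_triangle_ineq4[of "a - b + c" d] norm_triangle_ineq[of "a - b" c] norm_triangle_ineq4[of a b]
          by linarith
        have "norm (lfd h \<nu> (y + s *\<^sub>R e) - lfd h \<mu> (x + s *\<^sub>R e)) < \<epsilon> / 4 * s"
          "norm (lfd h \<nu> y - lfd h \<mu> x) < \<epsilon> / 4 * s"
          using elim unfolding dist_norm \<nu>_def y_def by auto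
        then show ?thesis using q1 q2 by (intro order_trans[OF tri] add_mono) auto
      qed
      also have "\<dots> = s * (2 * C * s + \<epsilon> / 2)" by (simp add: algebra_simps)
      finally have "s * norm (fd (lfd h \<nu>) y e - fd (lfd h \<mu>) x e) \<le> s * (2 * C * s + \<epsilon> / 2)"
        using s by simp
      then have "norm (fd (lfd h \<nu>) y e - fd (lfd h \<mu>) x e) \<le> 2 * C * s + \<epsilon> / 2" using s by simp
      then show ?case using sC by (simp add: dist_norm \<nu>_def y_def)
    qed
  qed
qed

theorem regular2_has_L_deriv_cont:
  fixes h :: "'x::euclidean_space measure \<Rightarrow> 'b::euclidean_space"
  assumes R: "regular2 h H" and rep: "every_law TYPE('x)"
  shows "has_L_deriv_cont h (\<lambda>\<mu> x. fd (lfd h \<mu>) x)"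
  unfolding has_L_deriv_cont_def
proof (intro conjI ballI regular2_deriv_jcont[OF R rep])
  fix \<mu> :: "'x measure" assume \<mu>: "\<mu> \<in> P2"
  obtain X where X: "sq_integrable X" "law X = \<mu>" by (rule every_lawE[OF rep \<mu>])
  have Xm: "X \<in> borel_measurable Omega" using X by (simp add: sq_integrable_def)
  obtain c where c: "bounded_on_bounded c" "\<And>\<mu> x. \<mu> \<in> P2 \<Longrightarrow> norm (fd (fd (lfd h \<mu>)) x) \<le> c \<mu>"
     "\<And>\<mu> x y. \<mu> \<in> P2 \<Longrightarrow> norm (mixed_deriv (H \<mu>) x y) \<le> c \<mu>"
    using R unfolding regular2_def by blast
  have Ld: "lfd h \<mu> differentiable (at y)" "fd (lfd h \<mu>) differentiable (at y)" for y
    using R \<mu> unfolding regular2_def by auto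
  obtain C where C: "\<And>\<nu>. \<nu> \<in> P2 \<Longrightarrow> mnorm 2 \<nu> \<le> sqrt (3 * sm \<mu> + 2) \<Longrightarrow> c \<nu> \<le> C"
    using c(1) unfolding bounded_on_bounded_def by blast
  have cc: "c \<mu> \<le> C" using C[OF \<mu>] by (simp add: mnorm_2 add_increasing2)
  have Dc: "continuous_on UNIV (fd (lfd h \<mu>))"
    using Ld(2) differentiable_imp_continuous_on[of "fd (lfd h \<mu>)" UNIV] by (simp add: differentiable_on_def)
  then have Dm: "fd (lfd h \<mu>) \<in> borel_measurable borel" by (rule borel_measurable_continuous_onI)
  have "sq_integrable (\<lambda>\<omega>. fd (lfd h \<mu>) (X \<omega>))"
    unfolding sq_integrable_def
  proof
    show m: "(\<lambda>\<omega>. fd (lfd h \<mu>) (X \<omega>)) \<in> borel_measurable Omega" by (rule measurable_compose[OF Xm Dm])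
    show "integrable Omega (\<lambda>\<omega>. (norm (fd (lfd h \<mu>) (X \<omega>)))\<^sup>2)"
    proof (rule Bochner_Integration.integrable_bound)
      let ?g = "\<lambda>\<omega>. 2 * (norm (fd (lfd h \<mu>) 0))\<^sup>2 + 2 * ((c \<mu>)\<^sup>2 * (norm (X \<omega>))\<^sup>2)"
      show "integrable Omega ?g" using X by (auto simp: sq_integrable_def)
      show "(\<lambda>\<omega>. (norm (fd (lfd h \<mu>) (X \<omega>)))\<^sup>2) \<in> borel_measurable Omega" using m by measurable
      have "(norm (fd (lfd h \<mu>) x))\<^sup>2 \<le> 2 * (norm (fd (lfd h \<mu>) 0))\<^sup>2 + 2 * ((c \<mu>)\<^sup>2 * (norm x)\<^sup>2)" for x
      proof -
        have "norm (fd (lfd h \<mu>) x - fd (lfd h \<mu>) 0) \<le> c \<mu> * norm (x - 0)"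
          by (rule fd_lipschitz[OF Ld(2) c(2)[OF \<mu>]])
        then have "(norm (fd (lfd h \<mu>) x - fd (lfd h \<mu>) 0))\<^sup>2 \<le> (c \<mu> * norm x)\<^sup>2"
          by (intro power_mono) auto
        then show ?thesis
          using norm_sq_le[of "fd (lfd h \<mu>) 0" "fd (lfd h \<mu>) x - fd (lfd h \<mu>) 0"]
          by (simp add: power_mult_distrib)
      qed
      then show "AE \<omega> in Omega. norm ((norm (fd (lfd h \<mu>) (X \<omega>)))\<^sup>2) \<le> norm (?g \<omega>)"
        by (intro AE_I2) auto
    qed
  qed
  moreover have "\<exists>\<delta>>0. \<forall>Y. sq_integrable Y \<longrightarrow> l2norm Y < \<delta> \<longrightarrow>
      \<bar>\<phi> (h (law (\<lambda>\<omega>. X \<omega> + Y \<omega>))) - \<phi> (h (law X)) - (\<integral>\<omega>. \<phi> (fd (lfd h \<mu>) (X \<omega>) (Y \<omega>)) \<partial>Omega)\<bar> \<le> \<epsilon> * l2norm Y"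
    if \<epsilon>: "0 < \<epsilon>" for \<phi> :: "'b \<Rightarrow>\<^sub>L real" and \<epsilon>
  proof -
    have C0: "0 \<le> C" using cc c(2)[OF \<mu>, of 0] norm_ge_zero[of "fd (fd (lfd h \<mu>)) 0"] by linarith
    define K where "K = norm \<phi> * (C + C)"
    have K0: "0 \<le> K" using C0 by (simp add: K_def)
    define \<delta> where "\<delta> = min 1 (\<epsilon> / (K + 1))"
    have \<delta>: "0 < \<delta>" using \<epsilon> K0 by (simp add: \<delta>_def)
    have "\<bar>\<phi> (h (law (\<lambda>\<omega>. X \<omega> + Y \<omega>))) - \<phi> (h (law X)) - (\<integral>\<omega>. \<phi> (fd (lfd h \<mu>) (X \<omega>) (Y \<omega>)) \<partial>Omega)\<bar> \<le> \<epsilon> * l2norm Y"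
      if Y: "sq_integrable Y" "l2norm Y < \<delta>" for Y
    proof -
      define \<nu> where "\<nu> = law (\<lambda>\<omega>. X \<omega> + Y \<omega>)"
      have XY: "sq_integrable (\<lambda>\<omega>. X \<omega> + Y \<omega>)" by (rule sq_integrable_add[OF X(1) Y(1)])
      have \<nu>: "\<nu> \<in> P2" unfolding \<nu>_def by (rule law_P2[OF XY])
      have "(l2norm Y)\<^sup>2 \<le> 1\<^sup>2" using Y(2) by (intro power_mono) (auto simp: \<delta>_def)
      then have sm\<nu>: "sm \<nu> \<le> 2 * sm \<mu> + 2"
        using l2norm_add_power2[OF X(1) Y(1)] X XY Xm unfolding \<nu>_def
        by (subst sm_law) (auto simp: sq_integrable_def sm_law simp flip: X(2))
      have "norm (mixed_deriv (H (mix \<theta> \<nu> \<mu>)) x y) \<le> C" if \<theta>: "0 \<le> \<theta>" "\<theta> \<le> 1" for \<theta> x y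
      proof -
        have "sm (mix \<theta> \<nu> \<mu>) \<le> 3 * sm \<mu> + 2" using mix_P2(2)[OF \<nu> \<mu> \<theta>] sm\<nu> by linarith
        then have "c (mix \<theta> \<nu> \<mu>) \<le> C" using mix_P2(1)[OF \<nu> \<mu> \<theta>] by (intro C) (auto simp: mnorm_2)
        then show ?thesis using c(3)[OF mix_P2(1)[OF \<nu> \<mu> \<theta>], of x y] by linarith
      qed
      moreover have "norm (fd (fd (lfd h \<mu>)) y) \<le> C" for y using c(2)[OF \<mu>, of y] cc by linarith
      ultimately have "\<bar>\<phi> (h (law (\<lambda>\<omega>. X \<omega> + Y \<omega>))) - \<phi> (h (law X)) - (\<integral>\<omega>. \<phi> (fd (lfd h \<mu>) (X \<omega>) (Y \<omega>)) \<partial>Omega)\<bar>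
          \<le> K * (l2norm Y)\<^sup>2"
        using regular2_expansion[OF R rep X(1) Y(1), of C C \<phi>] unfolding X(2) \<nu>_def K_def by blast
      also have "\<dots> = (K * l2norm Y) * l2norm Y" by (simp add: power2_eq_square)
      also have "\<dots> \<le> \<epsilon> * l2norm Y"
      proof (rule mult_right_mono)
        have "K * l2norm Y \<le> (K + 1) * (\<epsilon> / (K + 1))"
          using Y(2) K0 by (intro mult_mono) (auto simp: \<delta>_def)
        then show "K * l2norm Y \<le> \<epsilon>" using K0 by simp
      qed simp
      finally show ?thesis .
    qed
    then show ?thesis using \<delta> by blast
  qed
  ultimately show "has_L_deriv h \<mu> (fd (lfd h \<mu>))"
    unfolding has_L_deriv_def using Dm X by blast
qed

lemma L_deriv_works:
  fixes h :: "'x::euclidean_space measure \<Rightarrow> 'b::euclidean_space"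
  assumes "regular2 h H" "every_law TYPE('x)"
  shows "has_L_deriv_cont h (L_deriv h)"
  unfolding L_deriv_def by (rule someI[where P = "has_L_deriv_cont h", OF regular2_has_L_deriv_cont[OF assms]])

section \<open>Derivatives along finitely valued perturbations\<close>

lemma simple_perturb:
  assumes "simple_function Omega Z" "simple_function Omega (\<Xi> :: real \<Rightarrow> 'x::real_vector)"
  shows "simple_function Omega (\<lambda>\<omega>. Z \<omega> + \<Xi> \<omega>)" "simple_function Omega (\<lambda>\<omega>. Z \<omega> + s *\<^sub>R \<Xi> \<omega>)"
    "simple_function Omega (\<lambda>\<omega>. s *\<^sub>R \<Xi> \<omega>)"
  using simple_comp2[OF assms, of "\<lambda>z x. z + x"] simple_comp2[OF assms, of "\<lambda>z x. z + s *\<^sub>R x"]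
    simple_comp[OF assms(2), of "\<lambda>x. s *\<^sub>R x"] by auto

lemma law_simple_P2: "simple_function Omega Z \<Longrightarrow> law Z \<in> P2"
  by (intro law_P2 sq_integrable_simple)

text \<open>\<open>D\<close> is the derivative of \<open>h\<close> along all lines of finitely valued random vectors. Unlike
  L-differentiability, which provides an own representative for each function, this notion is
  evidently stable under differences.\<close>

definition directional_deriv :: "('x::euclidean_space measure \<Rightarrow> 'b::real_normed_vector) \<Rightarrow>
    ('x measure \<Rightarrow> 'x \<Rightarrow> 'x \<Rightarrow>\<^sub>L 'b) \<Rightarrow> bool" where
  "directional_deriv h D \<longleftrightarrow> (\<forall>Z \<Xi> s. \<forall>\<phi> :: 'b \<Rightarrow>\<^sub>L real. simple_function Omega Z \<longrightarrow> simple_function Omega \<Xi> \<longrightarrow>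
     ((\<lambda>s. \<phi> (h (law (\<lambda>\<omega>. Z \<omega> + s *\<^sub>R \<Xi> \<omega>)))) has_real_derivative
       (\<integral>\<omega>. \<phi> (D (law (\<lambda>\<omega>. Z \<omega> + s *\<^sub>R \<Xi> \<omega>)) (Z \<omega> + s *\<^sub>R \<Xi> \<omega>) (\<Xi> \<omega>)) \<partial>Omega)) (at s))"

lemma directional_derivD:
  fixes h :: "'x::euclidean_space measure \<Rightarrow> 'b::real_normed_vector" and \<phi> :: "'b \<Rightarrow>\<^sub>L real"
  assumes "directional_deriv h D" "simple_function Omega Z" "simple_function Omega \<Xi>"
  shows "((\<lambda>s. \<phi> (h (law (\<lambda>\<omega>. Z \<omega> + s *\<^sub>R \<Xi> \<omega>)))) has_real_derivative
       (\<integral>\<omega>. \<phi> (D (law (\<lambda>\<omega>. Z \<omega> + s *\<^sub>R \<Xi> \<omega>)) (Z \<omega> + s *\<^sub>R \<Xi> \<omega>) (\<Xi> \<omega>)) \<partial>Omega)) (at s)"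
  using assms unfolding directional_deriv_def by blast

lemma L_deriv_path:
  fixes h :: "'x::euclidean_space measure \<Rightarrow> 'b::real_normed_vector" and \<phi> :: "'b \<Rightarrow>\<^sub>L real"
  assumes Z: "simple_function Omega Z" and \<Xi>: "simple_function Omega \<Xi>"
    and h: "has_L_deriv h (law (\<lambda>\<omega>. Z \<omega> + s *\<^sub>R \<Xi> \<omega>)) D"
  shows "((\<lambda>s. \<phi> (h (law (\<lambda>\<omega>. Z \<omega> + s *\<^sub>R \<Xi> \<omega>)))) has_real_derivative
       (\<integral>\<omega>. \<phi> (D (Z \<omega> + s *\<^sub>R \<Xi> \<omega>) (\<Xi> \<omega>)) \<partial>Omega)) (at s)"
proof -
  define Zs where "Zs \<omega> = Z \<omega> + s *\<^sub>R \<Xi> \<omega>" for \<omega>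
  have Zs: "simple_function Omega Zs" unfolding Zs_def[abs_def] by (rule simple_perturb[OF Z \<Xi>])
  define I where "I = (\<integral>\<omega>. \<phi> (D (Zs \<omega>) (\<Xi> \<omega>)) \<partial>Omega)"
  have "((\<lambda>s. \<phi> (h (law (\<lambda>\<omega>. Z \<omega> + s *\<^sub>R \<Xi> \<omega>)))) has_derivative (*) I) (at s)"
    unfolding has_derivative_at_alt
  proof (intro conjI allI impI bounded_linear_mult_right)
    fix e :: real assume e: "0 < e"
    define e' where "e' = e / (l2norm \<Xi> + 1)"
    have n: "0 < l2norm \<Xi> + 1" by (simp add: add_nonneg_pos)
    have e': "0 < e'" using e n by (simp add: e'_def)
    obtain \<delta> where \<delta>: "0 < \<delta>" "\<And>Y. simple_function Omega Y \<Longrightarrow> l2norm Y < \<delta> \<Longrightarrow>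
      \<bar>\<phi> (h (law (\<lambda>\<omega>. Zs \<omega> + Y \<omega>))) - \<phi> (h (law Zs)) - (\<integral>\<omega>. \<phi> (D (Zs \<omega>) (Y \<omega>)) \<partial>Omega)\<bar> \<le> e' * l2norm Y"
      using L_deriv_simple[of h Zs D e' \<phi>] h Zs e' unfolding Zs_def by blast
    have "norm (\<phi> (h (law (\<lambda>\<omega>. Z \<omega> + r *\<^sub>R \<Xi> \<omega>))) - \<phi> (h (law (\<lambda>\<omega>. Z \<omega> + s *\<^sub>R \<Xi> \<omega>))) - I * (r - s)) \<le> e * norm (r - s)"
      if r: "norm (r - s) < \<delta> / (l2norm \<Xi> + 1)" for r
    proof -
      define Y where "Y \<omega> = (r - s) *\<^sub>R \<Xi> \<omega>" for \<omega>
      have Y: "simple_function Omega Y" unfolding Y_def[abs_def] by (rule simple_perturb[OF Z \<Xi>])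
      have Yn: "l2norm Y = \<bar>r - s\<bar> * l2norm \<Xi>" unfolding Y_def[abs_def] by (rule l2norm_scale)
      have "\<bar>r - s\<bar> * l2norm \<Xi> \<le> \<bar>r - s\<bar> * (l2norm \<Xi> + 1)" by (intro mult_left_mono) auto
      also have "\<dots> < \<delta>" using r n by (simp add: field_simps)
      finally have "l2norm Y < \<delta>" by (simp add: Yn)
      note \<delta>(2)[OF Y this]
      moreover have "(\<lambda>\<omega>. Zs \<omega> + Y \<omega>) = (\<lambda>\<omega>. Z \<omega> + r *\<^sub>R \<Xi> \<omega>)"
        by (simp add: Zs_def Y_def algebra_simps)
      moreover have "(\<integral>\<omega>. \<phi> (D (Zs \<omega>) (Y \<omega>)) \<partial>Omega) = I * (r - s)"
        unfolding Y_def I_def by (simp add: blinfun.scaleR_right)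
      moreover have "e' * l2norm Y \<le> e * \<bar>r - s\<bar>"
      proof -
        have "e' * l2norm \<Xi> \<le> e' * (l2norm \<Xi> + 1)" using e' by (intro mult_left_mono) auto
        also have "\<dots> = e" using n by (simp add: e'_def)
        finally show ?thesis unfolding Yn using mult_right_mono[of "e' * l2norm \<Xi>" e "\<bar>r - s\<bar>"]
          by (simp add: mult_ac)
      qed
      ultimately show ?thesis unfolding Zs_def by simp
    qed
    moreover have "0 < \<delta> / (l2norm \<Xi> + 1)" using \<delta>(1) n by simp
    ultimately show "\<exists>d>0. \<forall>y. norm (y - s) < d \<longrightarrow> norm (\<phi> (h (law (\<lambda>\<omega>. Z \<omega> + y *\<^sub>R \<Xi> \<omega>)))
         - \<phi> (h (law (\<lambda>\<omega>. Z \<omega> + s *\<^sub>R \<Xi> \<omega>))) - I * (y - s)) \<le> e * norm (y - s)"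
      by blast
  qed
  then show ?thesis unfolding has_field_derivative_def I_def Zs_def .
qed

lemma L_deriv_cont_directional:
  fixes h :: "'x::euclidean_space measure \<Rightarrow> 'b::real_normed_vector"
  assumes "has_L_deriv_cont h D" shows "directional_deriv h D"
  unfolding directional_deriv_def
proof (intro allI impI)
  fix Z \<Xi> :: "real \<Rightarrow> 'x" and s :: real and \<phi> :: "'b \<Rightarrow>\<^sub>L real"
  assume *: "simple_function Omega Z" "simple_function Omega \<Xi>"
  have "has_L_deriv h (law (\<lambda>\<omega>. Z \<omega> + s *\<^sub>R \<Xi> \<omega>)) (D (law (\<lambda>\<omega>. Z \<omega> + s *\<^sub>R \<Xi> \<omega>)))"
    using assms law_simple_P2[OF simple_perturb(2)[OF *]] unfolding has_L_deriv_cont_def by blast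
  from L_deriv_path[OF * this]
  show "((\<lambda>s. \<phi> (h (law (\<lambda>\<omega>. Z \<omega> + s *\<^sub>R \<Xi> \<omega>)))) has_real_derivative
       (\<integral>\<omega>. \<phi> (D (law (\<lambda>\<omega>. Z \<omega> + s *\<^sub>R \<Xi> \<omega>)) (Z \<omega> + s *\<^sub>R \<Xi> \<omega>) (\<Xi> \<omega>)) \<partial>Omega)) (at s)" .
qed

lemma directional_deriv_diff:
  fixes h k :: "'x::euclidean_space measure \<Rightarrow> 'b::real_normed_vector"
  assumes "directional_deriv h D" "directional_deriv k E"
  shows "directional_deriv (\<lambda>\<mu>. h \<mu> - k \<mu>) (\<lambda>\<mu> x. D \<mu> x - E \<mu> x)"
  unfolding directional_deriv_def
proof (intro allI impI)
  fix Z \<Xi> :: "real \<Rightarrow> 'x" and s :: real and \<phi> :: "'b \<Rightarrow>\<^sub>L real"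
  assume *: "simple_function Omega Z" "simple_function Omega \<Xi>"
  define \<mu> where "\<mu> s = law (\<lambda>\<omega>. Z \<omega> + s *\<^sub>R \<Xi> \<omega>)" for s
  have i: "integrable Omega (\<lambda>\<omega>. \<phi> (D (\<mu> s) (Z \<omega> + s *\<^sub>R \<Xi> \<omega>) (\<Xi> \<omega>)))"
    for D :: "'x measure \<Rightarrow> 'x \<Rightarrow> 'x \<Rightarrow>\<^sub>L 'b"
    using simple_integrable[OF simple_comp2[OF *, of Pair], of "\<lambda>(z, x). \<phi> (D (\<mu> s) (z + s *\<^sub>R x) x)"] by simp
  have "((\<lambda>s. \<phi> (h (\<mu> s)) - \<phi> (k (\<mu> s))) has_real_derivative
     (\<integral>\<omega>. \<phi> (D (\<mu> s) (Z \<omega> + s *\<^sub>R \<Xi> \<omega>) (\<Xi> \<omega>)) \<partial>Omega) - (\<integral>\<omega>. \<phi> (E (\<mu> s) (Z \<omega> + s *\<^sub>R \<Xi> \<omega>) (\<Xi> \<omega>)) \<partial>Omega)) (at s)"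
    using assms * unfolding directional_deriv_def \<mu>_def by (intro DERIV_diff) auto
  then show "((\<lambda>s. \<phi> (h (law (\<lambda>\<omega>. Z \<omega> + s *\<^sub>R \<Xi> \<omega>)) - k (law (\<lambda>\<omega>. Z \<omega> + s *\<^sub>R \<Xi> \<omega>)))) has_real_derivative
       (\<integral>\<omega>. \<phi> ((D (law (\<lambda>\<omega>. Z \<omega> + s *\<^sub>R \<Xi> \<omega>)) (Z \<omega> + s *\<^sub>R \<Xi> \<omega>) - E (law (\<lambda>\<omega>. Z \<omega> + s *\<^sub>R \<Xi> \<omega>)) (Z \<omega> + s *\<^sub>R \<Xi> \<omega>)) (\<Xi> \<omega>)) \<partial>Omega)) (at s)"
    unfolding \<mu>_def[symmetric] blinfun.diff_left blinfun.diff_right using i[of D] i[of E] by simp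
qed

lemma directional_lipschitz:
  fixes h :: "'x::euclidean_space measure \<Rightarrow> 'b::euclidean_space"
  assumes h: "directional_deriv h D" and Z: "simple_function Omega Z" and \<Xi>: "simple_function Omega \<Xi>"
    and \<Lambda>: "\<And>Z y. simple_function Omega Z \<Longrightarrow> norm (D (law Z) y) \<le> \<Lambda>"
  shows "norm (h (law (\<lambda>\<omega>. Z \<omega> + \<Xi> \<omega>)) - h (law Z)) \<le> \<Lambda> * l2norm \<Xi>"
proof -
  define e where "e = h (law (\<lambda>\<omega>. Z \<omega> + \<Xi> \<omega>)) - h (law Z)"
  let ?Z = "\<lambda>s \<omega>. Z \<omega> + s *\<^sub>R \<Xi> \<omega>" and ?\<phi> = "blinfun_inner_left e"
  have "\<And>s. ((\<lambda>s. ?\<phi> (h (law (?Z s)))) has_real_derivative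
       (\<integral>\<omega>. ?\<phi> (D (law (?Z s)) (?Z s \<omega>) (\<Xi> \<omega>)) \<partial>Omega)) (at s)"
    using h Z \<Xi> unfolding directional_deriv_def by blast
  from MVT2[of 0 1, OF _ this] obtain s where
    s: "?\<phi> (h (law (?Z 1))) - ?\<phi> (h (law (?Z 0))) = (1 - 0) * (\<integral>\<omega>. ?\<phi> (D (law (?Z s)) (?Z s \<omega>) (\<Xi> \<omega>)) \<partial>Omega)"
    by auto
  have "norm e * norm e = e \<bullet> e" by (simp add: dot_square_norm power2_eq_square)
  also have "e \<bullet> e = (\<integral>\<omega>. ?\<phi> (D (law (?Z s)) (?Z s \<omega>) (\<Xi> \<omega>)) \<partial>Omega)"
    using s by (simp add: e_def inner_diff_left inner_commute)
  also have "\<dots> \<le> (\<integral>\<omega>. norm e * \<Lambda> * norm (\<Xi> \<omega>) \<partial>Omega)"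
  proof (rule integral_mono)
    show "integrable Omega (\<lambda>\<omega>. ?\<phi> (D (law (?Z s)) (?Z s \<omega>) (\<Xi> \<omega>)))"
      using simple_integrable[OF simple_comp2[OF Z \<Xi>, of Pair], of "\<lambda>(z, x). ?\<phi> (D (law (?Z s)) (z + s *\<^sub>R x) x)"] by simp
    show "integrable Omega (\<lambda>\<omega>. norm e * \<Lambda> * norm (\<Xi> \<omega>))"
      using \<Xi> by (intro simple_integrable[where \<phi> = "\<lambda>x. norm e * \<Lambda> * norm x"])
    fix \<omega>
    have "?\<phi> (D (law (?Z s)) (?Z s \<omega>) (\<Xi> \<omega>)) \<le> norm e * norm (D (law (?Z s)) (?Z s \<omega>) (\<Xi> \<omega>))"
      by (simp add: norm_cauchy_schwarz inner_commute)
    also have "\<dots> \<le> norm e * (\<Lambda> * norm (\<Xi> \<omega>))"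
      by (intro mult_left_mono order_trans[OF norm_blinfun] mult_right_mono \<Lambda> simple_perturb(2)[OF Z \<Xi>]) auto
    finally show "?\<phi> (D (law (?Z s)) (?Z s \<omega>) (\<Xi> \<omega>)) \<le> norm e * \<Lambda> * norm (\<Xi> \<omega>)" by (simp add: mult.assoc)
  qed
  also have "\<dots> = norm e * (\<Lambda> * (\<integral>\<omega>. norm (\<Xi> \<omega>) \<partial>Omega))" by simp
  also have "\<dots> \<le> norm e * (\<Lambda> * l2norm \<Xi>)"
    using sq_integrable_norm(2)[OF sq_integrable_simple[OF \<Xi>]] order_trans[OF norm_ge_zero \<Lambda>[OF Z]]
    by (intro mult_left_mono) auto
  finally have *: "norm e * norm e \<le> norm e * (\<Lambda> * l2norm \<Xi>)" .
  have "0 \<le> \<Lambda> * l2norm \<Xi>" using order_trans[OF norm_ge_zero \<Lambda>[OF Z]] by simp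
  then have "norm e \<le> \<Lambda> * l2norm \<Xi>" using * by (cases "norm e = 0") auto
  then show ?thesis by (simp add: e_def)
qed

text \<open>Jointly continuous versions of the L-derivative agree at all points of the space, also outside the
  support of the measure: a small mass is moved to the point in question.\<close>

lemma L_deriv_cont_unique:
  fixes h :: "'x::euclidean_space measure \<Rightarrow> 'b::euclidean_space"
  assumes D: "has_L_deriv_cont h D" and E: "has_L_deriv_cont h E" and Z: "simple_function Omega Z"
  shows "D (law Z) y = E (law Z) y"
proof -
  have atom: "D (law Z) y = E (law Z) y"
    if Z: "simple_function Omega Z" and p: "0 < measure Omega {\<omega>. Z \<omega> = y}" for Z :: "real \<Rightarrow> 'x"
  proof (rule blinfun_eqI)
    fix v :: 'x
    define \<Xi> where "\<Xi> \<omega> = (if Z \<omega> = y then v else 0)" for \<omega>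
    have \<Xi>: "simple_function Omega \<Xi>" unfolding \<Xi>_def[abs_def] by (rule simple_comp[OF Z])
    have val: "(\<integral>\<omega>. \<phi> (D (law Z) (Z \<omega>) (\<Xi> \<omega>)) \<partial>Omega) = measure Omega {\<omega>. Z \<omega> = y} * \<phi> (D (law Z) y v)"
      for \<phi> :: "'b \<Rightarrow>\<^sub>L real" and D :: "'x measure \<Rightarrow> 'x \<Rightarrow> 'x \<Rightarrow>\<^sub>L 'b"
    proof -
      have "(\<integral>\<omega>. \<phi> (D (law Z) (Z \<omega>) (\<Xi> \<omega>)) \<partial>Omega) =
          (\<integral>\<omega>. \<phi> (D (law Z) y v) * indicator {\<omega>. Z \<omega> = y} \<omega> \<partial>Omega)"
        by (intro Bochner_Integration.integral_cong) (auto simp: \<Xi>_def blinfun.zero_right)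
      then show ?thesis by (simp add: mult.commute)
    qed
    have eq: "\<phi> (D (law Z) y v) = \<phi> (E (law Z) y v)" for \<phi> :: "'b \<Rightarrow>\<^sub>L real"
    proof -
      note directional_derivD[OF L_deriv_cont_directional[OF D] Z \<Xi>, where s = 0 and \<phi> = \<phi>]
        directional_derivD[OF L_deriv_cont_directional[OF E] Z \<Xi>, where s = 0 and \<phi> = \<phi>]
      from DERIV_unique[OF this] have "measure Omega {\<omega>. Z \<omega> = y} * \<phi> (D (law Z) y v) = measure Omega {\<omega>. Z \<omega> = y} * \<phi> (E (law Z) y v)"
        by (simp add: val)
      then show ?thesis using p by simp
    qed
    show "D (law Z) y v = E (law Z) y v"
    proof (rule euclidean_eqI)
      fix b :: 'b
      show "D (law Z) y v \<bullet> b = E (law Z) y v \<bullet> b"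
        using eq[of "blinfun_inner_right b"] eq[of "blinfun_inner_left b"]
        by (simp only: blinfun_inner_right.rep_eq blinfun_inner_left.rep_eq inner_commute[of b])
    qed
  qed
  \<comment> \<open>Under the law of \<open>W n\<close> the point \<open>y\<close> has positive mass, and these laws converge to the law of \<open>Z\<close>.\<close>
  define W where "W n \<omega> = (if \<omega> \<in> {0..1 / real (Suc n)} then y else Z \<omega>)" for n \<omega>
  have ind: "simple_function Omega (\<lambda>\<omega>. \<omega> \<in> {0..1 / real (Suc n)})" for n
  proof -
    have "{\<omega>. (\<omega> \<in> {0..1 / real (Suc n)}) = l} \<in> sets borel" for l
      by (cases l) (auto simp: Compl_eq[symmetric])
    then show ?thesis unfolding simple_Omega_iff by (auto intro: finite_subset[of _ UNIV])
  qed
  have W: "simple_function Omega (W n)" for n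
    unfolding W_def[abs_def] using simple_comp2[OF ind Z, of "\<lambda>b z. if b then y else z"] by simp
  have mass: "measure Omega {0..1 / real (Suc n)} = 1 / real (Suc n)" for n
  proof -
    have "{0..1} \<inter> {0..1 / real (Suc n)} = {0..1 / real (Suc n)}" by auto
    then show ?thesis by (subst measure_Omega) auto
  qed
  have eqW: "D (law (W n)) y = E (law (W n)) y" for n
  proof (rule atom[OF W])
    have "{\<omega>. W n \<omega> = y} \<in> sets Omega"
      using W[of n, unfolded simple_Omega_iff] unfolding sets_Omega by (rule conjunct2[THEN spec])
    moreover have "{0..1 / real (Suc n)} \<subseteq> {\<omega>. W n \<omega> = y}"
      by (rule subsetI) (simp only: W_def mem_Collect_eq if_True)
    ultimately have "measure Omega {0..1 / real (Suc n)} \<le> measure Omega {\<omega>. W n \<omega> = y}"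
      by (intro Om.finite_measure_mono)
    moreover have "0 < 1 / real (Suc n)" by simp
    ultimately show "0 < measure Omega {\<omega>. W n \<omega> = y}" unfolding mass by linarith
  qed
  have "finite (range Z)" using Z by (simp add: simple_Omega_iff)
  then obtain K where K: "\<And>\<omega>. norm (y - Z \<omega>) \<le> K"
    using finite_imp_bounded[THEN bounded_any_center[of "range Z" y, THEN iffD1]] by (auto simp: dist_norm)
  have dist: "wasserstein 2 (law (W n)) (law Z) \<le> sqrt (K\<^sup>2 * (1 / real (Suc n)))" for n
  proof -
    have sub: "simple_function Omega (\<lambda>\<omega>. W n \<omega> - Z \<omega>)" by (rule simple_comp2[OF W Z])
    have "(\<integral>\<omega>. (norm (W n \<omega> - Z \<omega>))\<^sup>2 \<partial>Omega) \<le> (\<integral>\<omega>. K\<^sup>2 * indicator {0..1 / real (Suc n)} \<omega> \<partial>Omega)"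
    proof (rule integral_mono)
      show "integrable Omega (\<lambda>\<omega>. (norm (W n \<omega> - Z \<omega>))\<^sup>2)"
        using sq_integrable_simple[OF sub] by (simp add: sq_integrable_def)
      show "integrable Omega (\<lambda>\<omega>. K\<^sup>2 * indicator {0..1 / real (Suc n)} \<omega>)"
        by (intro integrable_mult_right) (auto simp: integrable_indicator_iff Om.emeasure_eq_measure)
      show "(norm (W n \<omega> - Z \<omega>))\<^sup>2 \<le> K\<^sup>2 * indicator {0..1 / real (Suc n)} \<omega>" for \<omega>
        using K[of \<omega>] by (auto simp: W_def intro: power_mono)
    qed
    also have "\<dots> = K\<^sup>2 * (1 / real (Suc n))" using mass[of n] by simp
    finally have "l2norm (\<lambda>\<omega>. W n \<omega> - Z \<omega>) \<le> sqrt (K\<^sup>2 * (1 / real (Suc n)))"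
      unfolding l2norm_def by (rule real_sqrt_le_mono)
    then show ?thesis using wasserstein_le[OF simple_borel[OF W] simple_borel[OF Z], of n] by linarith
  qed
  have "(\<lambda>n. sqrt (K\<^sup>2 * (1 / real (Suc n)))) \<longlonglongrightarrow> sqrt (K\<^sup>2 * 0)"
    by (intro tendsto_intros LIMSEQ_Suc[OF lim_1_over_n])
  then have lim0: "(\<lambda>n. sqrt (K\<^sup>2 * (1 / real (Suc n)))) \<longlonglongrightarrow> 0" by simp
  have conv: "(\<lambda>n. D (law (W n)) y) \<longlonglongrightarrow> D (law Z) y" if "has_L_deriv_cont h D" for D
  proof (rule metric_LIMSEQ_I)
    fix r :: real assume r: "0 < r"
    have jc: "jcont UNIV (\<lambda>x \<mu>. D \<mu> x)" using that by (simp add: has_L_deriv_cont_def)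
    from jc[unfolded jcont_def, rule_format, OF UNIV_I law_simple_P2[OF Z] r, of y]
    obtain \<delta> where \<delta>: "0 < \<delta>" "\<And>p' \<mu>'. \<mu>' \<in> P2 \<Longrightarrow> dist p' y < \<delta> \<Longrightarrow> wasserstein 2 \<mu>' (law Z) < \<delta> \<Longrightarrow>
        dist (D \<mu>' p') (D (law Z) y) < r" by blast
    from lim0 \<delta>(1) obtain N where "\<And>n. n \<ge> N \<Longrightarrow> sqrt (K\<^sup>2 * (1 / real (Suc n))) < \<delta>"
      unfolding LIMSEQ_iff by (auto dest!: spec[of _ \<delta>])
    then have "dist (D (law (W n)) y) (D (law Z) y) < r" if "N \<le> n" for n
      using \<delta>(1) le_less_trans[OF dist] that by (intro \<delta>(2) law_simple_P2 W) auto
    then show "\<exists>N. \<forall>n\<ge>N. dist (D (law (W n)) y) (D (law Z) y) < r" by blast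
  qed
  show ?thesis using LIMSEQ_unique[OF conv[OF D]] conv[OF E] eqW by simp
qed

section \<open>Linear growth of the derivative\<close>

lemma dirac0_law: "dirac0 = law (\<lambda>_. 0 :: 'x::euclidean_space)"
proof (rule measure_eqI)
  fix A :: "'x set" assume "A \<in> sets dirac0"
  then have A: "A \<in> sets borel" by simp
  then show "emeasure dirac0 A = emeasure (law (\<lambda>_. 0)) A"
    using Om.emeasure_space_1 by (subst emeasure_distr) (auto simp: indicator_def)
qed simp

text \<open>A function whose first-order expansions have the remainder \<open>C\<parallel>\<Xi>\<parallel>\<^sup>2\<close> at every base point has a derivative
  of linear growth.\<close>

lemma quadratic_growth:
  fixes h :: "'x::euclidean_space measure \<Rightarrow> real" and D :: "'x measure \<Rightarrow> 'x \<Rightarrow> 'x \<Rightarrow>\<^sub>L real"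
  assumes C: "\<And>Z \<Xi>. simple_function Omega Z \<Longrightarrow> simple_function Omega \<Xi> \<Longrightarrow>
      \<bar>h (law (\<lambda>\<omega>. Z \<omega> + \<Xi> \<omega>)) - h (law Z) - (\<integral>\<omega>. D (law Z) (Z \<omega>) (\<Xi> \<omega>) \<partial>Omega)\<bar> \<le> C * (l2norm \<Xi>)\<^sup>2"
    and C0: "0 \<le> C" and Z: "simple_function Omega Z" and \<Xi>: "simple_function Omega \<Xi>"
  shows "\<bar>h (law (\<lambda>\<omega>. Z \<omega> + \<Xi> \<omega>)) - h (law Z)\<bar> \<le>
     (norm (D dirac0 0) + 6 * C) * (1 + l2norm Z + l2norm \<Xi>) * l2norm \<Xi>"
proof -
  define l where "l Z Y = (\<integral>\<omega>. D (law Z) (Z \<omega>) (Y \<omega>) \<partial>Omega)" for Z Y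
  define n where "n = l2norm \<Xi>"
  define K where "K = norm (D dirac0 0)"
  have K0: "0 \<le> K" by (simp add: K_def)
  have int: "integrable Omega (\<lambda>\<omega>. D (law Z) (Z \<omega>) (Y \<omega>))" if "simple_function Omega Y" for Y
    using simple_integrable[OF simple_comp2[OF Z that, of Pair], of "\<lambda>(z, x). D (law Z) z x"] by simp
  have l_bound: "\<bar>l W Y\<bar> \<le> M * l2norm Y" if W: "simple_function Omega W" and Y: "simple_function Omega Y"
    and M: "0 \<le> M" "\<And>\<omega>. norm (D (law W) (W \<omega>)) \<le> M" for W Y M
  proof -
    have i: "integrable Omega (\<lambda>\<omega>. D (law W) (W \<omega>) (Y \<omega>))"
      using simple_integrable[OF simple_comp2[OF W Y, of Pair], of "\<lambda>(z, x). D (law W) z x"] by simp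
    note n = sq_integrable_norm[OF sq_integrable_simple[OF Y]]
    have "\<bar>l W Y\<bar> \<le> (\<integral>\<omega>. \<bar>D (law W) (W \<omega>) (Y \<omega>)\<bar> \<partial>Omega)"
      unfolding l_def by (rule integral_abs_bound)
    also have "\<dots> \<le> (\<integral>\<omega>. M * norm (Y \<omega>) \<partial>Omega)"
    proof (rule integral_mono)
      show "\<bar>D (law W) (W \<omega>) (Y \<omega>)\<bar> \<le> M * norm (Y \<omega>)" for \<omega>
        using norm_blinfun[of "D (law W) (W \<omega>)" "Y \<omega>"] mult_right_mono[OF M(2)[of \<omega>] norm_ge_zero[of "Y \<omega>"]]
        by simp
    qed (use i n in auto)
    also have "\<dots> \<le> M * l2norm Y" using n M by (simp add: mult_left_mono)
    finally show ?thesis .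
  qed
  have l_bd: "\<bar>l Z \<Xi>\<bar> \<le> K * n + 6 * C * (1 + l2norm Z) * n"
  proof (cases "n = 0")
    case True
    have "finite (range (\<lambda>\<omega>. norm (D (law Z) (Z \<omega>))))"
      using simple_comp[OF Z, of "\<lambda>z. norm (D (law Z) z)"] by (simp add: simple_Omega_iff)
    then have "norm (D (law Z) (Z \<omega>)) \<le> Max (range (\<lambda>\<omega>. norm (D (law Z) (Z \<omega>))))" for \<omega> by auto
    then have "\<bar>l Z \<Xi>\<bar> \<le> Max (range (\<lambda>\<omega>. norm (D (law Z) (Z \<omega>)))) * n"
      unfolding n_def using norm_ge_zero order_trans by (intro l_bound[OF Z \<Xi>]) blast+
    then show ?thesis using True by simp
  next
    case False
    then have n0: "0 < n" by (simp add: n_def order_le_neq_trans)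
    \<comment> \<open>The derivative \<open>l Z\<close> is compared with \<open>l 0\<close> by expanding \<open>h\<close> at \<open>Z\<close> towards \<open>A\<close> and \<open>0\<close>, and at \<open>0\<close>
      towards \<open>A\<close>. The factor \<open>s\<close> makes \<open>A = s \<Xi>\<close> comparable in size with \<open>Z\<close>.\<close>
    define s where "s = (1 + l2norm Z) / n"
    have Z1: "0 < 1 + l2norm Z" by (simp add: add_pos_nonneg)
    have s: "0 < s" using n0 Z1 by (simp add: s_def)
    define A B where "A \<omega> = s *\<^sub>R \<Xi> \<omega>" and "B \<omega> = - Z \<omega>" for \<omega>
    have sA: "simple_function Omega A" and sB: "simple_function Omega B"
      unfolding A_def[abs_def] B_def[abs_def] using simple_comp[OF \<Xi>] simple_comp[OF Z] by auto
    have sAB: "simple_function Omega (\<lambda>\<omega>. A \<omega> + B \<omega>)" by (rule simple_comp2[OF sA sB])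
    have s0: "simple_function Omega (\<lambda>_. 0 :: 'x)" by simp
    have nA: "l2norm A = 1 + l2norm Z" unfolding A_def[abs_def] l2norm_scale using s n0 by (simp add: n_def[symmetric] s_def)
    have nB: "l2norm B = l2norm Z" by (simp add: B_def l2norm_def)
    have nAB: "(l2norm (\<lambda>\<omega>. A \<omega> + B \<omega>))\<^sup>2 \<le> 2 * (1 + l2norm Z)\<^sup>2 + 2 * (l2norm Z)\<^sup>2"
      using l2norm_add_power2[of A B] sA sB nA nB by simp
    have e1: "\<bar>h (law A) - h (law Z) - l Z (\<lambda>\<omega>. A \<omega> + B \<omega>)\<bar> \<le> C * (l2norm (\<lambda>\<omega>. A \<omega> + B \<omega>))\<^sup>2"
      using C[OF Z sAB] by (simp add: B_def l_def)
    have e2: "\<bar>h dirac0 - h (law Z) - l Z B\<bar> \<le> C * (l2norm Z)\<^sup>2"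
      using C[OF Z sB] nB unfolding dirac0_law by (simp add: B_def l_def)
    have e3: "\<bar>h (law A) - h dirac0 - l (\<lambda>_. 0) A\<bar> \<le> C * (1 + l2norm Z)\<^sup>2"
      using C[OF s0 sA] nA unfolding dirac0_law by (simp add: l_def)
    have e4: "\<bar>l (\<lambda>_. 0) A\<bar> \<le> K * (1 + l2norm Z)"
      unfolding nA[symmetric]
    proof (rule l_bound[OF s0 sA K0])
      show "norm (D (law (\<lambda>_. 0)) 0) \<le> K" unfolding K_def dirac0_law ..
    qed
    have lin: "l Z (\<lambda>\<omega>. A \<omega> + B \<omega>) - l Z B = s * l Z \<Xi>"
      unfolding l_def using int[OF sAB] int[OF sB] int[OF \<Xi>]
      by (subst Bochner_Integration.integral_diff[symmetric])
        (auto simp: blinfun.add_right A_def blinfun.scaleR_right)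
    have "C * (l2norm (\<lambda>\<omega>. A \<omega> + B \<omega>))\<^sup>2 \<le> C * (2 * (1 + l2norm Z)\<^sup>2 + 2 * (l2norm Z)\<^sup>2)"
      using C0 nAB by (intro mult_left_mono) auto
    moreover have "C * (l2norm Z)\<^sup>2 \<le> C * (1 + l2norm Z)\<^sup>2"
      using C0 by (intro mult_left_mono power_mono) auto
    ultimately have "\<bar>s * l Z \<Xi>\<bar> \<le> K * (1 + l2norm Z) + 6 * (C * (1 + l2norm Z)\<^sup>2)"
      using e1 e2 e3 e4 unfolding lin[symmetric] distrib_left by linarith
    also have "\<dots> = s * (K * n + 6 * C * (1 + l2norm Z) * n)"
      using n0 by (simp add: s_def field_simps power2_eq_square)
    finally have "s * \<bar>l Z \<Xi>\<bar> \<le> s * (K * n + 6 * C * (1 + l2norm Z) * n)"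
      using s by (simp add: abs_mult)
    then show ?thesis using s by simp
  qed
  have "\<bar>h (law (\<lambda>\<omega>. Z \<omega> + \<Xi> \<omega>)) - h (law Z) - l Z \<Xi>\<bar> \<le> C * n\<^sup>2"
    using C[OF Z \<Xi>] by (simp add: l_def n_def)
  then have "\<bar>h (law (\<lambda>\<omega>. Z \<omega> + \<Xi> \<omega>)) - h (law Z)\<bar> \<le> (K + 6 * C * (1 + l2norm Z) + C * n) * n"
    using l_bd unfolding distrib_right power2_eq_square by linarith
  also have "\<dots> \<le> ((K + 6 * C) * (1 + l2norm Z + n)) * n"
  proof (rule mult_right_mono)
    have "0 \<le> K * l2norm Z" "0 \<le> K * n" "0 \<le> C * n" "0 \<le> C" using K0 C0 by (auto simp: n_def)
    then show "K + 6 * C * (1 + l2norm Z) + C * n \<le> (K + 6 * C) * (1 + l2norm Z + n)"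
      by (simp add: algebra_simps)
  qed (simp add: n_def)
  finally show ?thesis by (simp add: n_def K_def)
qed

lemma regular2_growth:
  fixes h :: "'x::euclidean_space measure \<Rightarrow> real"
  assumes R: "regular2 h H" and rep: "every_law TYPE('x)"
    and d1: "\<And>Z y. simple_function Omega Z \<Longrightarrow> norm (fd (L_deriv h (law Z)) y) \<le> \<Lambda>"
    and d2: "\<And>\<mu> x y. \<mu> \<in> P2 \<Longrightarrow> norm (mixed_deriv (H \<mu>) x y) \<le> \<Lambda>"
  shows "\<exists>K\<ge>0. \<forall>Z \<Xi>. simple_function Omega Z \<longrightarrow> simple_function Omega \<Xi> \<longrightarrow>
    \<bar>h (law (\<lambda>\<omega>. Z \<omega> + \<Xi> \<omega>)) - h (law Z)\<bar> \<le> K * (1 + l2norm Z + l2norm \<Xi>) * l2norm \<Xi>"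
proof -
  define D where "D \<mu> x = fd (lfd h \<mu>) x" for \<mu> x
  have D: "has_L_deriv_cont h D" unfolding D_def[abs_def] by (rule regular2_has_L_deriv_cont[OF R rep])
  have same: "fd (lfd h (law Z)) = L_deriv h (law Z)" if "simple_function Omega Z" for Z
    using L_deriv_cont_unique[OF D L_deriv_works[OF R rep] that] by (auto simp: D_def)
  have \<Lambda>0: "0 \<le> \<Lambda>" using d1[of "\<lambda>_. 0" 0] by (auto intro: order_trans[OF norm_ge_zero])
  have C: "\<bar>h (law (\<lambda>\<omega>. Z \<omega> + \<Xi> \<omega>)) - h (law Z) - (\<integral>\<omega>. D (law Z) (Z \<omega>) (\<Xi> \<omega>) \<partial>Omega)\<bar> \<le> (\<Lambda> + \<Lambda>) * (l2norm \<Xi>)\<^sup>2"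
    if Z: "simple_function Omega Z" and \<Xi>: "simple_function Omega \<Xi>" for Z \<Xi>
  proof -
    have "\<bar>id_blinfun (h (law (\<lambda>\<omega>. Z \<omega> + \<Xi> \<omega>))) - id_blinfun (h (law Z)) -
        (\<integral>\<omega>. id_blinfun (fd (lfd h (law Z)) (Z \<omega>) (\<Xi> \<omega>)) \<partial>Omega)\<bar>
      \<le> norm (id_blinfun :: real \<Rightarrow>\<^sub>L real) * (\<Lambda> + \<Lambda>) * (l2norm \<Xi>)\<^sup>2"
    proof (rule regular2_expansion[OF R rep])
      show "norm (fd (fd (lfd h (law Z))) y) \<le> \<Lambda>" for y using d1[OF Z] by (simp add: same[OF Z])
      show "norm (mixed_deriv (H (mix \<theta> (law (\<lambda>\<omega>. Z \<omega> + \<Xi> \<omega>)) (law Z))) x y) \<le> \<Lambda>"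
        if "0 \<le> \<theta>" "\<theta> \<le> 1" for \<theta> x y
        using that simple_perturb(1)[OF Z \<Xi>] Z by (intro d2 mix_P2 law_simple_P2)
    qed (use Z \<Xi> in auto)
    then show ?thesis by (simp add: D_def norm_blinfun_id)
  qed
  show ?thesis
  proof (intro exI conjI allI impI)
    show "0 \<le> norm (D dirac0 0) + 6 * (\<Lambda> + \<Lambda>)" using \<Lambda>0 by (intro add_nonneg_nonneg norm_ge_zero) simp
    fix Z \<Xi> :: "real \<Rightarrow> 'x"
    assume "simple_function Omega Z" "simple_function Omega \<Xi>"
    then show "\<bar>h (law (\<lambda>\<omega>. Z \<omega> + \<Xi> \<omega>)) - h (law Z)\<bar> \<le>
       (norm (D dirac0 0) + 6 * (\<Lambda> + \<Lambda>)) * (1 + l2norm Z + l2norm \<Xi>) * l2norm \<Xi>"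
      using \<Lambda>0 by (intro quadratic_growth[OF C]) linarith+
  qed
qed

section \<open>Growth of the coefficients\<close>

text \<open>The drift is Lipschitz in all its arguments; as regards the law, along finitely valued random
  vectors and with respect to the \<open>L\<^sup>2\<close> norm.\<close>

definition drift_bounds :: "real \<Rightarrow> ('x::euclidean_space \<Rightarrow> 'x measure \<Rightarrow> 'a::euclidean_space \<Rightarrow> 'x) \<Rightarrow> bool" where
  "drift_bounds C f \<longleftrightarrow> 0 \<le> C \<and>
     (\<forall>x x' a. \<forall>\<mu>\<in>P2. norm (f x' \<mu> a - f x \<mu> a) \<le> C * norm (x' - x)) \<and>
     (\<forall>x a a'. \<forall>\<mu>\<in>P2. norm (f x \<mu> a' - f x \<mu> a) \<le> C * norm (a' - a)) \<and>
     (\<forall>x a Z \<Xi>. simple_function Omega Z \<longrightarrow> simple_function Omega \<Xi> \<longrightarrow>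
        norm (f x (law (\<lambda>\<omega>. Z \<omega> + \<Xi> \<omega>)) a - f x (law Z) a) \<le> C * l2norm \<Xi>)"

lemma a1_drift_bounds:
  fixes f :: "'x::euclidean_space \<Rightarrow> 'x measure \<Rightarrow> 'a::euclidean_space \<Rightarrow> 'x"
  assumes f: "a1 f lam Lam lbar Lip" and rep: "every_law TYPE('x)"
  shows "drift_bounds Lam f"
  unfolding drift_bounds_def
proof (intro conjI allI ballI impI)
  have d: "diff_x f" "diff_a f" using f by (auto simp: a1_def twice_diff_def)
  have n: "norm_le (\<lambda>x \<mu> \<alpha> y z. d_a f x \<mu> \<alpha>) Lam" "norm_le (\<lambda>x \<mu> \<alpha> y z. d_mu f x \<mu> \<alpha> y) Lam"
     "norm_le (\<lambda>x \<mu> \<alpha> y z. d_x f x \<mu> \<alpha>) Lam" and pos: "0 < Lam"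
    using f by (auto simp: a1_def)
  obtain H where H: "\<And>x \<alpha>. regular2 (\<lambda>\<mu>. f x \<mu> \<alpha>) (H x \<alpha>)" using f unfolding a1_def by blast
  show "0 \<le> Lam" using pos by simp
  fix x x' :: 'x and a a' :: 'a
  {
    fix \<mu> :: "'x measure" assume \<mu>: "\<mu> \<in> P2"
    show "norm (f x' \<mu> a - f x \<mu> a) \<le> Lam * norm (x' - x)"
      using d(1) n(3) \<mu> by (intro fd_lipschitz) (auto simp: diff_x_def norm_le_def d_x_def)
    show "norm (f x \<mu> a' - f x \<mu> a) \<le> Lam * norm (a' - a)"
      using d(2) n(1) \<mu> by (intro fd_lipschitz) (auto simp: diff_a_def norm_le_def d_a_def)
  next
    fix Z \<Xi> :: "real \<Rightarrow> 'x"
    assume Z: "simple_function Omega Z" "simple_function Omega \<Xi>"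
    show "norm (f x (law (\<lambda>\<omega>. Z \<omega> + \<Xi> \<omega>)) a - f x (law Z) a) \<le> Lam * l2norm \<Xi>"
      using directional_lipschitz[OF L_deriv_cont_directional[OF L_deriv_works[OF H rep]] Z, of x a Lam]
        n(2) law_simple_P2 by (auto simp: norm_le_def d_mu_def)
  }
qed

text \<open>The running cost is locally Lipschitz in state and law with constants of linear growth, its increment
  over the control \<open>0\<close> is coercive, and it is continuous in control and state. Again only finitely
  valued random vectors are considered.\<close>

definition cost_bounds :: "real \<Rightarrow> real \<Rightarrow> ('x::euclidean_space \<Rightarrow> 'x measure \<Rightarrow> 'a::euclidean_space \<Rightarrow> real) \<Rightarrow> bool" where
  "cost_bounds lam C g \<longleftrightarrow> 0 \<le> C \<and> 0 < lam \<and>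
     (\<forall>x x' a Z. simple_function Omega Z \<longrightarrow>
        \<bar>g x' (law Z) a - g x (law Z) a\<bar> \<le> C * (1 + norm x + norm x' + l2norm Z + norm a) * norm (x' - x)) \<and>
     (\<forall>x a Z \<Xi>. simple_function Omega Z \<longrightarrow> simple_function Omega \<Xi> \<longrightarrow>
        \<bar>g x (law (\<lambda>\<omega>. Z \<omega> + \<Xi> \<omega>)) a - g x (law Z) a\<bar>
          \<le> C * (1 + norm x + l2norm Z + l2norm \<Xi> + norm a) * l2norm \<Xi>) \<and>
     (\<forall>x a Z. simple_function Omega Z \<longrightarrow>
        lam * (norm a)\<^sup>2 - C * (1 + norm x + l2norm Z) * norm a \<le> g x (law Z) a - g x (law Z) 0) \<and>
     (\<forall>x Z. simple_function Omega Z \<longrightarrow> continuous_on UNIV (g x (law Z))) \<and>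
     (\<forall>a Z. simple_function Omega Z \<longrightarrow> continuous_on UNIV (\<lambda>x. g x (law Z) a))"

lemma strongly_convex_lower_bound:
  fixes q :: "'a::real_normed_vector \<Rightarrow> real"
  assumes q: "\<And>a. q differentiable (at a)" "\<And>a. fd q differentiable (at a)"
    and lam: "\<And>a \<xi>. lam * (norm \<xi>)\<^sup>2 \<le> fd (fd q) a \<xi> \<xi>"
  shows "fd q 0 a + lam / 2 * (norm a)\<^sup>2 \<le> q a - q 0"
proof -
  have 1: "((\<lambda>t. q (t *\<^sub>R a)) has_real_derivative fd q (t *\<^sub>R a) a) (at t)" for t
  proof -
    have "((\<lambda>t. q (t *\<^sub>R a)) has_derivative (\<lambda>s. fd q (t *\<^sub>R a) (s *\<^sub>R a))) (at t)"
      by (rule has_derivative_compose[OF _ fd_has_derivative[OF q(1)]])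
        (auto intro!: derivative_eq_intros)
    then show ?thesis by (simp add: has_field_derivative_def blinfun.scaleR_right mult_commute_abs)
  qed
  have 2: "((\<lambda>t. fd q (t *\<^sub>R a) a) has_real_derivative fd (fd q) (t *\<^sub>R a) a a) (at t)" for t
  proof -
    have "((\<lambda>t. fd q (t *\<^sub>R a)) has_derivative (\<lambda>s. fd (fd q) (t *\<^sub>R a) (s *\<^sub>R a))) (at t)"
      by (rule has_derivative_compose[OF _ fd_has_derivative[OF q(2)]])
        (auto intro!: derivative_eq_intros)
    from bounded_linear.has_derivative[OF blinfun.bounded_linear_left this, of a]
    have "((\<lambda>t. fd q (t *\<^sub>R a) a) has_derivative (\<lambda>s. fd (fd q) (t *\<^sub>R a) (s *\<^sub>R a) a)) (at t)"
      .
    then show ?thesis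
      by (simp add: has_field_derivative_def blinfun.scaleR_right blinfun.scaleR_left mult_commute_abs)
  qed
  have mono: "fd q 0 a + lam * (norm a)\<^sup>2 * t \<le> fd q (t *\<^sub>R a) a" if "0 \<le> t" for t
  proof -
    have "fd q (0 *\<^sub>R a) a - lam * (norm a)\<^sup>2 * 0 \<le> fd q (t *\<^sub>R a) a - lam * (norm a)\<^sup>2 * t"
    proof (rule DERIV_nonneg_imp_nondecreasing[OF that])
      fix s
      have "((\<lambda>t. fd q (t *\<^sub>R a) a - lam * (norm a)\<^sup>2 * t) has_real_derivative (fd (fd q) (s *\<^sub>R a) a a - lam * (norm a)\<^sup>2)) (at s)"
        by (auto intro!: derivative_eq_intros 2)
      then show "\<exists>y. ((\<lambda>t. fd q (t *\<^sub>R a) a - lam * (norm a)\<^sup>2 * t) has_real_derivative y) (at s) \<and> 0 \<le> y"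
        using lam[of a "s *\<^sub>R a"] by (intro exI[of _ "fd (fd q) (s *\<^sub>R a) a a - lam * (norm a)\<^sup>2"]) auto
    qed
    then show ?thesis by simp
  qed
  have "q (0 *\<^sub>R a) - (fd q 0 a * 0 + lam / 2 * (norm a)\<^sup>2 * 0\<^sup>2) \<le> q (1 *\<^sub>R a) - (fd q 0 a * 1 + lam / 2 * (norm a)\<^sup>2 * 1\<^sup>2)"
  proof (rule DERIV_nonneg_imp_nondecreasing[of 0 1 "\<lambda>t. q (t *\<^sub>R a) - (fd q 0 a * t + lam / 2 * (norm a)\<^sup>2 * t\<^sup>2)"])
    fix s :: real assume s: "0 \<le> s"
    have "((\<lambda>t. q (t *\<^sub>R a) - (fd q 0 a * t + lam / 2 * (norm a)\<^sup>2 * t\<^sup>2)) has_real_derivative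
        (fd q (s *\<^sub>R a) a - (fd q 0 a + lam * (norm a)\<^sup>2 * s))) (at s)"
      by (auto intro!: derivative_eq_intros 1)
    then show "\<exists>y. ((\<lambda>t. q (t *\<^sub>R a) - (fd q 0 a * t + lam / 2 * (norm a)\<^sup>2 * t\<^sup>2)) has_real_derivative y) (at s) \<and> 0 \<le> y"
      using mono[OF s] by (intro exI[of _ "fd q (s *\<^sub>R a) a - (fd q 0 a + lam * (norm a)\<^sup>2 * s)"]) auto
  qed simp
  then show ?thesis by simp
qed

text \<open>The bounds on the second derivatives control mixed differences in any two of the three arguments;
  by telescoping, each bound is reduced to the case that the remaining arguments are \<open>0\<close> and the
  Dirac mass at \<open>0\<close>.\<close>

lemma a2_cost_bounds:
  fixes g :: "'x::euclidean_space \<Rightarrow> 'x measure \<Rightarrow> 'a::euclidean_space \<Rightarrow> real"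
  assumes g: "a2 g lam Lam lbar l" and rep: "every_law TYPE('x)"
  shows "\<exists>C. cost_bounds (lam / 2) C g"
proof -
  have pos: "0 < lam" "0 < Lam" "0 < lbar" and tw: "twice_diff g"
    and dmx: "\<And>y. diff_x (\<lambda>x \<mu> \<alpha>. d_mu g x \<mu> \<alpha> y)" and dma: "\<And>y. diff_a (\<lambda>x \<mu> \<alpha>. d_mu g x \<mu> \<alpha> y)"
    and conv: "\<And>x \<mu> \<alpha> \<xi>. \<mu> \<in> P2 \<Longrightarrow> lam * (norm \<xi>)\<^sup>2 \<le> d_a (d_a g) x \<mu> \<alpha> \<xi> \<xi>"
    and nmx: "\<And>y x \<mu> \<alpha>. \<mu> \<in> P2 \<Longrightarrow> norm (d_x (\<lambda>x' \<mu>' \<alpha>'. d_mu g x' \<mu>' \<alpha>' y) x \<mu> \<alpha>) \<le> Lam"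
    and nxx: "\<And>x \<mu> \<alpha>. \<mu> \<in> P2 \<Longrightarrow> norm (d_x (d_x g) x \<mu> \<alpha>) \<le> Lam"
    and nmy: "\<And>y x \<mu> \<alpha>. \<mu> \<in> P2 \<Longrightarrow> norm (fd (d_mu g x \<mu> \<alpha>) y) \<le> Lam"
    and nax: "\<And>x \<mu> \<alpha>. \<mu> \<in> P2 \<Longrightarrow> norm (d_x (d_a g) x \<mu> \<alpha>) \<le> lbar"
    and nma: "\<And>y x \<mu> \<alpha>. \<mu> \<in> P2 \<Longrightarrow> norm (d_a (\<lambda>x' \<mu>' \<alpha>'. d_mu g x' \<mu>' \<alpha>' y) x \<mu> \<alpha>) \<le> lbar"
    using g unfolding a2_def norm_le_def by auto
  obtain H where "\<forall>x \<alpha>. regular2 (\<lambda>\<mu>. g x \<mu> \<alpha>) (H x \<alpha>)"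
    and "norm_le (\<lambda>x \<mu> \<alpha> y z. mixed_deriv (H x \<alpha> \<mu>) y z) Lam"
    using g unfolding a2_def by (elim conjE exE)
  then have H: "\<And>x \<alpha>. regular2 (\<lambda>\<mu>. g x \<mu> \<alpha>) (H x \<alpha>)"
    and nH: "\<And>x \<alpha> \<mu> y z. \<mu> \<in> P2 \<Longrightarrow> norm (mixed_deriv (H x \<alpha> \<mu>) y z) \<le> Lam"
    by (auto simp: norm_le_def)
  define C1 where "C1 = Lam + lbar"
  have C1: "0 \<le> C1" "Lam \<le> C1" "lbar \<le> C1" using pos by (auto simp: C1_def)
  have dx: "(\<lambda>x. g x \<mu> a) differentiable (at x)" "fd (\<lambda>x. g x \<mu> a) differentiable (at x)"
    and da: "g x \<mu> differentiable (at a)" "fd (g x \<mu>) differentiable (at a)"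
    and dax: "(\<lambda>x. fd (g x \<mu>) a) differentiable (at x)" if "\<mu> \<in> P2" for x \<mu> a
    using tw that unfolding twice_diff_def diff_x_def diff_a_def d_x_def d_a_def by auto
  have xa: "\<bar>g x' \<mu> a' - g x \<mu> a' - (g x' \<mu> a - g x \<mu> a)\<bar> \<le> lbar * norm (x' - x) * norm (a' - a)"
    if "\<mu> \<in> P2" for x x' a a' \<mu>
    using mixed_difference[of "\<lambda>x. g x \<mu>" lbar x' a' x a] da(1)[OF that] dax[OF that] nax[OF that]
    by (simp add: d_x_def d_a_def)
  have dd: "directional_deriv (\<lambda>\<mu>. g x \<mu> a) (L_deriv (\<lambda>\<mu>. g x \<mu> a))" for x a
    by (rule L_deriv_cont_directional[OF L_deriv_works[OF H rep]])
  have xm: "\<bar>g x' (law (\<lambda>\<omega>. Z \<omega> + \<Xi> \<omega>)) a - g x (law (\<lambda>\<omega>. Z \<omega> + \<Xi> \<omega>)) a - (g x' (law Z) a - g x (law Z) a)\<bar>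
      \<le> Lam * norm (x' - x) * l2norm \<Xi>" if Z: "simple_function Omega Z" "simple_function Omega \<Xi>" for x x' a Z \<Xi>
  proof -
    have "norm (L_deriv (\<lambda>\<mu>. g x' \<mu> a) (law Z) y - L_deriv (\<lambda>\<mu>. g x \<mu> a) (law Z) y) \<le> Lam * norm (x' - x)"
      if "simple_function Omega Z" for Z y
      using fd_lipschitz[of "\<lambda>x. d_mu g x (law Z) a y" Lam x' x] dmx[of y] nmx[OF law_simple_P2[OF that]] law_simple_P2[OF that]
      by (simp add: diff_x_def d_x_def d_mu_def)
    from directional_lipschitz[OF directional_deriv_diff[OF dd dd] Z this] show ?thesis by simp
  qed
  have am: "\<bar>g x (law (\<lambda>\<omega>. Z \<omega> + \<Xi> \<omega>)) a' - g x (law (\<lambda>\<omega>. Z \<omega> + \<Xi> \<omega>)) a - (g x (law Z) a' - g x (law Z) a)\<bar>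
      \<le> lbar * norm (a' - a) * l2norm \<Xi>" if Z: "simple_function Omega Z" "simple_function Omega \<Xi>" for x a' a Z \<Xi>
  proof -
    have "norm (L_deriv (\<lambda>\<mu>. g x \<mu> a') (law Z) y - L_deriv (\<lambda>\<mu>. g x \<mu> a) (law Z) y) \<le> lbar * norm (a' - a)"
      if "simple_function Omega Z" for Z y
      using fd_lipschitz[of "\<lambda>a. d_mu g x (law Z) a y" lbar a' a] dma[of y] nma[OF law_simple_P2[OF that]] law_simple_P2[OF that]
      by (simp add: diff_a_def d_a_def d_mu_def)
    from directional_lipschitz[OF directional_deriv_diff[OF dd dd] Z this] show ?thesis by simp
  qed
  define \<mu>0 where "\<mu>0 = law (\<lambda>_. 0 :: 'x)"
  have s0: "simple_function Omega (\<lambda>_. 0 :: 'x)" by simp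
  have \<mu>0: "\<mu>0 \<in> P2" unfolding \<mu>0_def by (rule law_simple_P2[OF s0])
  obtain K where K: "0 \<le> K" "\<And>Z \<Xi>. simple_function Omega Z \<Longrightarrow> simple_function Omega \<Xi> \<Longrightarrow>
    \<bar>g 0 (law (\<lambda>\<omega>. Z \<omega> + \<Xi> \<omega>)) 0 - g 0 (law Z) 0\<bar> \<le> K * (1 + l2norm Z + l2norm \<Xi>) * l2norm \<Xi>"
  proof -
    have "norm (fd (L_deriv (\<lambda>\<mu>. g 0 \<mu> 0) (law Z)) y) \<le> Lam" if "simple_function Omega Z" for Z y
    proof -
      have "d_mu g 0 (law Z) 0 = L_deriv (\<lambda>\<mu>. g 0 \<mu> 0) (law Z)" by (rule ext) (simp add: d_mu_def)
      then show ?thesis using nmy[OF law_simple_P2[OF that], of 0 0 y] by simp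
    qed
    from regular2_growth[OF H rep this nH] that show ?thesis by blast
  qed
  define Kx where "Kx = norm (fd (\<lambda>x. g x \<mu>0 0) 0)"
  define Ka where "Ka = norm (fd (g 0 \<mu>0) 0)"
  define C where "C = 2 * C1 + K + Kx + Ka"
  have nn: "0 \<le> Kx" "0 \<le> Ka" by (auto simp: Kx_def Ka_def)
  then have C: "0 \<le> C" "2 * C1 \<le> C" "C1 + K \<le> C" "Kx \<le> C" "Ka + C1 \<le> C" "Kx + 2 * C1 \<le> C"
    using C1 K by (auto simp: C_def)
  have "\<bar>g x' (law Z) a - g x (law Z) a\<bar> \<le> C * (1 + norm x + norm x' + l2norm Z + norm a) * norm (x' - x)"
    if Z: "simple_function Omega Z" for x x' a Z
  proof -
    have 1: "\<bar>g x' (law Z) a - g x (law Z) a - (g x' (law Z) 0 - g x (law Z) 0)\<bar> \<le> (C1 * norm a) * norm (x' - x)"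
    proof -
      have "lbar * norm (x' - x) * norm a \<le> C1 * norm (x' - x) * norm a"
        by (intro mult_right_mono C1) auto
      then show ?thesis using xa[OF law_simple_P2[OF Z], of x' a x 0] by (simp add: mult_ac)
    qed
    have 2: "\<bar>g x' (law Z) 0 - g x (law Z) 0 - (g x' \<mu>0 0 - g x \<mu>0 0)\<bar> \<le> (C1 * l2norm Z) * norm (x' - x)"
    proof -
      have "Lam * norm (x' - x) * l2norm Z \<le> C1 * norm (x' - x) * l2norm Z"
        by (intro mult_right_mono C1) auto
      then show ?thesis using xm[OF s0 Z, of x' 0 x] by (simp add: mult_ac \<mu>0_def)
    qed
    have 3: "\<bar>g x' \<mu>0 0 - g x \<mu>0 0\<bar> \<le> (Kx + 2 * C1 * (norm x + norm x')) * norm (x' - x)"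
    proof -
      let ?F = "\<lambda>x. g x \<mu>0 0"
      have b: "norm (fd (fd ?F) y) \<le> Lam" for y using nxx[OF \<mu>0, of y 0] by (simp add: d_x_def)
      have "norm (?F (x + (x' - x)) - ?F x - fd ?F x (x' - x)) \<le> Lam * (norm (x' - x))\<^sup>2"
        by (rule fd_taylor[OF dx[OF \<mu>0] b])
      moreover have "\<bar>fd ?F x (x' - x)\<bar> \<le> norm (fd ?F x) * norm (x' - x)"
        using norm_blinfun[of "fd ?F x" "x' - x"] by simp
      moreover have "norm (fd ?F x) * norm (x' - x) \<le> (Kx + Lam * norm x) * norm (x' - x)"
      proof (rule mult_right_mono)
        show "norm (fd ?F x) \<le> Kx + Lam * norm x"
          using fd_lipschitz[OF dx(2)[OF \<mu>0] b, of x 0] norm_triangle_sub[of "fd ?F x" "fd ?F 0"] by (simp add: Kx_def)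
      qed simp
      moreover have "Lam * (norm (x' - x))\<^sup>2 \<le> (Lam * (norm x + norm x')) * norm (x' - x)"
        unfolding power2_eq_square mult.assoc[symmetric] using pos norm_triangle_ineq4[of x' x]
        by (intro mult_right_mono mult_left_mono) auto
      ultimately have "\<bar>?F x' - ?F x\<bar> \<le> (Kx + Lam * norm x + Lam * (norm x + norm x')) * norm (x' - x)"
        by (simp add: distrib_right)
      also have "\<dots> \<le> (Kx + 2 * C1 * (norm x + norm x')) * norm (x' - x)"
      proof (rule mult_right_mono)
        have "Lam * norm x \<le> C1 * (norm x + norm x')" "Lam * (norm x + norm x') \<le> C1 * (norm x + norm x')"
          using C1 pos by (auto intro!: mult_mono)
        then show "Kx + Lam * norm x + Lam * (norm x + norm x') \<le> Kx + 2 * C1 * (norm x + norm x')" by linarith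
      qed simp
      finally show ?thesis .
    qed
    have "\<bar>g x' (law Z) a - g x (law Z) a\<bar> \<le> (C1 * norm a + C1 * l2norm Z + (Kx + 2 * C1 * (norm x + norm x'))) * norm (x' - x)"
      using 1 2 3 unfolding distrib_right by linarith
    also have "\<dots> \<le> C * (1 + norm x + norm x' + l2norm Z + norm a) * norm (x' - x)"
    proof (rule mult_right_mono)
      have "C1 * norm a \<le> C * norm a" "C1 * l2norm Z \<le> C * l2norm Z" "2 * C1 * (norm x + norm x') \<le> C * (norm x + norm x')"
        using C C1 K nn by (auto intro!: mult_right_mono add_nonneg_nonneg simp: C_def)
      then show "C1 * norm a + C1 * l2norm Z + (Kx + 2 * C1 * (norm x + norm x')) \<le> C * (1 + norm x + norm x' + l2norm Z + norm a)"
        using C(4) by (simp add: distrib_left)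
    qed simp
    finally show ?thesis .
  qed
  moreover have "\<bar>g x (law (\<lambda>\<omega>. Z \<omega> + \<Xi> \<omega>)) a - g x (law Z) a\<bar>
          \<le> C * (1 + norm x + l2norm Z + l2norm \<Xi> + norm a) * l2norm \<Xi>"
    if Z: "simple_function Omega Z" "simple_function Omega \<Xi>" for x a Z \<Xi>
  proof -
    have 1: "\<bar>g x (law (\<lambda>\<omega>. Z \<omega> + \<Xi> \<omega>)) a - g x (law Z) a - (g x (law (\<lambda>\<omega>. Z \<omega> + \<Xi> \<omega>)) 0 - g x (law Z) 0)\<bar>
        \<le> (C1 * norm a) * l2norm \<Xi>"
    proof -
      have "lbar * norm a * l2norm \<Xi> \<le> C1 * norm a * l2norm \<Xi>" by (intro mult_right_mono C1) auto
      then show ?thesis using am[OF Z, of x a 0] unfolding diff_zero by linarith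
    qed
    have 2: "\<bar>g x (law (\<lambda>\<omega>. Z \<omega> + \<Xi> \<omega>)) 0 - g x (law Z) 0 - (g 0 (law (\<lambda>\<omega>. Z \<omega> + \<Xi> \<omega>)) 0 - g 0 (law Z) 0)\<bar>
        \<le> (C1 * norm x) * l2norm \<Xi>"
    proof -
      have "Lam * norm x * l2norm \<Xi> \<le> C1 * norm x * l2norm \<Xi>" by (intro mult_right_mono C1) auto
      then show ?thesis using xm[OF Z, of x 0 0] unfolding diff_zero by linarith
    qed
    have 3: "\<bar>g 0 (law (\<lambda>\<omega>. Z \<omega> + \<Xi> \<omega>)) 0 - g 0 (law Z) 0\<bar> \<le> (K * (1 + l2norm Z + l2norm \<Xi>)) * l2norm \<Xi>"
      using K(2)[OF Z] .
    have "\<bar>g x (law (\<lambda>\<omega>. Z \<omega> + \<Xi> \<omega>)) a - g x (law Z) a\<bar>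
        \<le> (C1 * norm a + C1 * norm x + K * (1 + l2norm Z + l2norm \<Xi>)) * l2norm \<Xi>"
      using 1 2 3 unfolding distrib_right by linarith
    also have "\<dots> \<le> C * (1 + norm x + l2norm Z + l2norm \<Xi> + norm a) * l2norm \<Xi>"
    proof (rule mult_right_mono)
      have "C1 * norm a \<le> C * norm a" "C1 * norm x \<le> C * norm x"
          "K * (1 + l2norm Z + l2norm \<Xi>) \<le> C * (1 + l2norm Z + l2norm \<Xi>)"
        using C C1 K nn by (auto intro!: mult_right_mono add_nonneg_nonneg simp: C_def)
      then show "C1 * norm a + C1 * norm x + K * (1 + l2norm Z + l2norm \<Xi>) \<le> C * (1 + norm x + l2norm Z + l2norm \<Xi> + norm a)"
        by (simp add: distrib_left)
    qed simp
    finally show ?thesis .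
  qed
  moreover have "lam / 2 * (norm a)\<^sup>2 - C * (1 + norm x + l2norm Z) * norm a \<le> g x (law Z) a - g x (law Z) 0"
    if Z: "simple_function Omega Z" for x a Z
  proof -
    have 1: "\<bar>g x (law Z) a - g x (law Z) 0 - (g x \<mu>0 a - g x \<mu>0 0)\<bar> \<le> (C1 * l2norm Z) * norm a"
    proof -
      have "lbar * norm a * l2norm Z \<le> C1 * norm a * l2norm Z" by (intro mult_right_mono C1) auto
      then show ?thesis using am[OF s0 Z, of x a 0] by (simp add: mult_ac \<mu>0_def)
    qed
    have 2: "\<bar>g x \<mu>0 a - g 0 \<mu>0 a - (g x \<mu>0 0 - g 0 \<mu>0 0)\<bar> \<le> (C1 * norm x) * norm a"
    proof -
      have "lbar * norm x * norm a \<le> C1 * norm x * norm a" by (intro mult_right_mono C1) auto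
      then show ?thesis using xa[OF \<mu>0, of x a 0 0] by simp
    qed
    have 3: "fd (g 0 \<mu>0) 0 a + lam / 2 * (norm a)\<^sup>2 \<le> g 0 \<mu>0 a - g 0 \<mu>0 0"
      using conv[OF \<mu>0, of _ 0] by (intro strongly_convex_lower_bound da \<mu>0) (simp add: d_a_def)
    have 4: "\<bar>fd (g 0 \<mu>0) 0 a\<bar> \<le> Ka * norm a"
      using norm_blinfun[of "fd (g 0 \<mu>0) 0" a] by (simp add: Ka_def)
    have "(Ka + C1 * norm x + C1 * l2norm Z) * norm a \<le> C * (1 + norm x + l2norm Z) * norm a"
    proof (rule mult_right_mono)
      have "C1 * l2norm Z \<le> C * l2norm Z" "C1 * norm x \<le> C * norm x" "Ka \<le> C"
        using C C1 K nn by (auto intro!: mult_right_mono simp: C_def)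
      then show "Ka + C1 * norm x + C1 * l2norm Z \<le> C * (1 + norm x + l2norm Z)" by (simp add: distrib_left)
    qed simp
    then show ?thesis using 1 2 3 4 unfolding distrib_right by linarith
  qed
  moreover have "continuous_on UNIV (g x (law Z))" "continuous_on UNIV (\<lambda>x. g x (law Z) a)"
    if "simple_function Omega Z" for x a Z
    using da(1)[OF law_simple_P2[OF that]] dx(1)[OF law_simple_P2[OF that]]
    by (auto intro!: differentiable_imp_continuous_on simp: differentiable_on_def)
  ultimately have "cost_bounds (lam / 2) C g" unfolding cost_bounds_def using C(1) pos by simp
  then show ?thesis by blast
qed

lemma drift_boundsD:
  assumes "drift_bounds C f"
  shows "0 \<le> C" "\<mu> \<in> P2 \<Longrightarrow> norm (f x' \<mu> a - f x \<mu> a) \<le> C * norm (x' - x)"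
    "\<mu> \<in> P2 \<Longrightarrow> norm (f x \<mu> a' - f x \<mu> a) \<le> C * norm (a' - a)"
    "simple_function Omega Z \<Longrightarrow> simple_function Omega \<Xi> \<Longrightarrow>
       norm (f x (law (\<lambda>\<omega>. Z \<omega> + \<Xi> \<omega>)) a - f x (law Z) a) \<le> C * l2norm \<Xi>"
  using assms unfolding drift_bounds_def by simp_all

lemma cost_boundsD:
  assumes "cost_bounds lam C g"
  shows "0 \<le> C" "0 < lam"
    "simple_function Omega Z \<Longrightarrow>
       \<bar>g x' (law Z) a - g x (law Z) a\<bar> \<le> C * (1 + norm x + norm x' + l2norm Z + norm a) * norm (x' - x)"
    "simple_function Omega Z \<Longrightarrow> simple_function Omega \<Xi> \<Longrightarrow>
       \<bar>g x (law (\<lambda>\<omega>. Z \<omega> + \<Xi> \<omega>)) a - g x (law Z) a\<bar>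
         \<le> C * (1 + norm x + l2norm Z + l2norm \<Xi> + norm a) * l2norm \<Xi>"
    "simple_function Omega Z \<Longrightarrow>
       lam * (norm a)\<^sup>2 - C * (1 + norm x + l2norm Z) * norm a \<le> g x (law Z) a - g x (law Z) 0"
    "simple_function Omega Z \<Longrightarrow> continuous_on UNIV (g x (law Z))"
    "simple_function Omega Z \<Longrightarrow> continuous_on UNIV (\<lambda>x. g x (law Z) a)"
  using assms unfolding cost_bounds_def by simp_all

section \<open>The Hamiltonian\<close>

lemma lipschitz_continuous:
  fixes F :: "'b::real_normed_vector \<Rightarrow> 'c::real_normed_vector"
  assumes "0 \<le> C" "\<And>x y. norm (F y - F x) \<le> C * norm (y - x)"
  shows "continuous_on UNIV F"
  using assms by (intro lipschitz_on_continuous_on[of C] lipschitz_onI) (auto simp: dist_norm)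

lemma drift_continuous:
  assumes "drift_bounds C f" "\<mu> \<in> P2"
  shows "continuous_on UNIV (f x \<mu>)" "continuous_on UNIV (\<lambda>x. f x \<mu> a)"
  by (rule lipschitz_continuous[OF drift_boundsD(1)[OF assms(1)]], rule drift_boundsD(3)[OF assms])
    (rule lipschitz_continuous[OF drift_boundsD(1)[OF assms(1)]], rule drift_boundsD(2)[OF assms])

text \<open>The function \<open>f \<bullet> z + g\<close> of the control is continuous and coercive, whatever \<open>z\<close> is.\<close>

lemma minimizer_exists:
  fixes f :: "'x::euclidean_space \<Rightarrow> 'x measure \<Rightarrow> 'a::euclidean_space \<Rightarrow> 'x"
  assumes f: "drift_bounds \<Lambda> f" and g: "cost_bounds lam C g" and Z: "simple_function Omega Z"
  shows "\<exists>a. (\<forall>b. f x (law Z) a \<bullet> z + g x (law Z) a \<le> f x (law Z) b \<bullet> z + g x (law Z) b) \<and>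
    norm a \<le> (C * (1 + norm x + l2norm Z) + \<Lambda> * norm z) / lam"
proof -
  define q where "q a = f x (law Z) a \<bullet> z + g x (law Z) a" for a
  define N where "N = C * (1 + norm x + l2norm Z) + \<Lambda> * norm z"
  have pos: "0 < lam" "0 \<le> C" "0 \<le> \<Lambda>" using f g by (auto simp: drift_bounds_def cost_bounds_def)
  have N: "0 \<le> N" unfolding N_def using pos by (intro add_nonneg_nonneg mult_nonneg_nonneg) auto
  have P: "law Z \<in> P2" by (rule law_simple_P2[OF Z])
  have qc: "continuous_on UNIV q"
    unfolding q_def using drift_continuous[OF f P] g Z
    by (auto intro!: continuous_intros simp: cost_bounds_def)
  have grow: "norm a * (lam * norm a - N) \<le> q a - q 0" for a
  proof -
    have "\<bar>(f x (law Z) a - f x (law Z) 0) \<bullet> z\<bar> \<le> norm (f x (law Z) a - f x (law Z) 0) * norm z"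
      by (rule Cauchy_Schwarz_ineq2)
    also have "\<dots> \<le> (\<Lambda> * norm (a - 0)) * norm z"
      by (intro mult_right_mono drift_boundsD(3)[OF f P]) simp
    finally have 1: "\<bar>(f x (law Z) a - f x (law Z) 0) \<bullet> z\<bar> \<le> \<Lambda> * norm z * norm a" by (simp add: mult_ac)
    have 2: "lam * (norm a)\<^sup>2 - C * (1 + norm x + l2norm Z) * norm a \<le> g x (law Z) a - g x (law Z) 0"
      by (rule cost_boundsD(5)[OF g Z])
    have "norm a * (lam * norm a - N) = lam * (norm a)\<^sup>2 - C * (1 + norm x + l2norm Z) * norm a - \<Lambda> * norm z * norm a"
      by (simp add: N_def algebra_simps power2_eq_square)
    then show ?thesis using 1 2 unfolding q_def inner_diff_left by linarith
  qed
  have Nl: "0 \<le> N / lam" using N pos by (intro divide_nonneg_pos) auto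
  then have ne: "cball (0 :: 'a) (N / lam) \<noteq> {}" by simp
  obtain a where a: "a \<in> cball 0 (N / lam)" "\<And>b. b \<in> cball 0 (N / lam) \<Longrightarrow> q a \<le> q b"
    using continuous_attains_inf[OF compact_cball ne continuous_on_subset[OF qc subset_UNIV]] by blast
  have "q a \<le> q b" for b
  proof (cases "b \<in> cball 0 (N / lam)")
    case False
    then have "N \<le> lam * norm b" using pos by (simp add: field_simps not_le)
    then have "0 \<le> norm b * (lam * norm b - N)" by simp
    moreover have "q a \<le> q 0" using Nl by (intro a(2)) simp
    ultimately show ?thesis using grow[of b] by linarith
  qed (rule a(2))
  then show ?thesis using a(1) unfolding q_def N_def by (intro exI[of _ a]) auto
qed

lemma hamiltonian_eq:
  assumes "\<And>b. f x \<mu> a \<bullet> z + g x \<mu> a \<le> f x \<mu> b \<bullet> z + g x \<mu> b"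
  shows "hamiltonian f g x \<mu> z = f x \<mu> a \<bullet> z + g x \<mu> a"
  unfolding hamiltonian_def by (rule Least_equality) (use assms in auto)

text \<open>A strict upper bound of the minimum over all controls is attained on a countable dense set.\<close>

lemma hamiltonian_measurable:
  fixes f :: "'x::euclidean_space \<Rightarrow> 'x measure \<Rightarrow> 'a::euclidean_space \<Rightarrow> 'x"
  assumes f: "drift_bounds \<Lambda> f" and g: "cost_bounds lam C g" and Z: "simple_function Omega Z"
    and p: "continuous_on UNIV p"
  shows "(\<lambda>x. hamiltonian f g x (law Z) (p x)) \<in> borel_measurable borel"
  unfolding borel_measurable_iff_less
proof
  fix c :: real
  have P: "law Z \<in> P2" by (rule law_simple_P2[OF Z])
  define q where "q x a = f x (law Z) a \<bullet> p x + g x (law Z) a" for x a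
  have qa: "continuous_on UNIV (q x)" and qx: "continuous_on UNIV (\<lambda>x. q x a)" for x a
    unfolding q_def using drift_continuous[OF f P] g Z p
    by (auto intro!: continuous_intros simp: cost_bounds_def)
  obtain B :: "'a set" where B: "countable B" "\<And>X. open X \<Longrightarrow> X \<noteq> {} \<Longrightarrow> \<exists>b\<in>B. b \<in> X"
    using countable_dense_exists by blast
  have "{x \<in> space borel. hamiltonian f g x (law Z) (p x) < c} = (\<Union>b\<in>B. {x. q x b < c})"
  proof (intro set_eqI iffI)
    fix x assume "x \<in> {x \<in> space borel. hamiltonian f g x (law Z) (p x) < c}"
    moreover obtain a where "\<And>b. f x (law Z) a \<bullet> p x + g x (law Z) a \<le> f x (law Z) b \<bullet> p x + g x (law Z) b"
      using minimizer_exists[OF f g Z, of x "p x"] by blast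
    ultimately have "q x a < c" unfolding q_def using hamiltonian_eq[of f x "law Z" a "p x" g] by simp
    then have "{b. q x b < c} \<noteq> {}" by auto
    moreover have "open {b. q x b < c}" by (intro open_Collect_less qa continuous_on_const)
    ultimately show "x \<in> (\<Union>b\<in>B. {x. q x b < c})" using B(2) by blast
  next
    fix x assume "x \<in> (\<Union>b\<in>B. {x. q x b < c})"
    then obtain b where b: "q x b < c" by auto
    obtain a where a: "\<And>b. f x (law Z) a \<bullet> p x + g x (law Z) a \<le> f x (law Z) b \<bullet> p x + g x (law Z) b"
      using minimizer_exists[OF f g Z, of x "p x"] by blast
    then have "hamiltonian f g x (law Z) (p x) \<le> q x b"
      unfolding q_def using hamiltonian_eq[of f x "law Z" a "p x" g] by simp
    then show "x \<in> {x \<in> space borel. hamiltonian f g x (law Z) (p x) < c}" using b by simp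
  qed
  also have "\<dots> \<in> sets borel"
  proof (rule sets.countable_UN''[OF B(1)])
    show "{x. q x b < c} \<in> sets borel" for b
      by (intro borel_open open_Collect_less qx continuous_on_const)
  qed
  finally show "{x \<in> space borel. hamiltonian f g x (law Z) (p x) < c} \<in> sets borel" .
qed

section \<open>Restriction to laws with finitely many atoms\<close>

text \<open>A finitely valued label \<open>L\<close> all of whose values have positive probability. A configuration \<open>x\<close> of
  points indexed by the labels has the law of \<open>x \<circ> L\<close>, and the norms of \<open>x \<circ> L\<close> in \<open>L\<^sup>2\<close> and of \<open>x\<close> as a
  weighted configuration agree.\<close>

locale labels =
  fixes L :: "real \<Rightarrow> 'i"
  assumes simple_L: "simple_function Omega L" and pos_L: "\<And>\<omega>. 0 < measure Omega {\<omega>'. L \<omega>' = L \<omega>}"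
begin

text \<open>The weight of a label.\<close>

definition wt :: "'i \<Rightarrow> real" where "wt i = measure Omega {\<omega>. L \<omega> = i}"

lemma integral_label:
  fixes \<phi> :: "'i \<Rightarrow> 'b::{banach, second_countable_topology}"
  shows "(\<integral>\<omega>. \<phi> (L \<omega>) \<partial>Omega) = (\<Sum>i\<in>range L. wt i *\<^sub>R \<phi> i)"
  unfolding wt_def by (rule integral_simple(2)[OF simple_L])

sublocale weighted "range L" wt
proof
  show "finite (range L)" using simple_L by (simp add: simple_Omega_iff)
  show "0 < wt i" if "i \<in> range L" for i using that pos_L by (auto simp: wt_def)
  show "sum wt (range L) = 1" using integral_label[of "\<lambda>_. 1 :: real"] Om.prob_space by simp
qed

text \<open>The law \<open>\<Sum>\<^sub>i w\<^sub>i \<delta>\<^sub>x\<^sub>i\<close> of a configuration. Points may coincide.\<close>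

definition law_of :: "('i \<Rightarrow> 'x::euclidean_space) \<Rightarrow> 'x measure" where
  "law_of x = law (\<lambda>\<omega>. x (L \<omega>))"

lemma simple_x [simp]: "simple_function Omega (\<lambda>\<omega>. x (L \<omega>))"
  by (rule simple_comp[OF simple_L])

lemma l2norm_label: "l2norm (\<lambda>\<omega>. x (L \<omega>)) = nrm x"
proof (rule power2_eq_imp_eq)
  show "(l2norm (\<lambda>\<omega>. x (L \<omega>)))\<^sup>2 = (nrm x)\<^sup>2"
    unfolding l2norm_power2 nrm_power2 integral_label[of "\<lambda>i. (norm (x i))\<^sup>2"] by simp
qed simp_all

lemma law_of_P2: "law_of x \<in> P2"
  unfolding law_of_def by (rule law_simple_P2) simp

lemma wasserstein_law_of: "wasserstein 2 (law_of x') (law_of x) \<le> nrm (\<lambda>i. x' i - x i)"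
  using wasserstein_le[of "\<lambda>\<omega>. x' (L \<omega>)" "\<lambda>\<omega>. x (L \<omega>)"] l2norm_label[of "\<lambda>i. x' i - x i"]
  by (simp add: law_of_def)

lemma nrm_affine:
  fixes y :: "'i \<Rightarrow> 'v::real_normed_vector" and u :: "'i \<Rightarrow> 'w::real_normed_vector"
    and v :: "'i \<Rightarrow> 'u::real_normed_vector"
  assumes "\<And>i. norm (y i) \<le> \<alpha> + \<beta> * norm (u i) + \<gamma> * norm (v i)" "0 \<le> \<alpha>" "0 \<le> \<beta>" "0 \<le> \<gamma>"
  shows "nrm y \<le> \<alpha> + \<beta> * nrm u + \<gamma> * nrm v"
proof -
  have "nrm y \<le> nrm (\<lambda>i. (\<alpha> + \<beta> *\<^sub>R norm (u i)) + \<gamma> *\<^sub>R norm (v i))"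
    using assms by (intro nrm_mono) simp
  also have "\<dots> \<le> nrm (\<lambda>i. \<alpha> + \<beta> *\<^sub>R norm (u i)) + nrm (\<lambda>i. \<gamma> *\<^sub>R norm (v i))" by (rule nrm_triangle)
  also have "nrm (\<lambda>i. \<alpha> + \<beta> *\<^sub>R norm (u i)) \<le> nrm (\<lambda>_. \<alpha>) + nrm (\<lambda>i. \<beta> *\<^sub>R norm (u i))" by (rule nrm_triangle)
  finally show ?thesis
    using nrm_cong[of "\<lambda>i. norm (u i)" u] nrm_cong[of "\<lambda>i. norm (v i)" v] assms
    unfolding nrm_scale nrm_const by simp
qed

lemma weighted_sum_le:
  fixes \<alpha> \<beta> :: "'i \<Rightarrow> real"
  shows "(\<Sum>i\<in>range L. wt i * (\<alpha> i * \<beta> i)) \<le> nrm \<alpha> * nrm \<beta>"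
  using ip_le[of \<alpha> \<beta>] by (simp add: ip_def)

text \<open>Drift and running cost of a configuration whose points are controlled separately.\<close>

definition Fl :: "('x::euclidean_space \<Rightarrow> 'x measure \<Rightarrow> 'a \<Rightarrow> 'x) \<Rightarrow> ('i \<Rightarrow> 'x) \<Rightarrow> ('i \<Rightarrow> 'a) \<Rightarrow> 'i \<Rightarrow> 'x" where
  "Fl f x b i = f (x i) (law_of x) (b i)"

definition Gl :: "('x::euclidean_space \<Rightarrow> 'x measure \<Rightarrow> 'a \<Rightarrow> real) \<Rightarrow> ('i \<Rightarrow> 'x) \<Rightarrow> ('i \<Rightarrow> 'a) \<Rightarrow> real" where
  "Gl g x b = (\<Sum>i\<in>range L. wt i * g (x i) (law_of x) (b i))"

lemma Fl_lipschitz: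
  fixes f :: "'x::euclidean_space \<Rightarrow> 'x measure \<Rightarrow> 'a::euclidean_space \<Rightarrow> 'x"
  assumes f: "drift_bounds \<Lambda> f"
  shows "\<bar>ip q (\<lambda>i. Fl f (\<lambda>i. x i + \<xi> i) b i - Fl f x b i)\<bar> \<le> 2 * \<Lambda> * nrm \<xi> * nrm q"
proof -
  have L0: "0 \<le> \<Lambda>" using f by (simp add: drift_bounds_def)
  have "norm (Fl f (\<lambda>i. x i + \<xi> i) b i - Fl f x b i) \<le> \<Lambda> * nrm \<xi> + \<Lambda> * norm (\<xi> i) + 0 * norm (\<xi> i)" for i
  proof -
    have "norm (f (x i + \<xi> i) (law_of (\<lambda>i. x i + \<xi> i)) (b i) - f (x i) (law_of (\<lambda>i. x i + \<xi> i)) (b i)) \<le> \<Lambda> * norm (x i + \<xi> i - x i)"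
      by (rule drift_boundsD(2)[OF f law_of_P2])
    moreover have "norm (f (x i) (law_of (\<lambda>i. x i + \<xi> i)) (b i) - f (x i) (law_of x) (b i)) \<le> \<Lambda> * nrm \<xi>"
      unfolding law_of_def l2norm_label[symmetric] by (rule drift_boundsD(4)[OF f simple_x simple_x])
    ultimately show ?thesis unfolding Fl_def
      using norm_triangle_ineq[of "f (x i + \<xi> i) (law_of (\<lambda>i. x i + \<xi> i)) (b i) - f (x i) (law_of (\<lambda>i. x i + \<xi> i)) (b i)"
        "f (x i) (law_of (\<lambda>i. x i + \<xi> i)) (b i) - f (x i) (law_of x) (b i)"] by simp
  qed
  from nrm_affine[where y = "\<lambda>i. Fl f (\<lambda>i. x i + \<xi> i) b i - Fl f x b i" and u = \<xi> and v = \<xi>, OF this] L0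
  have "nrm (\<lambda>i. Fl f (\<lambda>i. x i + \<xi> i) b i - Fl f x b i) \<le> 2 * \<Lambda> * nrm \<xi>" by simp
  from mult_left_mono[OF this nrm_nonneg[of q]] show ?thesis
    using ip_le[of q "\<lambda>i. Fl f (\<lambda>i. x i + \<xi> i) b i - Fl f x b i"] by (simp add: mult_ac)
qed

lemma Fl_growth:
  fixes f :: "'x::euclidean_space \<Rightarrow> 'x measure \<Rightarrow> 'a::euclidean_space \<Rightarrow> 'x"
  assumes f: "drift_bounds \<Lambda> f"
  shows "nrm (Fl f x b) \<le> norm (f 0 (law (\<lambda>_. 0)) 0) + 2 * \<Lambda> * nrm x + \<Lambda> * nrm b"
proof -
  have L0: "0 \<le> \<Lambda>" using f by (simp add: drift_bounds_def)
  define \<mu>0 where "\<mu>0 = law (\<lambda>_. 0 :: 'x)"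
  have s0: "simple_function Omega (\<lambda>_. 0 :: 'x)" by simp
  have \<mu>0: "\<mu>0 \<in> P2" unfolding \<mu>0_def by (rule law_simple_P2[OF s0])
  have "norm (Fl f x b i) \<le> (norm (f 0 \<mu>0 0) + \<Lambda> * nrm x) + \<Lambda> * norm (x i) + \<Lambda> * norm (b i)" for i
  proof -
    have 1: "norm (f (x i) \<mu>0 0 - f 0 \<mu>0 0) \<le> \<Lambda> * norm (x i - 0)"
      by (rule drift_boundsD(2)[OF f \<mu>0])
    have 2: "norm (f (x i) (law_of x) 0 - f (x i) \<mu>0 0) \<le> \<Lambda> * nrm x"
    proof -
      have "norm (f (x i) (law (\<lambda>\<omega>. 0 + x (L \<omega>))) 0 - f (x i) (law (\<lambda>_. 0)) 0) \<le> \<Lambda> * l2norm (\<lambda>\<omega>. x (L \<omega>))"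
        by (rule drift_boundsD(4)[OF f s0 simple_x])
      then show ?thesis by (simp add: law_of_def \<mu>0_def l2norm_label)
    qed
    have 3: "norm (f (x i) (law_of x) (b i) - f (x i) (law_of x) 0) \<le> \<Lambda> * norm (b i - 0)"
      by (rule drift_boundsD(3)[OF f law_of_P2])
    have "Fl f x b i = f 0 \<mu>0 0 + (f (x i) \<mu>0 0 - f 0 \<mu>0 0) + (f (x i) (law_of x) 0 - f (x i) \<mu>0 0)
        + (f (x i) (law_of x) (b i) - f (x i) (law_of x) 0)" by (simp add: Fl_def)
    also have "norm \<dots> \<le> norm (f 0 \<mu>0 0) + \<Lambda> * norm (x i - 0) + \<Lambda> * nrm x + \<Lambda> * norm (b i - 0)"
      using 1 2 3 by (intro norm_triangle_le add_mono) auto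
    finally show ?thesis by (simp add: algebra_simps)
  qed
  from nrm_affine[where y = "Fl f x b" and u = x and v = b, OF this] L0
  have "nrm (Fl f x b) \<le> (norm (f 0 \<mu>0 0) + \<Lambda> * nrm x) + \<Lambda> * nrm x + \<Lambda> * nrm b" by simp
  then show ?thesis unfolding \<mu>0_def by linarith
qed

lemma Gl_growth:
  fixes g :: "'x::euclidean_space \<Rightarrow> 'x measure \<Rightarrow> 'a::euclidean_space \<Rightarrow> real"
  assumes g: "cost_bounds lam C g" and \<xi>: "nrm \<xi> \<le> 1"
  shows "Gl g (\<lambda>i. x i + \<xi> i) b - Gl g x b \<le> C * (6 + 5 * nrm x + 2 * nrm b) * nrm \<xi>"
proof -
  have C: "0 \<le> C" using g by (simp add: cost_bounds_def)
  define \<mu> \<mu>' where "\<mu> = law_of x" and "\<mu>' = law_of (\<lambda>i. x i + \<xi> i)"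
  define \<alpha> where "\<alpha> i = 1 + norm (x i) + norm (x i + \<xi> i) + nrm (\<lambda>i. x i + \<xi> i) + norm (b i)" for i
  define \<beta> where "\<beta> i = 1 + norm (x i) + nrm x + nrm \<xi> + norm (b i)" for i
  have pt: "g (x i + \<xi> i) \<mu>' (b i) - g (x i) \<mu> (b i) \<le> C * (\<alpha> i * norm (\<xi> i)) + C * nrm \<xi> * (\<beta> i * 1)" for i
  proof -
    have "\<bar>g (x i + \<xi> i) \<mu>' (b i) - g (x i) \<mu>' (b i)\<bar> \<le> C * (1 + norm (x i) + norm (x i + \<xi> i) + l2norm (\<lambda>\<omega>. x (L \<omega>) + \<xi> (L \<omega>)) + norm (b i)) * norm (x i + \<xi> i - x i)"
      unfolding \<mu>'_def law_of_def by (rule cost_boundsD(3)[OF g simple_x[of "\<lambda>i. x i + \<xi> i"]])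
    moreover have "\<bar>g (x i) \<mu>' (b i) - g (x i) \<mu> (b i)\<bar> \<le> C * (1 + norm (x i) + l2norm (\<lambda>\<omega>. x (L \<omega>)) + l2norm (\<lambda>\<omega>. \<xi> (L \<omega>)) + norm (b i)) * l2norm (\<lambda>\<omega>. \<xi> (L \<omega>))"
      unfolding \<mu>'_def \<mu>_def law_of_def by (rule cost_boundsD(4)[OF g simple_x simple_x])
    ultimately show ?thesis
      unfolding l2norm_label l2norm_label[of "\<lambda>i. x i + \<xi> i"] \<alpha>_def \<beta>_def by (simp add: mult_ac)
  qed
  have n: "nrm (\<lambda>i. x i + \<xi> i) \<le> nrm x + 1" using nrm_triangle[of x \<xi>] \<xi> by linarith
  have "nrm \<alpha> \<le> (3 + nrm x + nrm \<xi>) + 2 * nrm x + 1 * nrm b"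
  proof -
    have b: "norm (\<alpha>' i) \<le> (2 + nrm x) + 2 * norm (x i) + 1 * norm (b i)"
      if "\<alpha>' = (\<lambda>i. 1 + 2 * norm (x i) + nrm (\<lambda>i. x i + \<xi> i) + norm (b i))" for \<alpha>' :: "'i \<Rightarrow> real" and i
      using n that by (simp add: add_nonneg_nonneg)
    have "nrm \<alpha> \<le> nrm (\<lambda>i. (1 + 2 * norm (x i) + nrm (\<lambda>i. x i + \<xi> i) + norm (b i)) + norm (\<xi> i))"
    proof (rule nrm_mono)
      fix i
      have "0 \<le> nrm (\<lambda>i. x i + \<xi> i)" by simp
      then show "norm (\<alpha> i) \<le> norm ((1 + 2 * norm (x i) + nrm (\<lambda>i. x i + \<xi> i) + norm (b i)) + norm (\<xi> i))"
        using norm_triangle_ineq[of "x i" "\<xi> i"] norm_ge_zero[of "x i"] norm_ge_zero[of "x i + \<xi> i"]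
          norm_ge_zero[of "b i"] norm_ge_zero[of "\<xi> i"] unfolding \<alpha>_def real_norm_def by linarith
    qed
    also have "\<dots> \<le> nrm (\<lambda>i. 1 + 2 * norm (x i) + nrm (\<lambda>i. x i + \<xi> i) + norm (b i)) + nrm (\<lambda>i. norm (\<xi> i))"
      by (rule nrm_triangle)
    also have "nrm (\<lambda>i. norm (\<xi> i)) = nrm \<xi>" by (rule nrm_cong) simp
    also have "nrm (\<lambda>i. 1 + 2 * norm (x i) + nrm (\<lambda>i. x i + \<xi> i) + norm (b i)) \<le> (2 + nrm x) + 2 * nrm x + 1 * nrm b"
      by (rule nrm_affine[where u = x and v = b, OF b[OF refl]]) (simp_all add: add_nonneg_nonneg)
    finally show ?thesis by simp
  qed
  then have \<alpha>n: "nrm \<alpha> \<le> 4 + 3 * nrm x + nrm b" using \<xi> by simp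
  have "norm (\<beta> i) \<le> (2 + nrm x) + 1 * norm (x i) + 1 * norm (b i)" for i
    using \<xi> nrm_nonneg[of x] nrm_nonneg[of \<xi>] norm_ge_zero[of "x i"] norm_ge_zero[of "b i"]
    unfolding \<beta>_def real_norm_def by linarith
  from nrm_affine[where y = \<beta> and u = x and v = b, OF this] have \<beta>n: "nrm \<beta> \<le> 2 + 2 * nrm x + nrm b" by (simp add: add_nonneg_nonneg)
  have "Gl g (\<lambda>i. x i + \<xi> i) b - Gl g x b = (\<Sum>i\<in>range L. wt i * (g (x i + \<xi> i) \<mu>' (b i) - g (x i) \<mu> (b i)))"
    by (simp add: Gl_def \<mu>_def \<mu>'_def sum_subtractf right_diff_distrib)
  also have "\<dots> \<le> (\<Sum>i\<in>range L. wt i * (C * (\<alpha> i * norm (\<xi> i)) + C * nrm \<xi> * (\<beta> i * 1)))"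
    using pt wpos by (intro sum_mono mult_left_mono) (auto simp: less_imp_le)
  also have "\<dots> = C * (\<Sum>i\<in>range L. wt i * (\<alpha> i * norm (\<xi> i))) + C * nrm \<xi> * (\<Sum>i\<in>range L. wt i * (\<beta> i * 1))"
    by (simp add: sum.distrib sum_distrib_left algebra_simps)
  also have "\<dots> \<le> C * ((4 + 3 * nrm x + nrm b) * nrm \<xi>) + C * nrm \<xi> * (2 + 2 * nrm x + nrm b)"
  proof (intro add_mono mult_left_mono)
    have "(\<Sum>i\<in>range L. wt i * (\<alpha> i * norm (\<xi> i))) \<le> nrm \<alpha> * nrm (\<lambda>i. norm (\<xi> i))"
      by (rule weighted_sum_le)
    also have "nrm (\<lambda>i. norm (\<xi> i)) = nrm \<xi>" by (rule nrm_cong) simp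
    also have "nrm \<alpha> * nrm \<xi> \<le> (4 + 3 * nrm x + nrm b) * nrm \<xi>" using \<alpha>n by (intro mult_right_mono) auto
    finally show "(\<Sum>i\<in>range L. wt i * (\<alpha> i * norm (\<xi> i))) \<le> (4 + 3 * nrm x + nrm b) * nrm \<xi>" .
    show "(\<Sum>i\<in>range L. wt i * (\<beta> i * 1)) \<le> 2 + 2 * nrm x + nrm b"
      using weighted_sum_le[of \<beta> "\<lambda>_. 1"] \<beta>n by (simp add: nrm_const)
  qed (use C in auto)
  also have "\<dots> = C * (6 + 5 * nrm x + 2 * nrm b) * nrm \<xi>" by (simp add: algebra_simps)
  finally show ?thesis .
qed

end

lemma regular_solutionE:
  assumes "regular_solution T f g k u"
  obtains ut Du where
    "\<And>t m. t \<in> {0..T} \<Longrightarrow> m \<in> P2 \<Longrightarrow> ((\<lambda>s. u s m) has_real_derivative ut t m) (at t within {0..T})"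
    "\<And>t m. t \<in> {0..T} \<Longrightarrow> m \<in> P2 \<Longrightarrow> has_L_deriv (u t) m (\<lambda>x. blinfun_inner_left (Du t m x))"
    "jcont {0..T} ut" "jcont ({0..T} \<times> UNIV) (\<lambda>(t, x) m. Du t m x)"
    "\<And>t m. t \<in> {0..T} \<Longrightarrow> m \<in> P2 \<Longrightarrow> continuous_on UNIV (Du t m)"
    "\<And>t m. t \<in> {0..T} \<Longrightarrow> m \<in> P2 \<Longrightarrow> ut t m + (\<integral>x. hamiltonian f g x m (Du t m x) \<partial>m) = 0"
    "\<And>m. m \<in> P2 \<Longrightarrow> u T m = (\<integral>x. k x m \<partial>m)"
proof -
  from assms[unfolded regular_solution_def] obtain ut Du where
    u: "(\<forall>t\<in>{0..T}. \<forall>m\<in>P2. ((\<lambda>s. u s m) has_real_derivative ut t m) (at t within {0..T}) \<and>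
        has_L_deriv (u t) m (\<lambda>x. blinfun_inner_left (Du t m x))) \<and>
     jcont {0..T} ut \<and>
     jcont ({0..T} \<times> UNIV) (\<lambda>(t, x) m. Du t m x) \<and>
     (\<forall>t\<in>{0..T}. \<forall>m\<in>P2. (\<lambda>s. ut s m) differentiable (at t within {0..T}) \<and> L_differentiable (ut t) m) \<and>
     (\<forall>t\<in>{0..T}. \<forall>m\<in>P2. \<forall>x.
        (\<lambda>s. Du s m x) differentiable (at t within {0..T}) \<and>
        Du t m differentiable (at x) \<and> L_differentiable (\<lambda>\<nu>. Du t \<nu> x) m) \<and>
     (\<forall>t\<in>{0..T}. \<forall>m\<in>P2. ut t m + (\<integral>x. hamiltonian f g x m (Du t m x) \<partial>m) = 0) \<and>
     (\<forall>m\<in>P2. u T m = (\<integral>x. k x m \<partial>m))"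
    by (elim exE)
  show ?thesis
  proof (rule that[of ut Du])
    show "continuous_on UNIV (Du t m)" if "t \<in> {0..T}" "m \<in> P2" for t m
      using u that by (intro differentiable_imp_continuous_on) (simp add: differentiable_on_def)
  qed (use u in simp_all)
qed

lemma mvt_within:
  fixes u u' :: "real \<Rightarrow> real"
  assumes d: "\<And>t. t \<in> {0..T} \<Longrightarrow> (u has_real_derivative u' t) (at t within {0..T})"
    and a: "a \<in> {0..T}" and b: "b \<in> {0..T}"
  shows "\<exists>c\<in>{0..T}. \<bar>c - a\<bar> \<le> \<bar>b - a\<bar> \<and> u b - u a = u' c * (b - a)"
proof -
  have le: "\<exists>c\<in>{p..q}. u q - u p = u' c * (q - p)" if pq: "p \<le> q" "p \<in> {0..T}" "q \<in> {0..T}" for p q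
  proof (rule mvt_very_simple[OF pq(1)])
    fix x assume "p \<le> x" "x \<le> q"
    then show "(u has_derivative (*) (u' x)) (at x within {p..q})"
      using has_derivative_subset[OF d[of x, unfolded has_field_derivative_def], of "{p..q}"] pq by auto
  qed
  show ?thesis
  proof (cases "a \<le> b")
    case True
    then obtain c where "c \<in> {a..b}" "u b - u a = u' c * (b - a)" using le[of a b] a b by auto
    then show ?thesis using a b by (intro bexI[of _ c]) auto
  next
    case False
    then obtain c where "c \<in> {b..a}" "u a - u b = u' c * (a - b)" using le[of b a] a b by auto
    then show ?thesis using a b False by (intro bexI[of _ c]) (auto simp: algebra_simps)
  qed
qed

context labels
begin

lemma solution_space_deriv:
  fixes v :: "real \<Rightarrow> 'x::euclidean_space measure \<Rightarrow> real"
  assumes D: "\<And>m. m \<in> P2 \<Longrightarrow> has_L_deriv (v t) m (\<lambda>x. blinfun_inner_left (Dv t m x))"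
  shows "((\<lambda>s. v t (law_of (\<lambda>i. x i + s *\<^sub>R \<xi> i))) has_real_derivative
     ip (\<lambda>i. Dv t (law_of (\<lambda>i. x i + s *\<^sub>R \<xi> i)) (x i + s *\<^sub>R \<xi> i)) \<xi>) (at s)"
proof -
  let ?m = "law_of (\<lambda>i. x i + s *\<^sub>R \<xi> i)"
  have "has_L_deriv (v t) (law (\<lambda>\<omega>. x (L \<omega>) + s *\<^sub>R \<xi> (L \<omega>))) (\<lambda>y. blinfun_inner_left (Dv t ?m y))"
    using D[OF law_of_P2[of "\<lambda>i. x i + s *\<^sub>R \<xi> i"]] by (simp add: law_of_def)
  from L_deriv_path[OF simple_x simple_x this, of id_blinfun]
  have "((\<lambda>s. v t (law_of (\<lambda>i. x i + s *\<^sub>R \<xi> i))) has_real_derivative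
      (\<integral>\<omega>. \<xi> (L \<omega>) \<bullet> Dv t ?m (x (L \<omega>) + s *\<^sub>R \<xi> (L \<omega>)) \<partial>Omega)) (at s)"
    by (simp add: law_of_def inner_commute)
  also have "(\<integral>\<omega>. \<xi> (L \<omega>) \<bullet> Dv t ?m (x (L \<omega>) + s *\<^sub>R \<xi> (L \<omega>)) \<partial>Omega)
      = ip (\<lambda>i. Dv t ?m (x i + s *\<^sub>R \<xi> i)) \<xi>"
    using integral_label[of "\<lambda>i. \<xi> i \<bullet> Dv t ?m (x i + s *\<^sub>R \<xi> i)"] by (simp add: ip_def inner_commute)
  finally show ?thesis .
qed

text \<open>For the derivative in space-time the increment is split into a time increment at the new law, for
  which the joint continuity of the time derivative is used, and a spatial increment at fixed time.\<close>

lemma solution_c1_along: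
  fixes v vt :: "real \<Rightarrow> 'x::euclidean_space measure \<Rightarrow> real"
  assumes D1: "\<And>t m. t \<in> {0..T} \<Longrightarrow> m \<in> P2 \<Longrightarrow> ((\<lambda>s. v s m) has_real_derivative vt t m) (at t within {0..T})"
    and D2: "\<And>t m. t \<in> {0..T} \<Longrightarrow> m \<in> P2 \<Longrightarrow> has_L_deriv (v t) m (\<lambda>x. blinfun_inner_left (Dv t m x))"
    and J1: "jcont {0..T} vt" and J2: "jcont ({0..T} \<times> UNIV) (\<lambda>(t, x) m. Dv t m x)"
  shows "c1_along T (\<lambda>t x. v t (law_of x)) (\<lambda>t x. vt t (law_of x)) (\<lambda>t x i. Dv t (law_of x) (x i))"
  unfolding c1_along_def
proof (intro conjI ballI allI impI)
  fix t x \<xi> s assume "t \<in> {0..T}"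
  then show "((\<lambda>s. v t (law_of (\<lambda>i. x i + s *\<^sub>R \<xi> i))) has_real_derivative
     ip (\<lambda>i. Dv t (law_of (\<lambda>i. x i + s *\<^sub>R \<xi> i)) (x i + s *\<^sub>R \<xi> i)) \<xi>) (at s)"
    by (intro solution_space_deriv D2)
next
  fix t h s and x \<eta> :: "'i \<Rightarrow> 'x"
  assume t: "t \<in> {0..T}" and h: "0 < h" "t + h \<le> T" and s: "s \<in> {0..h}"
  define m where "m r = law_of (\<lambda>i. x i + r *\<^sub>R \<eta> i)" for r
  define c where "c = ip (\<lambda>i. Dv (t + s) (m s) (x i + s *\<^sub>R \<eta> i)) \<eta>"
  have in_T: "t + r \<in> {0..T}" if "r \<in> {0..h}" for r using that t h by auto
  have mP: "m r \<in> P2" for r unfolding m_def by (rule law_of_P2)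
  have mW: "wasserstein 2 (m r) (m s) \<le> \<bar>r - s\<bar> * nrm \<eta>" for r
  proof -
    have "(\<lambda>i. x i + r *\<^sub>R \<eta> i - (x i + s *\<^sub>R \<eta> i)) = (\<lambda>i. (r - s) *\<^sub>R \<eta> i)"
      by (simp add: algebra_simps)
    then show ?thesis unfolding m_def
      using wasserstein_law_of[of "\<lambda>i. x i + r *\<^sub>R \<eta> i" "\<lambda>i. x i + s *\<^sub>R \<eta> i"] nrm_scale[of "r - s" \<eta>] by simp
  qed
  have space: "((\<lambda>r. v (t + s) (m r)) has_real_derivative c) (at s within {0..h})"
    unfolding m_def c_def
    by (rule has_field_derivative_at_within[OF solution_space_deriv]) (rule D2[OF in_T[OF s]])
  have q2: "((\<lambda>r. (v (t + s) (m r) - v (t + s) (m s)) / (r - s)) \<longlongrightarrow> c) (at s within {0..h})"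
    using space unfolding has_field_derivative_iff .
  have q1: "((\<lambda>r. (v (t + r) (m r) - v (t + s) (m r)) / (r - s)) \<longlongrightarrow> vt (t + s) (m s)) (at s within {0..h})"
  proof (rule tendstoI)
    fix e :: real assume e: "0 < e"
    from J1[unfolded jcont_def, rule_format, OF in_T[OF s] mP e]
    obtain d where d: "0 < d" "\<And>\<tau> m'. \<tau> \<in> {0..T} \<Longrightarrow> m' \<in> P2 \<Longrightarrow> dist \<tau> (t + s) < d \<Longrightarrow>
        wasserstein 2 m' (m s) < d \<Longrightarrow> dist (vt \<tau> m') (vt (t + s) (m s)) < e" by blast
    define d' where "d' = d / (1 + nrm \<eta>)"
    have n: "0 < 1 + nrm \<eta>" by (simp add: add_pos_nonneg)
    have d': "0 < d'" using d n by (simp add: d'_def)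
    have "dist ((v (t + r) (m r) - v (t + s) (m r)) / (r - s)) (vt (t + s) (m s)) < e"
      if r: "r \<in> {0..h}" "r \<noteq> s" "dist r s < d'" for r
    proof -
      have "\<exists>\<tau>\<in>{0..T}. \<bar>\<tau> - (t + s)\<bar> \<le> \<bar>(t + r) - (t + s)\<bar> \<and>
          v (t + r) (m r) - v (t + s) (m r) = vt \<tau> (m r) * ((t + r) - (t + s))"
        using D1[OF _ mP] in_T[OF s] in_T[OF r(1)] by (intro mvt_within)
      then obtain \<tau> where \<tau>: "\<tau> \<in> {0..T}" "\<bar>\<tau> - (t + s)\<bar> \<le> \<bar>r - s\<bar>"
          "v (t + r) (m r) - v (t + s) (m r) = vt \<tau> (m r) * (r - s)" by auto
      have "\<bar>r - s\<bar> * (1 + nrm \<eta>) < d"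
        using r(3) n by (simp add: d'_def dist_real_def field_simps)
      then have lt: "\<bar>r - s\<bar> + \<bar>r - s\<bar> * nrm \<eta> < d" by (simp add: distrib_left)
      have nn: "0 \<le> \<bar>r - s\<bar> * nrm \<eta>" by simp
      have "\<bar>r - s\<bar> < d" using lt nn by linarith
      moreover have "\<bar>r - s\<bar> * nrm \<eta> < d" using lt by linarith
      ultimately have "dist (vt \<tau> (m r)) (vt (t + s) (m s)) < e"
        using \<tau>(2) mW[of r] by (intro d(2) \<tau>(1) mP) (auto simp: dist_real_def)
      then show ?thesis using \<tau>(3) r(2) by simp
    qed
    then show "\<forall>\<^sub>F r in at s within {0..h}. dist ((v (t + r) (m r) - v (t + s) (m r)) / (r - s)) (vt (t + s) (m s)) < e"
      unfolding eventually_at using d' by blast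
  qed
  have "((\<lambda>r. v (t + r) (m r)) has_real_derivative vt (t + s) (m s) + c) (at s within {0..h})"
    unfolding has_field_derivative_iff
    using tendsto_add[OF q1 q2] by (simp add: add_divide_distrib[symmetric])
  then show "((\<lambda>s. v (t + s) (law_of (\<lambda>i. x i + s *\<^sub>R \<eta> i))) has_real_derivative
      vt (t + s) (law_of (\<lambda>i. x i + s *\<^sub>R \<eta> i)) +
      ip (\<lambda>i. Dv (t + s) (law_of (\<lambda>i. x i + s *\<^sub>R \<eta> i)) (x i + s *\<^sub>R \<eta> i)) \<eta>) (at s within {0..h})"
    unfolding m_def c_def .
next
  show "jcontinuous T (\<lambda>t x. vt t (law_of x))"
    unfolding jcontinuous_def
  proof (intro ballI allI impI)
    fix t x and e :: real assume t: "t \<in> {0..T}" and e: "0 < e"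
    from J1[unfolded jcont_def, rule_format, OF t law_of_P2 e, of x]
    obtain d where d: "0 < d" "\<And>\<tau> m'. \<tau> \<in> {0..T} \<Longrightarrow> m' \<in> P2 \<Longrightarrow> dist \<tau> t < d \<Longrightarrow>
        wasserstein 2 m' (law_of x) < d \<Longrightarrow> dist (vt \<tau> m') (vt t (law_of x)) < e" by blast
    have "dist (vt t' (law_of x')) (vt t (law_of x)) < e"
      if "t' \<in> {0..T}" "\<bar>t' - t\<bar> < d" "nrm (\<lambda>i. x' i - x i) < d" for t' x'
      using that le_less_trans[OF wasserstein_law_of that(3)] by (intro d(2) law_of_P2) (auto simp: dist_real_def)
    then show "\<exists>\<delta>>0. \<forall>t'\<in>{0..T}. \<forall>x'. \<bar>t' - t\<bar> < \<delta> \<longrightarrow> nrm (\<lambda>i. x' i - x i) < \<delta> \<longrightarrow>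
        dist (vt t' (law_of x')) (vt t (law_of x)) < e"
      using d(1) by blast
  qed
next
  fix i assume i: "i \<in> range L"
  show "jcontinuous T (\<lambda>t x. Dv t (law_of x) (x i))"
    unfolding jcontinuous_def
  proof (intro ballI allI impI)
    fix t and x :: "'i \<Rightarrow> 'x" and e :: real assume t: "t \<in> {0..T}" and e: "0 < e"
    have tx: "(t, x i) \<in> {0..T} \<times> UNIV" using t by simp
    from J2[unfolded jcont_def, rule_format, OF tx law_of_P2 e, of x]
    obtain d where d: "0 < d" "\<And>p m'. p \<in> {0..T} \<times> UNIV \<Longrightarrow> m' \<in> P2 \<Longrightarrow> dist p (t, x i) < d \<Longrightarrow>
        wasserstein 2 m' (law_of x) < d \<Longrightarrow> dist ((\<lambda>(t, x) m. Dv t m x) p m') (Dv t (law_of x) (x i)) < e"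
      by auto
    define K where "K = 1 / sqrt (wt i)"
    have K: "0 < K" using wpos[OF i] by (simp add: K_def)
    define d' where "d' = d / (1 + K)"
    have d': "0 < d'" "d' \<le> d" "d' * (1 + K) = d" using d K by (auto simp: d'_def field_simps)
    have "dist (Dv t' (law_of x') (x' i)) (Dv t (law_of x) (x i)) < e"
      if x': "t' \<in> {0..T}" "\<bar>t' - t\<bar> < d'" "nrm (\<lambda>i. x' i - x i) < d'" for t' x'
    proof -
      have "norm (x' i - x i) \<le> nrm (\<lambda>i. x' i - x i) * K"
        using norm_le_nrm[OF i, of "\<lambda>i. x' i - x i"] by (simp add: K_def)
      also have "\<dots> \<le> d' * K" using x' K by (intro mult_right_mono) auto
      finally have "\<bar>t' - t\<bar> + norm (x' i - x i) < d' * (1 + K)" using x'(2) by (simp add: distrib_left)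
      moreover have "dist (t', x' i) (t, x i) \<le> \<bar>t' - t\<bar> + norm (x' i - x i)"
        using sqrt_sum_squares_le_sum_abs[of "\<bar>t' - t\<bar>" "norm (x' i - x i)"]
        unfolding dist_Pair_Pair dist_real_def dist_norm[of "x' i"] by simp
      ultimately have "dist (t', x' i) (t, x i) < d" using d' by simp
      moreover have "wasserstein 2 (law_of x') (law_of x) < d"
        using wasserstein_law_of[of x' x] x'(3) d' by linarith
      ultimately have "dist ((\<lambda>(t, x) m. Dv t m x) (t', x' i) (law_of x')) (Dv t (law_of x) (x i)) < e"
        using x'(1) by (intro d(2) law_of_P2) auto
      then show ?thesis by simp
    qed
    then show "\<exists>\<delta>>0. \<forall>t'\<in>{0..T}. \<forall>x'. \<bar>t' - t\<bar> < \<delta> \<longrightarrow> nrm (\<lambda>i. x' i - x i) < \<delta> \<longrightarrow>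
        dist (Dv t' (law_of x') (x' i)) (Dv t (law_of x) (x i)) < e"
      using d'(1) by blast
  qed
qed

lemma integral_law_of:
  fixes q :: "'x::euclidean_space \<Rightarrow> real"
  assumes "q \<in> borel_measurable borel"
  shows "(\<integral>y. q y \<partial>law_of x) = (\<Sum>i\<in>range L. wt i * q (x i))"
proof -
  have "(\<integral>y. q y \<partial>law_of x) = (\<integral>\<omega>. q (x (L \<omega>)) \<partial>Omega)"
    unfolding law_of_def by (rule integral_distr) (simp_all add: assms)
  then show ?thesis using integral_label[of "\<lambda>i. q (x i)"] by simp
qed

lemma hamiltonian_integral:
  fixes f :: "'x::euclidean_space \<Rightarrow> 'x measure \<Rightarrow> 'a::euclidean_space \<Rightarrow> 'x"
  assumes f: "drift_bounds \<Lambda> f" and g: "cost_bounds lam C g" and p: "continuous_on UNIV p"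
  shows "(\<integral>y. hamiltonian f g y (law_of x) (p y) \<partial>law_of x) =
     (\<Sum>i\<in>range L. wt i * hamiltonian f g (x i) (law_of x) (p (x i)))"
proof -
  have m: "(\<lambda>y. hamiltonian f g y (law_of x) (p y)) \<in> borel_measurable borel"
    unfolding law_of_def by (rule hamiltonian_measurable[OF f g simple_x p])
  show ?thesis using integral_law_of[OF m, of x] by simp
qed

text \<open>Minimal controls of the single points together are minimal for the configuration, and they satisfy the
  growth conditions of the comparison result.\<close>

lemma minimal_feedback:
  fixes f :: "'x::euclidean_space \<Rightarrow> 'x measure \<Rightarrow> 'a::euclidean_space \<Rightarrow> 'x"
  assumes f: "drift_bounds \<Lambda> f" and g: "cost_bounds lam C g"
  shows "\<exists>K\<ge>0. \<forall>x p. \<exists>a. ip p (Fl f x a) + Gl g x a = (\<Sum>i\<in>range L. wt i * hamiltonian f g (x i) (law_of x) (p i)) \<and>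
     nrm (Fl f x a) \<le> K * (1 + nrm x + nrm p) \<and>
     (\<forall>\<xi>. nrm \<xi> \<le> 1 \<longrightarrow> Gl g (\<lambda>i. x i + \<xi> i) a - Gl g x a \<le> K * (1 + nrm x + nrm p) * nrm \<xi>)"
proof -
  have pos: "0 \<le> \<Lambda>" "0 \<le> C" "0 < lam" using drift_boundsD(1)[OF f] cost_boundsD(1,2)[OF g] by auto
  define c0 where "c0 = norm (f 0 (law (\<lambda>_. 0)) 0)"
  define A where "A = (2 * C + \<Lambda>) / lam"
  define K where "K = c0 + 2 * \<Lambda> + \<Lambda> * A + C * (6 + 2 * A)"
  have A: "0 \<le> A" using pos by (simp add: A_def)
  have c0: "0 \<le> c0" by (simp add: c0_def)
  have K: "0 \<le> K" using pos A c0 by (simp add: K_def)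
  have "\<exists>a. ip p (Fl f x a) + Gl g x a = (\<Sum>i\<in>range L. wt i * hamiltonian f g (x i) (law_of x) (p i)) \<and>
     nrm (Fl f x a) \<le> K * (1 + nrm x + nrm p) \<and>
     (\<forall>\<xi>. nrm \<xi> \<le> 1 \<longrightarrow> Gl g (\<lambda>i. x i + \<xi> i) a - Gl g x a \<le> K * (1 + nrm x + nrm p) * nrm \<xi>)" for x p
  proof -
    define good where "good i a \<longleftrightarrow> (\<forall>b. f (x i) (law_of x) a \<bullet> p i + g (x i) (law_of x) a \<le> f (x i) (law_of x) b \<bullet> p i + g (x i) (law_of x) b) \<and>
        norm a \<le> (C * (1 + norm (x i) + nrm x) + \<Lambda> * norm (p i)) / lam" for i a
    define a where "a i = (SOME a. good i a)" for i
    have "good i (a i)" for i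
      unfolding a_def
    proof (rule someI_ex)
      show "\<exists>a. good i a"
        using minimizer_exists[OF f g simple_x[of x], of "x i" "p i"] unfolding good_def law_of_def l2norm_label .
    qed
    then have a: "\<And>i b. f (x i) (law_of x) (a i) \<bullet> p i + g (x i) (law_of x) (a i) \<le> f (x i) (law_of x) b \<bullet> p i + g (x i) (law_of x) b"
       "\<And>i. norm (a i) \<le> (C * (1 + norm (x i) + nrm x) + \<Lambda> * norm (p i)) / lam"
      unfolding good_def by auto
    have "ip p (Fl f x a) + Gl g x a = (\<Sum>i\<in>range L. wt i * (f (x i) (law_of x) (a i) \<bullet> p i + g (x i) (law_of x) (a i)))"
      by (simp add: ip_def Fl_def Gl_def sum.distrib[symmetric] distrib_left inner_commute)
    also have "\<dots> = (\<Sum>i\<in>range L. wt i * hamiltonian f g (x i) (law_of x) (p i))"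
      using hamiltonian_eq[of f "x i" "law_of x" "a i" "p i" g for i, OF a(1)] by simp
    finally have eq: "ip p (Fl f x a) + Gl g x a = (\<Sum>i\<in>range L. wt i * hamiltonian f g (x i) (law_of x) (p i))" .
    have "norm (a i) \<le> C * (1 + nrm x) / lam + (C / lam) * norm (x i) + (\<Lambda> / lam) * norm (p i)" for i
      using a(2)[of i] by (simp add: add_divide_distrib[symmetric] algebra_simps)
    from nrm_affine[where y = a and u = x and v = p, OF this]
    have "nrm a \<le> C * (1 + nrm x) / lam + (C / lam) * nrm x + (\<Lambda> / lam) * nrm p"
      using pos by (simp add: add_nonneg_nonneg)
    also have "\<dots> = (C + 2 * C * nrm x + \<Lambda> * nrm p) / lam"
      by (simp add: add_divide_distrib[symmetric] algebra_simps)
    also have "\<dots> \<le> ((2 * C + \<Lambda>) * (1 + nrm x + nrm p)) / lam"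
    proof (rule divide_right_mono)
      have "0 \<le> C * nrm p" "0 \<le> \<Lambda> * nrm x" using pos by auto
      then show "C + 2 * C * nrm x + \<Lambda> * nrm p \<le> (2 * C + \<Lambda>) * (1 + nrm x + nrm p)"
        using pos by (simp add: algebra_simps)
    qed (use pos in simp)
    finally have an: "nrm a \<le> A * (1 + nrm x + nrm p)" by (simp add: A_def)
    define R where "R = 1 + nrm x + nrm p"
    have R: "1 \<le> R" "nrm x \<le> R" "0 \<le> R" by (auto simp: R_def add_nonneg_nonneg)
    have "nrm (Fl f x a) \<le> c0 + 2 * \<Lambda> * nrm x + \<Lambda> * nrm a"
      unfolding c0_def by (rule Fl_growth[OF f])
    also have "\<dots> \<le> c0 * R + 2 * \<Lambda> * R + \<Lambda> * (A * R)"
    proof (intro add_mono)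
      show "c0 \<le> c0 * R" using mult_left_mono[OF R(1) c0] by simp
      show "2 * \<Lambda> * nrm x \<le> 2 * \<Lambda> * R" using R pos by (intro mult_left_mono) auto
      show "\<Lambda> * nrm a \<le> \<Lambda> * (A * R)" using an pos unfolding R_def by (intro mult_left_mono)
    qed
    also have "\<dots> = (c0 + 2 * \<Lambda> + \<Lambda> * A) * R" by (simp add: algebra_simps)
    also have "\<dots> \<le> K * R"
      using pos A by (intro mult_right_mono R) (simp add: K_def)
    finally have Fn: "nrm (Fl f x a) \<le> K * R" .
    have Gn: "Gl g (\<lambda>i. x i + \<xi> i) a - Gl g x a \<le> K * R * nrm \<xi>" if \<xi>: "nrm \<xi> \<le> 1" for \<xi>
    proof -
      have "Gl g (\<lambda>i. x i + \<xi> i) a - Gl g x a \<le> C * (6 + 5 * nrm x + 2 * nrm a) * nrm \<xi>"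
        by (rule Gl_growth[OF g \<xi>])
      also have "\<dots> \<le> K * R * nrm \<xi>"
      proof (rule mult_right_mono)
        have "6 + 5 * nrm x + 2 * nrm a \<le> 6 * R + 2 * (A * R)"
        proof -
          have "6 + 5 * nrm x \<le> 6 * R" unfolding R_def distrib_left by (simp add: add_increasing2)
          moreover have "nrm a \<le> A * R" using an by (simp add: R_def)
          ultimately show ?thesis by linarith
        qed
        also have "\<dots> = (6 + 2 * A) * R" by (simp add: algebra_simps)
        finally have "C * (6 + 5 * nrm x + 2 * nrm a) \<le> C * ((6 + 2 * A) * R)" using pos by (intro mult_left_mono)
        also have "\<dots> = (C * (6 + 2 * A)) * R" by simp
        also have "\<dots> \<le> K * R"
          using pos A c0 by (intro mult_right_mono R) (simp add: K_def)
        finally show "C * (6 + 5 * nrm x + 2 * nrm a) \<le> K * R" .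
      qed simp
      finally show ?thesis .
    qed
    show ?thesis using eq Fn Gn unfolding R_def by blast
  qed
  then show ?thesis using K by blast
qed

lemma hamiltonian_le:
  fixes f :: "'x::euclidean_space \<Rightarrow> 'x measure \<Rightarrow> 'a::euclidean_space \<Rightarrow> 'x"
  assumes f: "drift_bounds \<Lambda> f" and g: "cost_bounds lam C g"
  shows "(\<Sum>i\<in>range L. wt i * hamiltonian f g (x i) (law_of x) (p i)) \<le> ip p (Fl f x b) + Gl g x b"
proof -
  have "hamiltonian f g (x i) (law_of x) (p i) \<le> f (x i) (law_of x) (b i) \<bullet> p i + g (x i) (law_of x) (b i)" for i
  proof -
    obtain a where a: "\<And>b. f (x i) (law_of x) a \<bullet> p i + g (x i) (law_of x) a \<le> f (x i) (law_of x) b \<bullet> p i + g (x i) (law_of x) b"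
      using minimizer_exists[OF f g simple_x[of x], of "x i" "p i"] unfolding law_of_def by blast
    show ?thesis unfolding hamiltonian_eq[of f "x i" "law_of x" a "p i" g, OF a] by (rule a)
  qed
  then have "(\<Sum>i\<in>range L. wt i * hamiltonian f g (x i) (law_of x) (p i)) \<le>
      (\<Sum>i\<in>range L. wt i * (f (x i) (law_of x) (b i) \<bullet> p i + g (x i) (law_of x) (b i)))"
    using wpos by (intro sum_mono mult_left_mono) (auto simp: less_imp_le)
  then show ?thesis
    by (simp add: ip_def Fl_def Gl_def sum.distrib[symmetric] distrib_left inner_commute)
qed

lemma solution_le:
  fixes f :: "'x::euclidean_space \<Rightarrow> 'x measure \<Rightarrow> 'a::euclidean_space \<Rightarrow> 'x"
  assumes f: "drift_bounds \<Lambda> f" and g: "cost_bounds lam C g"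
    and v: "regular_solution T f g k v" and w: "regular_solution T f g k w" and t: "t \<in> {0..T}"
  shows "w t (law_of x) \<le> v t (law_of x)"
proof -
  have sol: "\<exists>A P. c1_along T (\<lambda>t x. u t (law_of x)) A P \<and>
      (\<forall>t\<in>{0..T}. \<forall>x. A t x + (\<Sum>i\<in>range L. wt i * hamiltonian f g (x i) (law_of x) (P t x i)) = 0) \<and>
      (\<forall>x. u T (law_of x) = (\<integral>y. k y (law_of x) \<partial>law_of x))"
    if u: "regular_solution T f g k u" for u
  proof -
    show ?thesis
    proof (rule regular_solutionE[OF u])
      fix ut Du
      assume u1: "\<And>t m. t \<in> {0..T} \<Longrightarrow> m \<in> P2 \<Longrightarrow> ((\<lambda>s. u s m) has_real_derivative ut t m) (at t within {0..T})"
        "\<And>t m. t \<in> {0..T} \<Longrightarrow> m \<in> P2 \<Longrightarrow> has_L_deriv (u t) m (\<lambda>x. blinfun_inner_left (Du t m x))"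
        "jcont {0..T} ut" "jcont ({0..T} \<times> UNIV) (\<lambda>(t, x) m. Du t m x)"
      and u2: "\<And>t m. t \<in> {0..T} \<Longrightarrow> m \<in> P2 \<Longrightarrow> continuous_on UNIV (Du t m)"
      and u3: "\<And>t m. t \<in> {0..T} \<Longrightarrow> m \<in> P2 \<Longrightarrow> ut t m + (\<integral>x. hamiltonian f g x m (Du t m x) \<partial>m) = 0"
      and u4: "\<And>m. m \<in> P2 \<Longrightarrow> u T m = (\<integral>x. k x m \<partial>m)"
    show ?thesis
    proof (intro exI conjI ballI allI)
      show "c1_along T (\<lambda>t x. u t (law_of x)) (\<lambda>t x. ut t (law_of x)) (\<lambda>t x i. Du t (law_of x) (x i))"
        by (rule solution_c1_along[OF u1])
      show "ut t (law_of x) + (\<Sum>i\<in>range L. wt i * hamiltonian f g (x i) (law_of x) (Du t (law_of x) (x i))) = 0"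
        if "t \<in> {0..T}" for t x
        using u3[OF that law_of_P2, of x] unfolding hamiltonian_integral[OF f g u2[OF that law_of_P2]] .
      show "u T (law_of x) = (\<integral>y. k y (law_of x) \<partial>law_of x)" for x by (rule u4[OF law_of_P2])
    qed
    qed
  qed
  obtain A P where U: "c1_along T (\<lambda>t x. v t (law_of x)) A P"
      "\<And>t x. t \<in> {0..T} \<Longrightarrow> A t x + (\<Sum>i\<in>range L. wt i * hamiltonian f g (x i) (law_of x) (P t x i)) = 0"
      "\<And>x. v T (law_of x) = (\<integral>y. k y (law_of x) \<partial>law_of x)"
    using sol[OF v] by blast
  obtain B Q where V: "c1_along T (\<lambda>t x. w t (law_of x)) B Q"
      "\<And>t x. t \<in> {0..T} \<Longrightarrow> B t x + (\<Sum>i\<in>range L. wt i * hamiltonian f g (x i) (law_of x) (Q t x i)) = 0"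
      "\<And>x. w T (law_of x) = (\<integral>y. k y (law_of x) \<partial>law_of x)"
    using sol[OF w] by blast
  obtain K where K: "0 \<le> K" "\<And>x p. \<exists>a. ip p (Fl f x a) + Gl g x a = (\<Sum>i\<in>range L. wt i * hamiltonian f g (x i) (law_of x) (p i)) \<and>
     nrm (Fl f x a) \<le> K * (1 + nrm x + nrm p) \<and>
     (\<forall>\<xi>. nrm \<xi> \<le> 1 \<longrightarrow> Gl g (\<lambda>i. x i + \<xi> i) a - Gl g x a \<le> K * (1 + nrm x + nrm p) * nrm \<xi>)"
    using minimal_feedback[OF f g] by blast
  define C' where "C' = K + 2 * \<Lambda>"
  have L0: "0 \<le> \<Lambda>" by (rule drift_boundsD(1)[OF f])
  have C': "0 \<le> C'" "K \<le> C'" "2 * \<Lambda> \<le> C'" using K(1) L0 by (auto simp: C'_def)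
  show ?thesis
  proof (rule bellman_comparison[where U = "\<lambda>t x. v t (law_of x)" and V = "\<lambda>t x. w t (law_of x)" and
        F = "Fl f" and G = "Gl g" and C = C', OF U(1) V(1) C'(1) _ _ _ _ _ t])
    show "0 \<le> A t x + ip (P t x) (Fl f x b) + Gl g x b" if "t \<in> {0..T}" for t x b
      using U(2)[OF that, of x] hamiltonian_le[OF f g, of x "P t x" b] by linarith
    show "0 \<le> B t x + ip (Q t x) (Fl f x b) + Gl g x b" if "t \<in> {0..T}" for t x b
      using V(2)[OF that, of x] hamiltonian_le[OF f g, of x "Q t x" b] by linarith
    show "\<exists>a. A t x + ip (P t x) (Fl f x a) + Gl g x a = 0 \<and>
        nrm (Fl f x a) \<le> C' * (1 + nrm x + nrm (P t x)) \<and>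
        (\<forall>\<xi>. nrm \<xi> \<le> 1 \<longrightarrow> Gl g (\<lambda>i. x i + \<xi> i) a - Gl g x a \<le> C' * (1 + nrm x + nrm (P t x)) * nrm \<xi>)"
      if t: "t \<in> {0..T}" for t x
    proof -
      obtain a where a: "ip (P t x) (Fl f x a) + Gl g x a = (\<Sum>i\<in>range L. wt i * hamiltonian f g (x i) (law_of x) (P t x i))"
         "nrm (Fl f x a) \<le> K * (1 + nrm x + nrm (P t x))"
         "\<And>\<xi>. nrm \<xi> \<le> 1 \<Longrightarrow> Gl g (\<lambda>i. x i + \<xi> i) a - Gl g x a \<le> K * (1 + nrm x + nrm (P t x)) * nrm \<xi>"
        using K(2)[of "P t x" x] by blast
      have le: "K * (1 + nrm x + nrm (P t x)) \<le> C' * (1 + nrm x + nrm (P t x))"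
        using C' by (intro mult_right_mono) (auto intro: add_nonneg_nonneg)
      show ?thesis
      proof (intro exI[of _ a] conjI allI impI)
        show "A t x + ip (P t x) (Fl f x a) + Gl g x a = 0" using U(2)[OF t, of x] a(1) by linarith
        show "nrm (Fl f x a) \<le> C' * (1 + nrm x + nrm (P t x))" using a(2) le by linarith
        fix \<xi> :: "'i \<Rightarrow> 'x" assume "nrm \<xi> \<le> 1"
        then show "Gl g (\<lambda>i. x i + \<xi> i) a - Gl g x a \<le> C' * (1 + nrm x + nrm (P t x)) * nrm \<xi>"
          using a(3) mult_right_mono[OF le nrm_nonneg[of \<xi>]] by fastforce
      qed
    qed
    show "\<bar>ip q (\<lambda>i. Fl f (\<lambda>i. x i + \<xi> i) b i - Fl f x b i)\<bar> \<le> C' * nrm \<xi> * nrm q" for x \<xi> b q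
    proof -
      have "2 * \<Lambda> * (nrm \<xi> * nrm q) \<le> C' * (nrm \<xi> * nrm q)" using C' by (intro mult_right_mono) auto
      then show ?thesis using Fl_lipschitz[OF f, of q x \<xi> b] by (simp add: mult.assoc)
    qed
    show "v T (law_of x) = w T (law_of x)" for x using U(3) V(3) by simp
  qed
qed

end

section \<open>Passage to arbitrary laws\<close>

text \<open>Values of probability zero are merged into a value of positive probability.\<close>

lemma simple_law_label:
  fixes Z :: "real \<Rightarrow> 'x::euclidean_space"
  assumes Z: "simple_function Omega Z"
  obtains L :: "real \<Rightarrow> 'x" where "labels L" "law Z = law L"
proof -
  define mass where "mass y = measure Omega {\<omega>. Z \<omega> = y}" for y
  have fin: "finite (range Z)" and Zm: "\<And>y. {\<omega>. Z \<omega> = y} \<in> sets borel"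
    using Z unfolding simple_Omega_iff by auto
  have sum: "(\<Sum>y\<in>range Z. mass y) = 1"
    using integral_simple(2)[OF Z, of "\<lambda>_. 1 :: real"] Om.prob_space by (simp add: mass_def)
  have "\<exists>y\<in>range Z. mass y \<noteq> 0" using sum by (metis sum.neutral zero_neq_one)
  then obtain y0 where y0: "0 < mass y0" unfolding mass_def by (metis measure_nonneg order_le_neq_trans)
  define r where "r y = (if 0 < mass y then y else y0)" for y
  define L where "L \<omega> = r (Z \<omega>)" for \<omega>
  have sL: "simple_function Omega L" unfolding L_def[abs_def] by (rule simple_comp[OF Z])
  have "labels L"
  proof
    show "simple_function Omega L" by (rule sL)
    fix \<omega>
    have rp: "0 < mass (r y)" "r (r y) = r y" for y using y0 by (auto simp: r_def)
    have "{\<omega>'. Z \<omega>' = r (Z \<omega>)} \<subseteq> {\<omega>'. L \<omega>' = L \<omega>}" using rp by (auto simp: L_def)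
    moreover have "{\<omega>'. L \<omega>' = L \<omega>} \<in> sets Omega" using sL unfolding simple_Omega_iff by auto
    ultimately have "mass (r (Z \<omega>)) \<le> measure Omega {\<omega>'. L \<omega>' = L \<omega>}"
      unfolding mass_def by (intro Om.finite_measure_mono)
    then show "0 < measure Omega {\<omega>'. L \<omega>' = L \<omega>}" using rp(1)[of "Z \<omega>"] by linarith
  qed
  moreover have "law Z = law L"
  proof (rule distr_cong_AE)
    let ?N = "\<Union>y\<in>{y \<in> range Z. mass y = 0}. {\<omega>. Z \<omega> = y}"
    show "AE \<omega> in Omega. Z \<omega> = L \<omega>"
    proof (rule AE_I)
      show "{\<omega> \<in> space Omega. Z \<omega> \<noteq> L \<omega>} \<subseteq> ?N"
      proof
        fix \<omega> assume "\<omega> \<in> {\<omega> \<in> space Omega. Z \<omega> \<noteq> L \<omega>}"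
        then have "\<not> 0 < mass (Z \<omega>)" by (auto simp: L_def r_def)
        moreover have "0 \<le> mass (Z \<omega>)" by (simp add: mass_def)
        ultimately show "\<omega> \<in> ?N" by auto
      qed
      have "measure Omega ?N \<le> (\<Sum>y\<in>{y \<in> range Z. mass y = 0}. mass y)"
        unfolding mass_def using fin Zm by (intro measure_UNION_le) auto
      then have "measure Omega ?N = 0" by (simp add: measure_le_0_iff)
      then show "emeasure Omega ?N = 0" by (simp add: Om.emeasure_eq_measure)
      show "?N \<in> sets Omega" using fin Zm by auto
    qed
  qed (use Z sL in auto)
  ultimately show ?thesis using that by blast
qed

text \<open>The maps \<open>s i\<close> approximate the identity. The approximating laws are the images of \<open>m\<close> under these maps, so
  they do not depend on the representative at which \<open>h\<close> is differentiable.\<close>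

lemma L_deriv_continuous_approx:
  fixes h :: "'x::euclidean_space measure \<Rightarrow> real"
  assumes h: "has_L_deriv h m (\<lambda>x. blinfun_inner_left (p x))" and p: "p \<in> borel_measurable borel"
    and s: "\<And>i. s i \<in> borel_measurable borel" "\<And>x. (\<lambda>i. s i x) \<longlonglongrightarrow> x" "\<And>i x. norm (s i x) \<le> 2 * norm x"
  shows "(\<lambda>i. h (distr m borel (s i))) \<longlonglongrightarrow> h m"
proof -
  obtain X where X: "sq_integrable X" "law X = m" "sq_integrable (\<lambda>\<omega>. blinfun_inner_left (p (X \<omega>)))"
     and F: "\<And>\<phi> :: real \<Rightarrow>\<^sub>L real. \<And>\<epsilon>. 0 < \<epsilon> \<Longrightarrow> \<exists>\<delta>>0. \<forall>Y. sq_integrable Y \<longrightarrow> l2norm Y < \<delta> \<longrightarrow>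
           \<bar>\<phi> (h (law (\<lambda>\<omega>. X \<omega> + Y \<omega>))) - \<phi> (h (law X))
              - (\<integral>\<omega>. \<phi> (blinfun_inner_left (p (X \<omega>)) (Y \<omega>)) \<partial>Omega)\<bar> \<le> \<epsilon> * l2norm Y"
    using h unfolding has_L_deriv_def by blast
  have Xm: "X \<in> borel_measurable Omega" and Xi: "integrable Omega (\<lambda>\<omega>. (norm (X \<omega>))\<^sup>2)"
    using X(1) by (auto simp: sq_integrable_def)
  have pm: "(\<lambda>\<omega>. p (X \<omega>)) \<in> borel_measurable Omega" by (rule measurable_compose[OF Xm p])
  have pi: "integrable Omega (\<lambda>\<omega>. (norm (p (X \<omega>)))\<^sup>2)"
  proof (rule Bochner_Integration.integrable_bound)
    show "integrable Omega (\<lambda>\<omega>. (norm (blinfun_inner_left (p (X \<omega>))))\<^sup>2)"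
      using X(3) by (simp add: sq_integrable_def)
    have "norm y \<le> norm (blinfun_inner_left y)" for y :: 'x
    proof (cases "y = 0")
      case False
      have "norm y * norm y \<le> norm (blinfun_inner_left y) * norm y"
        using norm_blinfun[of "blinfun_inner_left y" y] by (simp add: dot_square_norm power2_eq_square)
      then show ?thesis using False by simp
    qed simp
    then show "AE \<omega> in Omega. norm ((norm (p (X \<omega>)))\<^sup>2) \<le> norm ((norm (blinfun_inner_left (p (X \<omega>))))\<^sup>2)"
      by (intro AE_I2) (simp add: power_mono)
  qed (use pm in measurable)
  define Y where "Y i \<omega> = s i (X \<omega>) - X \<omega>" for i \<omega>
  have Ym: "Y i \<in> borel_measurable Omega" for i
    unfolding Y_def[abs_def] using measurable_compose[OF Xm s(1)] Xm by measurable
  have Yb: "norm (Y i \<omega>) \<le> 3 * norm (X \<omega>)" for i \<omega>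
    using norm_triangle_ineq4[of "s i (X \<omega>)" "X \<omega>"] s(3)[of i "X \<omega>"] by (simp add: Y_def)
  have Yb2: "(norm (Y i \<omega>))\<^sup>2 \<le> 9 * (norm (X \<omega>))\<^sup>2" for i \<omega>
    using power_mono[OF Yb[of i \<omega>], of 2] by (simp add: power_mult_distrib)
  have Y0: "(\<lambda>i. Y i \<omega>) \<longlonglongrightarrow> 0" for \<omega>
    unfolding Y_def using tendsto_diff[OF s(2)[of "X \<omega>"] tendsto_const[of "X \<omega>"]] by simp
  have b1: "integrable Omega (\<lambda>\<omega>. 9 * (norm (X \<omega>))\<^sup>2)" using Xi by simp
  have Ysq: "sq_integrable (Y i)" for i
    unfolding sq_integrable_def
    using Ym Yb2 by (auto intro!: Bochner_Integration.integrable_bound[OF b1])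
  have "(\<lambda>i. \<integral>\<omega>. (norm (Y i \<omega>))\<^sup>2 \<partial>Omega) \<longlonglongrightarrow> (\<integral>\<omega>. 0 \<partial>Omega)"
  proof (rule integral_dominated_convergence[where w = "\<lambda>\<omega>. 9 * (norm (X \<omega>))\<^sup>2"])
    show "AE \<omega> in Omega. (\<lambda>i. (norm (Y i \<omega>))\<^sup>2) \<longlonglongrightarrow> 0"
    proof (rule AE_I2)
      fix \<omega>
      show "(\<lambda>i. (norm (Y i \<omega>))\<^sup>2) \<longlonglongrightarrow> 0"
        using tendsto_power[OF tendsto_norm[OF Y0[of \<omega>]], where n = 2] by simp
    qed
  qed (use b1 Ym Yb2 in auto)
  then have "(\<lambda>i. sqrt (\<integral>\<omega>. (norm (Y i \<omega>))\<^sup>2 \<partial>Omega)) \<longlonglongrightarrow> sqrt 0"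
    by (intro tendsto_real_sqrt) simp
  then have n0: "(\<lambda>i. l2norm (Y i)) \<longlonglongrightarrow> 0" by (simp add: l2norm_def)
  have i0: "(\<lambda>i. \<integral>\<omega>. Y i \<omega> \<bullet> p (X \<omega>) \<partial>Omega) \<longlonglongrightarrow> (\<integral>\<omega>. 0 \<partial>Omega)"
  proof (rule integral_dominated_convergence[where w = "\<lambda>\<omega>. 9 * (norm (X \<omega>))\<^sup>2 + (norm (p (X \<omega>)))\<^sup>2"])
    show "integrable Omega (\<lambda>\<omega>. 9 * (norm (X \<omega>))\<^sup>2 + (norm (p (X \<omega>)))\<^sup>2)" using b1 pi by simp
    show "(\<lambda>\<omega>. Y i \<omega> \<bullet> p (X \<omega>)) \<in> borel_measurable Omega" for i using Ym pm by measurable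
    show "AE \<omega> in Omega. (\<lambda>i. Y i \<omega> \<bullet> p (X \<omega>)) \<longlonglongrightarrow> 0"
    proof (rule AE_I2)
      fix \<omega>
      show "(\<lambda>i. Y i \<omega> \<bullet> p (X \<omega>)) \<longlonglongrightarrow> 0"
        using tendsto_inner[OF Y0[of \<omega>] tendsto_const[of "p (X \<omega>)"]] by simp
    qed
    show "AE \<omega> in Omega. norm (Y i \<omega> \<bullet> p (X \<omega>)) \<le> 9 * (norm (X \<omega>))\<^sup>2 + (norm (p (X \<omega>)))\<^sup>2" for i
    proof (rule AE_I2)
      fix \<omega>
      have "norm (Y i \<omega> \<bullet> p (X \<omega>)) \<le> norm (Y i \<omega>) * norm (p (X \<omega>))"
        using Cauchy_Schwarz_ineq2 by simp
      also have "\<dots> \<le> (norm (Y i \<omega>))\<^sup>2 + (norm (p (X \<omega>)))\<^sup>2"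
        using sum_squares_bound[of "norm (Y i \<omega>)" "norm (p (X \<omega>))"]
          mult_nonneg_nonneg[OF norm_ge_zero[of "Y i \<omega>"] norm_ge_zero[of "p (X \<omega>)"]] by linarith
      finally show "norm (Y i \<omega> \<bullet> p (X \<omega>)) \<le> 9 * (norm (X \<omega>))\<^sup>2 + (norm (p (X \<omega>)))\<^sup>2"
        using Yb2[of i \<omega>] by linarith
    qed
  qed simp
  have law: "distr m borel (s i) = law (\<lambda>\<omega>. X \<omega> + Y i \<omega>)" for i
    unfolding X(2)[symmetric] using Xm s(1) by (simp add: distr_distr o_def Y_def)
  obtain \<delta> where \<delta>: "0 < \<delta>" "\<And>Y. sq_integrable Y \<Longrightarrow> l2norm Y < \<delta> \<Longrightarrow>
      \<bar>h (law (\<lambda>\<omega>. X \<omega> + Y \<omega>)) - h m - (\<integral>\<omega>. Y \<omega> \<bullet> p (X \<omega>) \<partial>Omega)\<bar> \<le> 1 * l2norm Y"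
    using F[of 1 id_blinfun] X(2) by auto
  have "(\<lambda>i. h (distr m borel (s i)) - h m) \<longlonglongrightarrow> 0"
  proof (rule Lim_null_comparison)
    show "\<forall>\<^sub>F i in sequentially. norm (h (distr m borel (s i)) - h m) \<le> l2norm (Y i) + \<bar>\<integral>\<omega>. Y i \<omega> \<bullet> p (X \<omega>) \<partial>Omega\<bar>"
      using order_tendstoD(2)[OF n0 \<delta>(1)]
    proof eventually_elim
      case (elim i)
      then show ?case using \<delta>(2)[OF Ysq elim] unfolding law real_norm_def by linarith
    qed
    show "(\<lambda>i. l2norm (Y i) + \<bar>\<integral>\<omega>. Y i \<omega> \<bullet> p (X \<omega>) \<partial>Omega\<bar>) \<longlonglongrightarrow> 0"
      using tendsto_add[OF n0 tendsto_rabs[OF i0]] by simp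
  qed
  then show ?thesis by (simp add: LIM_zero_iff)
qed

theorem theorem9p4:
  fixes T :: real
    and f :: "'x::euclidean_space \<Rightarrow> 'x measure \<Rightarrow> 'a::euclidean_space \<Rightarrow> 'x"
    and g :: "'x \<Rightarrow> 'x measure \<Rightarrow> 'a \<Rightarrow> real"
    and k :: "'x \<Rightarrow> 'x measure \<Rightarrow> real"
    and v w :: "real \<Rightarrow> 'x measure \<Rightarrow> real"
    and lam_f Lam_f lbar_f Lip_f lam_g Lam_g lbar_g l_g lam_k Lam_k l_k :: real
  assumes "T > 0"
    and "a1 f lam_f Lam_f lbar_f Lip_f"
    and "a2 g lam_g Lam_g lbar_g l_g"
    and "a3 k lam_k Lam_k l_k"
    and "h1 f g k"
    and "h2 DIM('x) lam_f Lam_f lbar_f lam_g Lam_g lbar_g lam_k Lam_k"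
    and "regular_solution T f g k v"
    and "regular_solution T f g k w"
  shows "\<forall>t\<in>{0..T}. \<forall>m\<in>P2. v t m = w t m"
proof (intro ballI)
  fix t and m :: "'x measure" assume t: "t \<in> {0..T}" and m: "m \<in> P2"
  have grad: "\<exists>p. has_L_deriv (u t) m (\<lambda>x. blinfun_inner_left (p x)) \<and> continuous_on UNIV p"
    if u: "regular_solution T f g k u" and m: "m \<in> P2" for u m
  proof -
    show ?thesis
    proof (rule regular_solutionE[OF u])
      fix ut Du
      assume "\<And>t m. t \<in> {0..T} \<Longrightarrow> m \<in> P2 \<Longrightarrow> has_L_deriv (u t) m (\<lambda>x. blinfun_inner_left (Du t m x))"
        and "\<And>t m. t \<in> {0..T} \<Longrightarrow> m \<in> P2 \<Longrightarrow> continuous_on UNIV (Du t m)"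
      then show ?thesis using t m by (intro exI[of _ "Du t m"]) simp
    qed
  qed
  have rep: "every_law TYPE('x)"
    using grad[OF assms(7)] unfolding every_law_def has_L_deriv_def by meson
  have f: "drift_bounds Lam_f f" by (rule a1_drift_bounds[OF assms(2) rep])
  obtain C where g: "cost_bounds (lam_g / 2) C g" using a2_cost_bounds[OF assms(3) rep] by blast
  have simple_eq: "v t (law Z) = w t (law Z)" if Z: "simple_function Omega Z" for Z :: "real \<Rightarrow> 'x"
  proof -
    obtain L :: "real \<Rightarrow> 'x" where L: "labels L" "law Z = law L" using simple_law_label[OF Z] .
    interpret labels L by (rule L(1))
    have "law_of (\<lambda>y. y) = law Z" by (simp add: law_of_def L(2))
    then show ?thesis
      using solution_le[OF f g assms(7,8) t, of "\<lambda>y. y"] solution_le[OF f g assms(8,7) t, of "\<lambda>y. y"] by simp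
  qed
  have id: "(\<lambda>x::'x. x) \<in> borel_measurable borel" by simp
  from borel_measurable_implies_sequence_metric[OF id, of 0]
  obtain s :: "nat \<Rightarrow> 'x \<Rightarrow> 'x" where s: "\<And>i. simple_function borel (s i)" "\<And>x. (\<lambda>i. s i x) \<longlonglongrightarrow> x"
      "\<And>i x. norm (s i x) \<le> 2 * norm x"
    by (auto simp: dist_norm)
  have sm: "s i \<in> borel_measurable borel" for i using s(1) by (rule borel_measurable_simple_function)
  obtain X where X: "sq_integrable X" "law X = m" by (rule every_lawE[OF rep m])
  have Xm: "X \<in> borel_measurable Omega" using X by (simp add: sq_integrable_def)
  have eq: "v t (distr m borel (s i)) = w t (distr m borel (s i))" for i
  proof -
    have "distr m borel (s i) = law (\<lambda>\<omega>. s i (X \<omega>))"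
      unfolding X(2)[symmetric] using Xm sm by (simp add: distr_distr o_def)
    moreover have "simple_function Omega (\<lambda>\<omega>. s i (X \<omega>))"
      using simple_function_comp[OF Xm s(1)] by (simp add: o_def)
    ultimately show ?thesis using simple_eq by simp
  qed
  have lim: "(\<lambda>i. u t (distr m borel (s i))) \<longlonglongrightarrow> u t m" if "regular_solution T f g k u" for u
    using grad[OF that m] L_deriv_continuous_approx[OF _ _ sm s(2,3)] borel_measurable_continuous_onI by blast
  show "v t m = w t m"
    using LIMSEQ_unique[OF lim[OF assms(7)]] lim[OF assms(8)] unfolding eq by blast
qed

end
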